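(* For every prime number $n$ there exists an element $\eta_n\in C_{n^4}\otimes S_1^n\otimes S_1^n$ such that $$\|\eta_n\|_{C_{n^4}\otimes_{\min} (S_1^n\otimes_{\max} S_1^n)}\leq \sqrt{2}\,n^{\frac{3}{4}}\qquad\text{and}\qquad \|\eta_n\|_{C_{n^4}\otimes_{\min} (S_1^n\otimes_{\mu} S_1^n)}\geq n.$$
   Context: An operator space is a closed subspace $X\subset\mathcal B(H)$ with the induced norms on $M_n(X)\subset \mathcal B(H^{\oplus n})$. The dual $X^*$ carries the operator space structure $M_n(X^* )=CB(X,M_n)$. $C_m=\mathcal B(\mathbb C,\ell_2^m)$ is the $m$-dimensional column operator space. $S_1^n$ is the space of $n\times n$ complex matrices with the trace norm and the operator space structure as the dual of $M_n=S_\infty^n=\mathcal B(\ell_2^n)$. A complete contraction is a linear map of cb norm at most $1$. Minimal tensor product: if $X\subset\mathcal B(H)$, $Y\subset\mathcal B(K)$, then $X\otimes_{\min}Y\subset\mathcal B(H\otimes_2K)$ completely isometrically. Haagerup tensor product: for $w\in M_n(X\otimes Y)$, $\|w\|_{M_n(X\otimes_hY)}=\inf\|u\|_{M_{n,r}(X)}\|v\|_{M_{r,n}(Y)}$, the infimum over $r\in\mathbb N$ and $u,v$ with $w_{i,j}=\sum_{k=1}^r u_{i,k}\otimes v_{k,j}$ for all $i,j$. Symmetrized Haagerup tensor product $X\otimes_\mu Y$: for $w\in M_n(X\otimes Y)$, $$\|w\|_\mu=\inf\{\|w_1\|_{M_n(X\otimes_hY)}+\|w_2^T\|_{M_n(Y\otimes_hX)}:\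 w=w_1+w_2\},$$ where for $w_2=\sum_i a_i\otimes x_i\otimes y_i$ (with $a_i\in M_n$, $x_i\in X$, $y_i\in Y$) one sets $w_2^T=\sum_i a_i\otimes y_i\otimes x_i$. Maximal tensor product $X\otimes_{\max}Y$: for $w\in M_n(X\otimes Y)$, $$\|w\|_{M_n(X\otimes_{\max}Y)}=\sup\|(\mathrm{Id}\otimes T\odot S)(w)\|_{M_n(\mathcal B(H))},$$ the supremum over all complex Hilbert spaces $H$ and all complete contractions $T:X\to\mathcal B(H)$, $S:Y\to\mathcal B(H)$ with $[T(x),S(y)]=[T(x),S(y)^\dagger]=0$ for all $x\in X$, $y\in Y$; here $(T\odot S)(x\otimes y)=T(x)S(y)$ and $[A,B]=AB-BA$. *)

theory Defs
  imports "HOL-Analysis.Analysis" "HOL-Computational_Algebra.Primes"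
begin

section \<open>Hilbert spaces and operators\<close>

text \<open>Complex Hilbert spaces are the spaces \<open>\<ell>\<^sup>2(I)\<close>, for \<open>I\<close> a set of indices (every complex
  Hilbert space is of this form up to a unitary). An operator on \<open>\<ell>\<^sup>2(I)\<close> is a function on
  coordinate families; only its values on \<open>ell2 I\<close> matter.\<close>

definition ell2 :: "'i set \<Rightarrow> ('i \<Rightarrow> complex) set" where
  "ell2 I = {\<xi>. (\<forall>i. i \<notin> I \<longrightarrow> \<xi> i = 0) \<and> (\<lambda>i. (cmod (\<xi> i))\<^sup>2) summable_on UNIV}"

definition l2norm :: "('i \<Rightarrow> complex) \<Rightarrow> real" where
  "l2norm \<xi> = sqrt (\<Sum>\<^sub>\<infinity>i. (cmod (\<xi> i))\<^sup>2)"

definition l2inner :: "('i \<Rightarrow> complex) \<Rightarrow> ('i \<Rightarrow> complex) \<Rightarrow> complex" where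
  "l2inner \<xi> \<zeta> = (\<Sum>\<^sub>\<infinity>i. cnj (\<xi> i) * \<zeta> i)"

definition unit :: "'i \<Rightarrow> 'i \<Rightarrow> complex" where
  "unit a = (\<lambda>b. if b = a then 1 else 0)"

type_synonym 'i oper = "('i \<Rightarrow> complex) \<Rightarrow> ('i \<Rightarrow> complex)"

definition bounded_ops :: "'i set \<Rightarrow> 'i oper set" where
  "bounded_ops I = {A. (\<forall>\<xi>\<in>ell2 I. A \<xi> \<in> ell2 I) \<and>
     (\<forall>\<xi>\<in>ell2 I. \<forall>\<zeta>\<in>ell2 I. \<forall>c. A (\<lambda>i. \<xi> i + c * \<zeta> i) = (\<lambda>i. A \<xi> i + c * A \<zeta> i)) \<and>
     (\<exists>C. \<forall>\<xi>\<in>ell2 I. l2norm (A \<xi>) \<le> C * l2norm \<xi>)}"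

text \<open>The Hilbert space adjoint, in coordinates \<open>\<langle>e\<^sub>i, A\<^sup>\<dagger> \<zeta>\<rangle> = \<langle>A e\<^sub>i, \<zeta>\<rangle>\<close>; see \<open>adj_bounded\<close> and
  \<open>adj_property\<close> below.\<close>

definition adj :: "'i set \<Rightarrow> 'i oper \<Rightarrow> 'i oper" where
  "adj I A = (\<lambda>\<zeta> i. if i \<in> I then l2inner (A (unit i)) \<zeta> else 0)"

text \<open>The norm of a \<open>p \<times> q\<close> matrix of operators, as an operator \<open>\<ell>\<^sup>2(I)\<^sup>\<oplus>\<^sup>q \<rightarrow> \<ell>\<^sup>2(I)\<^sup>\<oplus>\<^sup>p\<close>.\<close>

definition opmat_norm :: "'i set \<Rightarrow> nat \<Rightarrow> nat \<Rightarrow> (nat \<Rightarrow> nat \<Rightarrow> 'i oper) \<Rightarrow> ennreal" where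
  "opmat_norm I p q A =
     (SUP \<xi> \<in> {\<xi> :: nat \<Rightarrow> 'i \<Rightarrow> complex. (\<forall>j<q. \<xi> j \<in> ell2 I) \<and> (\<Sum>j<q. (l2norm (\<xi> j))\<^sup>2) \<le> 1}.
        ennreal (sqrt (\<Sum>i<p. (l2norm (\<lambda>s. \<Sum>j<q. A i j (\<xi> j) s))\<^sup>2)))"

definition mat_op :: "'j set \<Rightarrow> ('j \<Rightarrow> 'j \<Rightarrow> complex) \<Rightarrow> 'j oper" where
  "mat_op J M = (\<lambda>\<xi> s. if s \<in> J then (\<Sum>t\<in>J. M s t * \<xi> t) else 0)"


section \<open>Finite-dimensional operator spaces\<close>

text \<open>A finite-dimensional operator space is given in coordinates, with underlying vector space
  \<open>'a \<Rightarrow> complex\<close>, by its sequence of norms: \<open>X k x\<close> is the norm of the \<open>k \<times> k\<close> matrix \<open>x\<close> in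
  \<open>M\<^sub>k(X)\<close> (entries \<open>x i j\<close> with \<open>i, j < k\<close>). The tensor product of spaces with coordinates in
  \<open>'a\<close> and \<open>'b\<close> has coordinates in \<open>'a \<times> 'b\<close>, with \<open>(x \<otimes> y) (a, b) = x a * y b\<close>.\<close>

type_synonym 'a opspace = "nat \<Rightarrow> (nat \<Rightarrow> nat \<Rightarrow> 'a \<Rightarrow> complex) \<Rightarrow> ennreal"

text \<open>The norm of \<open>M\<^sub>p\<^sub>,\<^sub>q(X)\<close>, whose elements are square matrices padded with zeros.\<close>

definition rect_norm :: "'a opspace \<Rightarrow> nat \<Rightarrow> nat \<Rightarrow> (nat \<Rightarrow> nat \<Rightarrow> 'a \<Rightarrow> complex) \<Rightarrow> ennreal" where
  "rect_norm X p q x = X (max p q) (\<lambda>i j. if i < p \<and> j < q then x i j else (\<lambda>_. 0))"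

definition linear_into :: "'i set \<Rightarrow> (('a \<Rightarrow> complex) \<Rightarrow> 'i oper) \<Rightarrow> bool" where
  "linear_into I T \<longleftrightarrow> (\<forall>x. T x \<in> bounded_ops I) \<and>
     (\<forall>x y c. \<forall>\<xi>\<in>ell2 I. T (\<lambda>a. x a + c * y a) \<xi> = (\<lambda>i. T x \<xi> i + c * T y \<xi> i))"

definition cb_norm :: "'a opspace \<Rightarrow> 'i set \<Rightarrow> (('a \<Rightarrow> complex) \<Rightarrow> 'i oper) \<Rightarrow> ennreal" where
  "cb_norm X I T = (SUP l. SUP x \<in> {x. X l x \<le> 1}. opmat_norm I l l (\<lambda>i j. T (x i j)))"

definition complete_contraction :: "'a opspace \<Rightarrow> 'i set \<Rightarrow> (('a \<Rightarrow> complex) \<Rightarrow> 'i oper) \<Rightarrow> bool" where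
  "complete_contraction X I T \<longleftrightarrow> linear_into I T \<and> cb_norm X I T \<le> 1"

definition completely_isometric :: "'a opspace \<Rightarrow> 'i set \<Rightarrow> (('a \<Rightarrow> complex) \<Rightarrow> 'i oper) \<Rightarrow> bool" where
  "completely_isometric X I T \<longleftrightarrow> linear_into I T \<and>
     (\<forall>k x. opmat_norm I k k (\<lambda>i j. T (x i j)) = X k x)"

text \<open>\<open>M\<^sub>n = B(\<ell>\<^sub>2\<^sup>n)\<close>, with \<open>n = CARD('n)\<close>; the coordinate \<open>(s, t)\<close> is the matrix entry in row \<open>s\<close>
  and column \<open>t\<close>.\<close>

definition M_os :: "('n::finite \<times> 'n) opspace" where
  "M_os k x = opmat_norm UNIV k k (\<lambda>i j. mat_op UNIV (\<lambda>s t. x i j (s, t)))"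

text \<open>The dual: \<open>M\<^sub>k(X\<^sup>*) = CB(X, M\<^sub>k)\<close>, where a functional \<open>f\<close> acts by \<open>x \<mapsto> \<Sum>a. f a * x a\<close>, and
  \<open>M\<^sub>k = B(\<ell>\<^sup>2({..<k}))\<close>.\<close>

definition dual_os :: "('a::finite) opspace \<Rightarrow> 'a opspace" where
  "dual_os X k f = cb_norm X {..<k} (\<lambda>x. mat_op {..<k} (\<lambda>i j. \<Sum>a\<in>UNIV. f i j a * x a))"

text \<open>\<open>S\<^sub>1\<^sup>n\<close> as the dual of \<open>M\<^sub>n\<close> under the trace duality \<open>\<langle>a, x\<rangle> = tr(a x) = \<Sum>s t. a (t, s) * x (s, t)\<close>.\<close>

definition S1_os :: "('n::finite \<times> 'n) opspace" where
  "S1_os k a = dual_os M_os k (\<lambda>i j (s, t). a i j (t, s))"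


section \<open>Tensor products\<close>

text \<open>\<open>C\<^sub>m \<otimes>\<^sub>m\<^sub>i\<^sub>n Z\<close>, for \<open>C\<^sub>m = B(\<complex>, \<ell>\<^sub>2\<^sup>m)\<close> and an element \<open>\<Sum>i<m. e\<^sub>i \<otimes> w i\<close>. If \<open>Z \<subseteq> B(K)\<close>, then this
  space sits in \<open>B(\<complex> \<otimes> K, \<ell>\<^sub>2\<^sup>m \<otimes> K) = B(K, K\<^sup>\<oplus>\<^sup>m)\<close> as the \<open>m \<times> 1\<close> matrices with entries in \<open>Z\<close>, so that
  its norm is that of \<open>M\<^sub>m\<^sub>,\<^sub>1(Z)\<close>; see \<open>col_min_norm_concrete\<close> below.\<close>

definition col_min_norm :: "nat \<Rightarrow> 'a opspace \<Rightarrow> (nat \<Rightarrow> 'a \<Rightarrow> complex) \<Rightarrow> ennreal" where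
  "col_min_norm m Z w = rect_norm Z m 1 (\<lambda>i _. w i)"

definition haagerup :: "'a opspace \<Rightarrow> 'b opspace \<Rightarrow> ('a \<times> 'b) opspace" where
  "haagerup X Y k w =
     (INF (r, u, v) \<in> {(r, u, v). \<forall>i<k. \<forall>j<k. \<forall>a b. w i j (a, b) = (\<Sum>l<r. u i l a * v l j b)}.
        rect_norm X k r u * rect_norm Y r k v)"

definition sym_haagerup :: "'a opspace \<Rightarrow> 'b opspace \<Rightarrow> ('a \<times> 'b) opspace" where
  "sym_haagerup X Y k w =
     (INF (w1, w2) \<in> {(w1, w2). \<forall>i<k. \<forall>j<k. \<forall>c. w i j c = w1 i j c + w2 i j c}.
        haagerup X Y k w1 + haagerup Y X k (\<lambda>i j (b, a). w2 i j (a, b)))"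

definition tensor_op ::
  "(('a::finite \<Rightarrow> complex) \<Rightarrow> 'i oper) \<Rightarrow> (('b::finite \<Rightarrow> complex) \<Rightarrow> 'i oper) \<Rightarrow> ('a \<times> 'b \<Rightarrow> complex) \<Rightarrow> 'i oper"
  where "tensor_op T S w = (\<lambda>\<xi> i. \<Sum>(a, b)\<in>UNIV. w (a, b) * T (unit a) (S (unit b) \<xi>) i)"

definition commuting_pair :: "'a opspace \<Rightarrow> 'b opspace \<Rightarrow> 'i set \<Rightarrow>
    (('a \<Rightarrow> complex) \<Rightarrow> 'i oper) \<Rightarrow> (('b \<Rightarrow> complex) \<Rightarrow> 'i oper) \<Rightarrow> bool" where
  "commuting_pair X Y I T S \<longleftrightarrow> complete_contraction X I T \<and> complete_contraction Y I S \<and>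
     (\<forall>x y. \<forall>\<xi>\<in>ell2 I. T x (S y \<xi>) = S y (T x \<xi>) \<and>
                      T x (adj I (S y) \<xi>) = adj I (S y) (T x \<xi>))"

text \<open>The supremum only ranges over \<open>\<ell>\<^sup>2(I)\<close> with \<open>I\<close> a set of natural numbers, as HOL cannot quantify
  over index types. No Hilbert space is lost: by \<open>max_os_upper\<close> below, the value bounds the
  norms obtained from commuting pairs on \<open>\<ell>\<^sup>2(I)\<close> for \<open>I\<close> a set in any type.\<close>

definition max_os :: "('a::finite) opspace \<Rightarrow> ('b::finite) opspace \<Rightarrow> ('a \<times> 'b) opspace" where
  "max_os X Y k w =
     (SUP (I :: nat set, T, S) \<in> {(I, T, S). commuting_pair X Y I T S}.
        opmat_norm I k k (\<lambda>i j. tensor_op T S (w i j)))"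

section \<open>Consistency of the definitions\<close>

subsection \<open>Adjoints\<close>

lemma ell2_add:
  assumes "\<xi> \<in> ell2 I" "\<zeta> \<in> ell2 I"
  shows "(\<lambda>i. \<xi> i + c * \<zeta> i) \<in> ell2 I"
proof -
  have "(\<lambda>i. (cmod (\<xi> i + c * \<zeta> i))\<^sup>2) summable_on UNIV"
  proof (rule summable_on_comparison_test)
    show "(\<lambda>i. 2 * (cmod (\<xi> i))\<^sup>2 + (2 * (cmod c)\<^sup>2) * (cmod (\<zeta> i))\<^sup>2) summable_on UNIV"
      using assms by (intro summable_on_add summable_on_cmult_right) (auto simp: ell2_def)
    show "(cmod (\<xi> i + c * \<zeta> i))\<^sup>2 \<le> 2 * (cmod (\<xi> i))\<^sup>2 + (2 * (cmod c)\<^sup>2) * (cmod (\<zeta> i))\<^sup>2" for i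
    proof -
      have "cmod (\<xi> i + c * \<zeta> i) \<le> cmod (\<xi> i) + cmod c * cmod (\<zeta> i)"
        by (metis norm_mult norm_triangle_ineq)
      then have "(cmod (\<xi> i + c * \<zeta> i))\<^sup>2 \<le> (cmod (\<xi> i) + cmod c * cmod (\<zeta> i))\<^sup>2"
        by (intro power_mono) auto
      also have "\<dots> \<le> 2 * (cmod (\<xi> i))\<^sup>2 + 2 * (cmod c * cmod (\<zeta> i))\<^sup>2"
        using sum_squares_bound[of "cmod (\<xi> i)" "cmod c * cmod (\<zeta> i)"] by (simp add: power2_sum)
      finally show ?thesis by (simp add: power_mult_distrib)
    qed
  qed auto
  then show ?thesis using assms by (auto simp: ell2_def)
qed

lemma ell2_zero [simp]: "(\<lambda>_. 0) \<in> ell2 I"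
  by (simp add: ell2_def)

lemma ell2_scale: "\<zeta> \<in> ell2 I \<Longrightarrow> (\<lambda>i. c * \<zeta> i) \<in> ell2 I"
  using ell2_add[OF ell2_zero, of \<zeta> I c] by simp

lemma ell2_finite_support: "finite F \<Longrightarrow> F \<subseteq> I \<Longrightarrow> (\<lambda>i. if i \<in> F then f i else 0) \<in> ell2 I"
  by (auto simp: ell2_def intro!: finite_nonzero_values_imp_summable_on elim: finite_subset[rotated])

lemma ell2_unit: "i \<in> I \<Longrightarrow> unit i \<in> ell2 I"
  using ell2_finite_support[of "{i}" I "\<lambda>_. 1"] by (simp add: unit_def)

lemma ell2_mono: "J \<subseteq> I \<Longrightarrow> ell2 J \<subseteq> ell2 I"
  by (auto simp: ell2_def)

lemma l2norm_nonneg [simp]: "0 \<le> l2norm \<xi>"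
  by (simp add: l2norm_def infsum_nonneg)

lemma l2norm_power2: "(l2norm \<xi>)\<^sup>2 = (\<Sum>\<^sub>\<infinity>i. (cmod (\<xi> i))\<^sup>2)"
  by (simp add: l2norm_def infsum_nonneg)

lemma finite_sum_le_l2norm:
  assumes "\<xi> \<in> ell2 I" "finite F"
  shows "L2_set (\<lambda>i. cmod (\<xi> i)) F \<le> l2norm \<xi>"
  unfolding L2_set_def l2norm_def
  using assms by (intro real_sqrt_le_mono finite_sum_le_infsum) (auto simp: ell2_def)

lemma l2inner_abs_summable:
  assumes "\<xi> \<in> ell2 I" "\<zeta> \<in> ell2 I"
  shows "(\<lambda>i. cmod (cnj (\<xi> i) * \<zeta> i)) summable_on UNIV"
proof (rule Infinite_Sum.abs_summable_on_comparison_test')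
  show "(\<lambda>i. (cmod (\<xi> i))\<^sup>2 + (cmod (\<zeta> i))\<^sup>2) summable_on UNIV"
    using assms by (intro summable_on_add) (auto simp: ell2_def)
  show "cmod (cnj (\<xi> i) * \<zeta> i) \<le> (cmod (\<xi> i))\<^sup>2 + (cmod (\<zeta> i))\<^sup>2" for i
  proof -
    have "0 \<le> cmod (\<xi> i) * cmod (\<zeta> i)" by simp
    then have "cmod (\<xi> i) * cmod (\<zeta> i) \<le> (cmod (\<xi> i))\<^sup>2 + (cmod (\<zeta> i))\<^sup>2"
      using sum_squares_bound[of "cmod (\<xi> i)" "cmod (\<zeta> i)"] by linarith
    then show ?thesis by (simp add: norm_mult)
  qed
qed

lemma l2inner_cauchy_schwarz:
  assumes "\<xi> \<in> ell2 I" "\<zeta> \<in> ell2 I"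
  shows "cmod (l2inner \<xi> \<zeta>) \<le> l2norm \<xi> * l2norm \<zeta>"
proof -
  have "cmod (l2inner \<xi> \<zeta>) \<le> (\<Sum>\<^sub>\<infinity>i. cmod (cnj (\<xi> i) * \<zeta> i))"
    unfolding l2inner_def by (rule norm_infsum_bound[OF l2inner_abs_summable[OF assms]])
  also have "\<dots> \<le> l2norm \<xi> * l2norm \<zeta>"
  proof (rule infsum_le_finite_sums[OF l2inner_abs_summable[OF assms]])
    fix F :: "'a set" assume "finite F"
    have "(\<Sum>i\<in>F. cmod (cnj (\<xi> i) * \<zeta> i)) \<le> L2_set (\<lambda>i. cmod (\<xi> i)) F * L2_set (\<lambda>i. cmod (\<zeta> i)) F"
      using L2_set_mult_ineq[of "\<lambda>i. cmod (\<xi> i)" "\<lambda>i. cmod (\<zeta> i)" F] by (simp add: norm_mult)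
    also have "\<dots> \<le> l2norm \<xi> * l2norm \<zeta>"
      using assms \<open>finite F\<close> by (intro mult_mono finite_sum_le_l2norm) auto
    finally show "(\<Sum>i\<in>F. cmod (cnj (\<xi> i) * \<zeta> i)) \<le> l2norm \<xi> * l2norm \<zeta>" .
  qed
  finally show ?thesis .
qed

lemma l2inner_add:
  assumes "\<xi> \<in> ell2 I" "\<zeta> \<in> ell2 I" "\<zeta>' \<in> ell2 I"
  shows "l2inner \<xi> (\<lambda>i. \<zeta> i + c * \<zeta>' i) = l2inner \<xi> \<zeta> + c * l2inner \<xi> \<zeta>'"
proof -
  have "l2inner \<xi> (\<lambda>i. \<zeta> i + c * \<zeta>' i) = (\<Sum>\<^sub>\<infinity>i. cnj (\<xi> i) * \<zeta> i + c * (cnj (\<xi> i) * \<zeta>' i))"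
    by (simp add: l2inner_def algebra_simps)
  also have "\<dots> = (\<Sum>\<^sub>\<infinity>i. cnj (\<xi> i) * \<zeta> i) + (\<Sum>\<^sub>\<infinity>i. c * (cnj (\<xi> i) * \<zeta>' i))"
    by (rule infsum_add[OF abs_summable_summable[OF l2inner_abs_summable[OF assms(1,2)]]
          summable_on_cmult_right[OF abs_summable_summable[OF l2inner_abs_summable[OF assms(1,3)]]]])
  also have "\<dots> = l2inner \<xi> \<zeta> + c * l2inner \<xi> \<zeta>'"
    by (simp add: l2inner_def infsum_cmult_right')
  finally show ?thesis .
qed

lemma l2inner_cnj: "cnj (l2inner \<xi> \<zeta>) = l2inner \<zeta> \<xi>"
  by (simp add: l2inner_def mult.commute flip: infsum_cnj)

lemma l2inner_unit: "l2inner (unit i) \<zeta> = \<zeta> i"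
proof -
  have "l2inner (unit i) \<zeta> = (\<Sum>\<^sub>\<infinity>j\<in>{i}. cnj (unit i j) * \<zeta> j)"
    unfolding l2inner_def by (rule infsum_cong_neutral) (auto simp: unit_def)
  then show ?thesis by (simp add: unit_def)
qed

lemma bounded_opsD:
  assumes "A \<in> bounded_ops I"
  shows "\<And>\<xi>. \<xi> \<in> ell2 I \<Longrightarrow> A \<xi> \<in> ell2 I"
    and "\<And>\<xi> \<zeta> c. \<xi> \<in> ell2 I \<Longrightarrow> \<zeta> \<in> ell2 I \<Longrightarrow> A (\<lambda>i. \<xi> i + c * \<zeta> i) = (\<lambda>i. A \<xi> i + c * A \<zeta> i)"
  using assms by (auto simp: bounded_ops_def)

lemma bounded_ops_bound:
  assumes "A \<in> bounded_ops I"
  obtains C where "C \<ge> 0" "\<And>\<xi>. \<xi> \<in> ell2 I \<Longrightarrow> l2norm (A \<xi>) \<le> C * l2norm \<xi>"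
proof -
  obtain C where C: "\<And>\<xi>. \<xi> \<in> ell2 I \<Longrightarrow> l2norm (A \<xi>) \<le> C * l2norm \<xi>"
    using assms unfolding bounded_ops_def by blast
  have "l2norm (A \<xi>) \<le> max C 0 * l2norm \<xi>" if "\<xi> \<in> ell2 I" for \<xi>
    by (rule order_trans[OF C[OF that]]) (simp add: mult_right_mono)
  then show ?thesis by (intro that[of "max C 0"]) auto
qed

lemma bounded_ops_zero:
  assumes "A \<in> bounded_ops I"
  shows "A (\<lambda>_. 0) = (\<lambda>_. 0)"
proof -
  have "A (\<lambda>_. 0) = (\<lambda>i. A (\<lambda>_. 0) i + 1 * A (\<lambda>_. 0) i)"
    using bounded_opsD(2)[OF assms ell2_zero ell2_zero, of 1] by simp
  then have "A (\<lambda>_. 0) i = A (\<lambda>_. 0) i + A (\<lambda>_. 0) i" for i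
    by (metis mult_1)
  then show ?thesis by (intro ext) simp
qed

lemma l2inner_finite:
  assumes A: "A \<in> bounded_ops I" and F: "finite F" "F \<subseteq> I" and \<zeta>: "\<zeta> \<in> ell2 I"
  shows "l2inner (A (\<lambda>i. if i \<in> F then f i else 0)) \<zeta> = (\<Sum>i\<in>F. cnj (f i) * adj I A \<zeta> i)"
  using F
proof (induction F rule: finite_induct)
  case empty
  then show ?case using bounded_ops_zero[OF A] by (simp add: l2inner_def)
next
  case (insert j F)
  let ?g = "\<lambda>i. if i \<in> F then f i else 0"
  have g: "?g \<in> ell2 I" "unit j \<in> ell2 I" using insert by (auto intro: ell2_finite_support ell2_unit)
  have "(\<lambda>i. if i \<in> insert j F then f i else 0) = (\<lambda>i. ?g i + f j * unit j i)"
    using insert by (auto simp: unit_def fun_eq_iff)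
  then have "A (\<lambda>i. if i \<in> insert j F then f i else 0) = (\<lambda>i. A ?g i + f j * A (unit j) i)"
    using bounded_opsD(2)[OF A g] by simp
  then have "l2inner (A (\<lambda>i. if i \<in> insert j F then f i else 0)) \<zeta> =
      cnj (l2inner \<zeta> (\<lambda>i. A ?g i + f j * A (unit j) i))"
    by (simp add: l2inner_cnj)
  also have "\<dots> = l2inner (A ?g) \<zeta> + cnj (f j) * l2inner (A (unit j)) \<zeta>"
    by (subst l2inner_add) (use A g \<zeta> in \<open>auto simp: l2inner_cnj intro: bounded_opsD(1)\<close>)
  finally show ?case using insert by (simp add: adj_def)
qed

lemma l2norm_finite:
  assumes "finite F"
  shows "l2norm (\<lambda>i. if i \<in> F then f i else 0) = L2_set (\<lambda>i. cmod (f i)) F"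
proof -
  have "(\<Sum>\<^sub>\<infinity>i. (cmod (if i \<in> F then f i else 0))\<^sup>2) = (\<Sum>\<^sub>\<infinity>i\<in>F. (cmod (f i))\<^sup>2)"
    by (rule infsum_cong_neutral) auto
  then show ?thesis using assms by (simp add: l2norm_def L2_set_def)
qed

lemma adj_l2:
  assumes A: "A \<in> bounded_ops I" and \<zeta>: "\<zeta> \<in> ell2 I"
    and C: "C \<ge> 0" "\<And>\<xi>. \<xi> \<in> ell2 I \<Longrightarrow> l2norm (A \<xi>) \<le> C * l2norm \<xi>"
  shows "adj I A \<zeta> \<in> ell2 I" "l2norm (adj I A \<zeta>) \<le> C * l2norm \<zeta>"
proof -
  let ?B = "(C * l2norm \<zeta>)\<^sup>2"
  have bd: "(\<Sum>i\<in>F. (cmod (adj I A \<zeta> i))\<^sup>2) \<le> ?B" if F: "finite F" for F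
  proof -
    let ?G = "F \<inter> I" let ?a = "adj I A \<zeta>"
    let ?g = "\<lambda>i. if i \<in> ?G then ?a i else 0"
    let ?L = "L2_set (\<lambda>i. cmod (?a i)) ?G"
    have G: "finite ?G" "?G \<subseteq> I" using F by auto
    have g: "?g \<in> ell2 I" using G by (rule ell2_finite_support)
    have "?L\<^sup>2 = (\<Sum>i\<in>?G. (cmod (?a i))\<^sup>2)" by (simp add: L2_set_def sum_nonneg)
    moreover have "complex_of_real (\<Sum>i\<in>?G. (cmod (?a i))\<^sup>2) = l2inner (A ?g) \<zeta>"
      by (simp only: l2inner_finite[OF A G \<zeta>] of_real_sum complex_norm_square mult.commute)
    ultimately have "cmod (complex_of_real (?L\<^sup>2)) \<le> l2norm (A ?g) * l2norm \<zeta>"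
      using l2inner_cauchy_schwarz[OF bounded_opsD(1)[OF A g] \<zeta>] by simp
    then have "?L\<^sup>2 \<le> l2norm (A ?g) * l2norm \<zeta>" by (simp only: norm_of_real)
    also have "\<dots> \<le> (C * ?L) * l2norm \<zeta>"
      using C(2)[OF g] l2norm_finite[OF G(1), of ?a] by (intro mult_right_mono) auto
    finally have *: "?L\<^sup>2 \<le> (C * l2norm \<zeta>) * ?L" by (simp add: mult_ac)
    have "?L \<le> C * l2norm \<zeta>"
    proof (cases "?L = 0")
      case True then show ?thesis using C(1) by simp
    next
      case False
      then have "?L > 0" using L2_set_nonneg[of "\<lambda>i. cmod (?a i)" ?G] by linarith
      then show ?thesis using * by (simp add: power2_eq_square)
    qed
    then have "?L\<^sup>2 \<le> ?B" by (intro power_mono) auto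
    moreover have "(\<Sum>i\<in>F. (cmod (?a i))\<^sup>2) = (\<Sum>i\<in>?G. (cmod (?a i))\<^sup>2)"
      using F by (intro sum.mono_neutral_right) (auto simp: adj_def)
    ultimately show ?thesis by (simp add: L2_set_def sum_nonneg)
  qed
  have s: "(\<lambda>i. (cmod (adj I A \<zeta> i))\<^sup>2) summable_on UNIV"
    by (rule nonneg_bdd_above_summable_on) (auto intro!: bdd_aboveI2[where M = ?B] bd)
  then show "adj I A \<zeta> \<in> ell2 I" by (auto simp: ell2_def adj_def)
  have "(l2norm (adj I A \<zeta>))\<^sup>2 \<le> ?B"
    unfolding l2norm_power2 by (rule infsum_le_finite_sums[OF s]) (auto intro: bd)
  then show "l2norm (adj I A \<zeta>) \<le> C * l2norm \<zeta>"
    by (rule power2_le_imp_le) (use C(1) in simp)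
qed

lemma adj_bounded:
  assumes A: "A \<in> bounded_ops I"
  shows "adj I A \<in> bounded_ops I"
proof -
  obtain C where C: "C \<ge> 0" "\<And>\<xi>. \<xi> \<in> ell2 I \<Longrightarrow> l2norm (A \<xi>) \<le> C * l2norm \<xi>"
    using bounded_ops_bound[OF A] by metis
  have "adj I A (\<lambda>i. \<xi> i + c * \<zeta> i) = (\<lambda>i. adj I A \<xi> i + c * adj I A \<zeta> i)"
    if "\<xi> \<in> ell2 I" "\<zeta> \<in> ell2 I" for \<xi> \<zeta> c
    using l2inner_add[OF bounded_opsD(1)[OF A ell2_unit] that] by (auto simp: adj_def fun_eq_iff)
  then show ?thesis
    using adj_l2[OF A _ C] unfolding bounded_ops_def by blast
qed

lemma adj_property:
  assumes A: "A \<in> bounded_ops I" and \<xi>: "\<xi> \<in> ell2 I" and \<zeta>: "\<zeta> \<in> ell2 I"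
  shows "l2inner (A \<xi>) \<zeta> = l2inner \<xi> (adj I A \<zeta>)"
proof -
  obtain C where C: "C \<ge> 0" "\<And>\<xi>. \<xi> \<in> ell2 I \<Longrightarrow> l2norm (A \<xi>) \<le> C * l2norm \<xi>"
    using bounded_ops_bound[OF A] by metis
  define s where "s = (\<lambda>F. \<Sum>i\<in>F. cnj (\<xi> i) * adj I A \<zeta> i)"
  have "((\<lambda>i. cnj (\<xi> i) * adj I A \<zeta> i) has_sum l2inner \<xi> (adj I A \<zeta>)) UNIV"
    unfolding l2inner_def
    by (rule has_sum_infsum[OF abs_summable_summable[OF l2inner_abs_summable[OF \<xi> adj_l2(1)[OF A \<zeta> C]]]])
  then have lim1: "(s \<longlongrightarrow> l2inner \<xi> (adj I A \<zeta>)) (finite_subsets_at_top UNIV)"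
    by (simp add: has_sum_def s_def)
  define q where "q = (\<lambda>F. \<Sum>i\<in>F. (cmod (\<xi> i))\<^sup>2)"
  have "((\<lambda>i. (cmod (\<xi> i))\<^sup>2) has_sum (l2norm \<xi>)\<^sup>2) UNIV"
    unfolding l2norm_power2 by (rule has_sum_infsum) (use \<xi> in \<open>auto simp: ell2_def\<close>)
  then have q: "(q \<longlongrightarrow> (l2norm \<xi>)\<^sup>2) (finite_subsets_at_top UNIV)"
    by (simp add: has_sum_def q_def)
  have "((\<lambda>F. C * sqrt ((l2norm \<xi>)\<^sup>2 - q F) * l2norm \<zeta>) \<longlongrightarrow> C * sqrt ((l2norm \<xi>)\<^sup>2 - (l2norm \<xi>)\<^sup>2) * l2norm \<zeta>)
      (finite_subsets_at_top UNIV)"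
    by (intro tendsto_intros q)
  then have lim0: "((\<lambda>F. C * sqrt ((l2norm \<xi>)\<^sup>2 - q F) * l2norm \<zeta>) \<longlongrightarrow> 0) (finite_subsets_at_top UNIV)"
    by simp
  have est: "cmod (l2inner (A \<xi>) \<zeta> - s F) \<le> C * sqrt ((l2norm \<xi>)\<^sup>2 - q F) * l2norm \<zeta>" if F: "finite F" for F
  proof -
    let ?G = "F \<inter> I"
    let ?g = "\<lambda>i. if i \<in> ?G then \<xi> i else 0"
    let ?h = "\<lambda>i. \<xi> i + (- 1) * ?g i"
    have G: "finite ?G" "?G \<subseteq> I" using F by auto
    have g: "?g \<in> ell2 I" by (rule ell2_finite_support[OF G])
    have h: "?h \<in> ell2 I" by (rule ell2_add[OF \<xi> g])
    have sF: "s F = l2inner (A ?g) \<zeta>"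
      unfolding l2inner_finite[OF A G \<zeta>] s_def
      using F by (intro sum.mono_neutral_right) (auto simp: adj_def)
    have "l2inner (A ?h) \<zeta> = cnj (l2inner \<zeta> (\<lambda>i. A \<xi> i + (- 1) * A ?g i))"
      by (simp only: l2inner_cnj bounded_opsD(2)[OF A \<xi> g])
    also have "\<dots> = l2inner (A \<xi>) \<zeta> - s F"
      by (subst l2inner_add[OF \<zeta> bounded_opsD(1)[OF A \<xi>] bounded_opsD(1)[OF A g]])
        (simp add: l2inner_cnj sF)
    finally have "cmod (l2inner (A \<xi>) \<zeta> - s F) \<le> l2norm (A ?h) * l2norm \<zeta>"
      using l2inner_cauchy_schwarz[OF bounded_opsD(1)[OF A h] \<zeta>] by simp
    also have "\<dots> \<le> C * l2norm ?h * l2norm \<zeta>"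
      by (intro mult_right_mono C(2)[OF h]) simp
    also have "(l2norm ?h)\<^sup>2 = (l2norm \<xi>)\<^sup>2 - q F"
    proof -
      have "(\<Sum>\<^sub>\<infinity>i. (cmod (?h i))\<^sup>2) = (\<Sum>\<^sub>\<infinity>i\<in>UNIV - F. (cmod (\<xi> i))\<^sup>2)"
        using \<xi> by (intro infsum_cong_neutral) (auto simp: ell2_def)
      also have "\<dots> = (\<Sum>\<^sub>\<infinity>i. (cmod (\<xi> i))\<^sup>2) - (\<Sum>\<^sub>\<infinity>i\<in>F. (cmod (\<xi> i))\<^sup>2)"
        using F \<xi> by (intro infsum_Diff) (auto simp: ell2_def)
      finally show ?thesis using F by (simp add: l2norm_power2 q_def)
    qed
    then have "l2norm ?h = sqrt ((l2norm \<xi>)\<^sup>2 - q F)" by (metis l2norm_nonneg real_sqrt_unique)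
    finally show ?thesis .
  qed
  have "((\<lambda>F. l2inner (A \<xi>) \<zeta> - s F) \<longlongrightarrow> 0) (finite_subsets_at_top UNIV)"
    by (rule Lim_null_comparison[OF _ lim0]) (auto intro!: eventually_finite_subsets_at_top_weakI est)
  from tendsto_diff[OF tendsto_const[of "l2inner (A \<xi>) \<zeta>"] this]
  have "(s \<longlongrightarrow> l2inner (A \<xi>) \<zeta>) (finite_subsets_at_top UNIV)" by simp
  then show ?thesis using lim1 by (rule tendsto_unique[rotated]) simp
qed

subsection \<open>The minimal tensor product with a column space\<close>

lemma linear_into_add:
  "linear_into I T \<Longrightarrow> \<xi> \<in> ell2 I \<Longrightarrow> T (\<lambda>a. x a + c * y a) \<xi> = (\<lambda>i. T x \<xi> i + c * T y \<xi> i)"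
  by (simp add: linear_into_def)

lemma linear_into_zero:
  assumes "linear_into I T" "\<xi> \<in> ell2 I"
  shows "T (\<lambda>_. 0) \<xi> = (\<lambda>_. 0)"
proof -
  have "T (\<lambda>_. 0) \<xi> = (\<lambda>i. T (\<lambda>_. 0) \<xi> i + 1 * T (\<lambda>_. 0) \<xi> i)"
    using linear_into_add[OF assms, of "\<lambda>_. 0" 1 "\<lambda>_. 0"] by simp
  then have "T (\<lambda>_. 0) \<xi> i = T (\<lambda>_. 0) \<xi> i + T (\<lambda>_. 0) \<xi> i" for i
    by (metis mult_1)
  then show ?thesis by (intro ext) simp
qed

lemma opmat_norm_upper:
  assumes "\<And>j. j < q \<Longrightarrow> \<xi> j \<in> ell2 I" "(\<Sum>j<q. (l2norm (\<xi> j))\<^sup>2) \<le> 1"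
  shows "ennreal (sqrt (\<Sum>i<p. (l2norm (\<lambda>s. \<Sum>j<q. A i j (\<xi> j) s))\<^sup>2)) \<le> opmat_norm I p q A"
  unfolding opmat_norm_def using assms by (intro SUP_upper2[of \<xi>]) auto

lemma opmat_norm_least:
  assumes "\<And>\<xi>. (\<And>j. j < q \<Longrightarrow> \<xi> j \<in> ell2 I) \<Longrightarrow> (\<Sum>j<q. (l2norm (\<xi> j))\<^sup>2) \<le> 1 \<Longrightarrow>
    ennreal (sqrt (\<Sum>i<p. (l2norm (\<lambda>s. \<Sum>j<q. A i j (\<xi> j) s))\<^sup>2)) \<le> C"
  shows "opmat_norm I p q A \<le> C"
  unfolding opmat_norm_def using assms by (intro SUP_least) auto

lemma l2norm_zero [simp]: "l2norm (\<lambda>_. 0) = 0"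
  by (simp add: l2norm_def)

lemma col_min_norm_concrete:
  assumes J: "completely_isometric Z I J" and m: "m > 0"
  shows "col_min_norm m Z w = opmat_norm I m 1 (\<lambda>i _. J (w i))"
proof -
  have lin: "linear_into I J" using J by (simp add: completely_isometric_def)
  let ?x = "\<lambda>i j. if i < m \<and> j < (1::nat) then w i else (\<lambda>_. 0)"
  have "max m 1 = m" using m by simp
  then have "col_min_norm m Z w = opmat_norm I m m (\<lambda>i j. J (?x i j))"
    using J by (simp only: col_min_norm_def rect_norm_def completely_isometric_def)
  also have "\<dots> = opmat_norm I m 1 (\<lambda>i _. J (w i))"
  proof -
    obtain m' where m': "m = Suc m'" using m by (cases m) auto
    have val: "(\<lambda>s. \<Sum>j<m. J (?x i j) (\<xi> j) s) = (\<lambda>s. \<Sum>j<(1::nat). J (w i) (\<xi> j) s)"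
      if "i < m" "\<And>j. j < m \<Longrightarrow> \<xi> j \<in> ell2 I" for i \<xi>
    proof
      fix s
      have "(\<Sum>j<m. J (?x i j) (\<xi> j) s) = (\<Sum>j\<in>{0}. J (?x i j) (\<xi> j) s)"
        using m that(2) by (intro sum.mono_neutral_right) (auto simp: linear_into_zero[OF lin])
      then show "(\<Sum>j<m. J (?x i j) (\<xi> j) s) = (\<Sum>j<(1::nat). J (w i) (\<xi> j) s)"
        using that(1) by simp
    qed
    have vals: "(\<Sum>i<m. (l2norm (\<lambda>s. \<Sum>j<m. J (?x i j) (\<xi> j) s))\<^sup>2) =
        (\<Sum>i<m. (l2norm (\<lambda>s. \<Sum>j<(1::nat). J (w i) (\<xi> j) s))\<^sup>2)"
      if "\<And>j. j < m \<Longrightarrow> \<xi> j \<in> ell2 I" for \<xi>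
    proof (rule sum.cong[OF refl])
      fix i assume "i \<in> {..<m}"
      then have "i < m" by simp
      show "(l2norm (\<lambda>s. \<Sum>j<m. J (?x i j) (\<xi> j) s))\<^sup>2 =
          (l2norm (\<lambda>s. \<Sum>j<(1::nat). J (w i) (\<xi> j) s))\<^sup>2"
        by (simp only: val[OF \<open>i < m\<close> that])
    qed
    show ?thesis
    proof (rule antisym; rule opmat_norm_least)
      fix \<xi> :: "nat \<Rightarrow> 'b \<Rightarrow> complex"
      assume \<xi>: "\<And>j. j < m \<Longrightarrow> \<xi> j \<in> ell2 I" "(\<Sum>j<m. (l2norm (\<xi> j))\<^sup>2) \<le> 1"
      have "(\<Sum>j<(1::nat). (l2norm (\<xi> j))\<^sup>2) \<le> (\<Sum>j<m. (l2norm (\<xi> j))\<^sup>2)"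
        using m by (intro sum_mono2) auto
      then have *: "(\<Sum>j<(1::nat). (l2norm (\<xi> j))\<^sup>2) \<le> 1" using \<xi>(2) by linarith
      show "ennreal (sqrt (\<Sum>i<m. (l2norm (\<lambda>s. \<Sum>j<m. J (?x i j) (\<xi> j) s))\<^sup>2))
          \<le> opmat_norm I m 1 (\<lambda>i _. J (w i))"
        using opmat_norm_upper[where I = I and p = m and A = "\<lambda>i _. J (w i)", OF _ *] \<xi>(1) m by (simp only: vals[OF \<xi>(1)])
    next
      fix \<xi> :: "nat \<Rightarrow> 'b \<Rightarrow> complex"
      assume \<xi>: "\<And>j. j < 1 \<Longrightarrow> \<xi> j \<in> ell2 I" "(\<Sum>j<(1::nat). (l2norm (\<xi> j))\<^sup>2) \<le> 1"
      define \<xi>' where "\<xi>' = (\<lambda>j. if j < (1::nat) then \<xi> j else (\<lambda>_. 0))"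
      have \<xi>'1: "\<xi>' j \<in> ell2 I" for j using \<xi>(1) by (simp add: \<xi>'_def)
      have "(\<Sum>j<m. (l2norm (\<xi>' j))\<^sup>2) = (\<Sum>j<(1::nat). (l2norm (\<xi>' j))\<^sup>2)"
        using m by (intro sum.mono_neutral_right) (auto simp: \<xi>'_def)
      then have \<xi>'2: "(\<Sum>j<m. (l2norm (\<xi>' j))\<^sup>2) \<le> 1" using \<xi>(2) by (simp add: \<xi>'_def)
      show "ennreal (sqrt (\<Sum>i<m. (l2norm (\<lambda>s. \<Sum>j<1. J (w i) (\<xi> j) s))\<^sup>2))
          \<le> opmat_norm I m m (\<lambda>i j. J (?x i j))"
        using opmat_norm_upper[where p = m and A = "\<lambda>i j. J (?x i j)", OF \<xi>'1 \<xi>'2]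
        unfolding vals[of \<xi>', OF \<xi>'1] by (simp add: \<xi>'_def)
    qed
  qed
  finally show ?thesis .
qed

subsection \<open>The maximal tensor product sees every Hilbert space\<close>

lemma countable_support:
  assumes "\<xi> \<in> ell2 I"
  shows "countable {i. \<xi> i \<noteq> 0}"
proof -
  have "countable {i\<in>UNIV. (cmod (\<xi> i))\<^sup>2 \<noteq> 0}"
    using assms by (intro summable_countable_real) (auto simp: ell2_def)
  then show ?thesis by simp
qed

lemma ell2I: "\<xi> \<in> ell2 I \<Longrightarrow> (\<And>i. \<xi> i \<noteq> 0 \<Longrightarrow> i \<in> J) \<Longrightarrow> \<xi> \<in> ell2 J"
  by (auto simp: ell2_def)

lemma ell2D: "\<xi> \<in> ell2 I \<Longrightarrow> i \<notin> I \<Longrightarrow> \<xi> i = 0"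
  by (auto simp: ell2_def)

lemma adj_unit: "i \<in> I \<Longrightarrow> adj I A (unit j) i = cnj (A (unit i) j)"
  by (simp add: adj_def l2inner_unit flip: l2inner_cnj[of "unit j"])

lemma bounded_ops_invariant:
  assumes A: "A \<in> bounded_ops I" and J: "J \<subseteq> I"
    and cols: "\<And>j i. j \<in> J \<Longrightarrow> i \<notin> J \<Longrightarrow> A (unit j) i = 0" and \<xi>: "\<xi> \<in> ell2 J"
  shows "A \<xi> \<in> ell2 J"
proof -
  have \<xi>I: "\<xi> \<in> ell2 I" using \<xi> ell2_mono[OF J] by auto
  have AI: "A \<xi> \<in> ell2 I" by (rule bounded_opsD(1)[OF A \<xi>I])
  have "A \<xi> i = 0" if i: "i \<notin> J" for i
  proof (cases "i \<in> I")
    case True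
    have z: "cnj (\<xi> j) * adj I A (unit i) j = 0" for j
    proof (cases "j \<in> J")
      case j: True
      then have "j \<in> I" using J by auto
      then show ?thesis using cols[OF j i] by (simp add: adj_unit)
    qed (simp add: ell2D[OF \<xi>])
    have "cnj (A \<xi> i) = l2inner (A \<xi>) (unit i)"
      by (simp add: l2inner_unit flip: l2inner_cnj[of "unit i"])
    also have "\<dots> = l2inner \<xi> (adj I A (unit i))"
      by (rule adj_property[OF A \<xi>I ell2_unit[OF True]])
    also have "\<dots> = 0" by (simp only: l2inner_def z infsum_0_simp)
    finally show ?thesis by simp
  qed (rule ell2D[OF AI])
  then have "i \<in> J" if "A \<xi> i \<noteq> 0" for i using that by metis
  then show ?thesis by (rule ell2I[OF AI])
qed

lemma bounded_ops_restrict: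
  assumes "A \<in> bounded_ops I" "J \<subseteq> I" "\<And>\<xi>. \<xi> \<in> ell2 J \<Longrightarrow> A \<xi> \<in> ell2 J"
  shows "A \<in> bounded_ops J"
proof -
  have sub: "\<xi> \<in> ell2 I" if "\<xi> \<in> ell2 J" for \<xi> using that ell2_mono[OF assms(2)] by auto
  obtain C where "\<And>\<xi>. \<xi> \<in> ell2 I \<Longrightarrow> l2norm (A \<xi>) \<le> C * l2norm \<xi>"
    using bounded_ops_bound[OF assms(1)] by metis
  then have "\<forall>\<xi>\<in>ell2 J. l2norm (A \<xi>) \<le> C * l2norm \<xi>" using sub by simp
  then show ?thesis
    using assms(3) bounded_opsD(2)[OF assms(1) sub sub] unfolding bounded_ops_def by blast
qed

lemma adj_restrict:
  assumes "J \<subseteq> I" "adj I A \<zeta> \<in> ell2 J"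
  shows "adj J A \<zeta> = adj I A \<zeta>"
proof
  fix i show "adj J A \<zeta> i = adj I A \<zeta> i"
    using assms ell2D[OF assms(2), of i] by (auto simp: adj_def)
qed

lemma opmat_norm_restrict: "J \<subseteq> I \<Longrightarrow> opmat_norm J p q A \<le> opmat_norm I p q A"
  using ell2_mono[of J I] by (intro opmat_norm_least opmat_norm_upper) auto

lemma complete_contraction_restrict:
  assumes T: "complete_contraction X I T" and J: "J \<subseteq> I" and inv: "\<And>x \<xi>. \<xi> \<in> ell2 J \<Longrightarrow> T x \<xi> \<in> ell2 J"
  shows "complete_contraction X J T"
proof -
  have lin: "linear_into I T" using T by (simp add: complete_contraction_def)
  have "T x \<in> bounded_ops J" for x
    by (rule bounded_ops_restrict[OF _ J inv]) (use lin in \<open>simp_all add: linear_into_def\<close>)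
  moreover have "T (\<lambda>a. x a + c * y a) \<xi> = (\<lambda>i. T x \<xi> i + c * T y \<xi> i)" if "\<xi> \<in> ell2 J" for x y c \<xi>
    by (rule linear_into_add[OF lin]) (use that ell2_mono[OF J] in blast)
  ultimately have "linear_into J T" by (simp add: linear_into_def)
  moreover have "cb_norm X J T \<le> cb_norm X I T"
    unfolding cb_norm_def by (intro SUP_mono' opmat_norm_restrict[OF J])
  ultimately show ?thesis using T by (auto simp: complete_contraction_def)
qed

lemma commuting_pair_restrict:
  assumes TS: "commuting_pair X Y I T S" and J: "J \<subseteq> I"
    and inv: "\<And>x \<xi>. \<xi> \<in> ell2 J \<Longrightarrow> T x \<xi> \<in> ell2 J" "\<And>y \<xi>. \<xi> \<in> ell2 J \<Longrightarrow> S y \<xi> \<in> ell2 J"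
      "\<And>y \<xi>. \<xi> \<in> ell2 J \<Longrightarrow> adj I (S y) \<xi> \<in> ell2 J"
  shows "commuting_pair X Y J T S"
proof -
  have T: "complete_contraction X I T" and S: "complete_contraction Y I S"
    and comm: "\<And>x y \<xi>. \<xi> \<in> ell2 I \<Longrightarrow> T x (S y \<xi>) = S y (T x \<xi>)"
      "\<And>x y \<xi>. \<xi> \<in> ell2 I \<Longrightarrow> T x (adj I (S y) \<xi>) = adj I (S y) (T x \<xi>)"
    using TS by (auto simp: commuting_pair_def)
  have sub: "\<xi> \<in> ell2 I" if "\<xi> \<in> ell2 J" for \<xi> using that ell2_mono[OF J] by auto
  have "T x (adj J (S y) \<xi>) = adj J (S y) (T x \<xi>)" if "\<xi> \<in> ell2 J" for x y \<xi>
    unfolding adj_restrict[OF J inv(3)[OF that]] adj_restrict[OF J inv(3)[OF inv(1)[OF that]]]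
    by (rule comm(2)[OF sub[OF that]])
  moreover have "T x (S y \<xi>) = S y (T x \<xi>)" if "\<xi> \<in> ell2 J" for x y \<xi>
    by (rule comm(1)[OF sub[OF that]])
  moreover have "complete_contraction X J T" by (rule complete_contraction_restrict[OF T J inv(1)])
  moreover have "complete_contraction Y J S" by (rule complete_contraction_restrict[OF S J inv(2)])
  ultimately show ?thesis by (simp add: commuting_pair_def)
qed

definition pull :: "'k set \<Rightarrow> ('k \<Rightarrow> 'i) \<Rightarrow> ('i \<Rightarrow> complex) \<Rightarrow> 'k \<Rightarrow> complex" where
  "pull K g \<xi> = (\<lambda>m. if m \<in> K then \<xi> (g m) else 0)"

lemma pull_ell2:
  assumes g: "bij_betw g K J" and \<xi>: "\<xi> \<in> ell2 J"
  shows "pull K g \<xi> \<in> ell2 K" "l2norm (pull K g \<xi>) = l2norm \<xi>"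
proof -
  have "(\<lambda>i. (cmod (\<xi> i))\<^sup>2) summable_on J" using \<xi> by (auto simp: ell2_def intro: summable_on_subset)
  then have "(\<lambda>m. (cmod (\<xi> (g m)))\<^sup>2) summable_on K"
    using summable_on_reindex_bij_betw[OF g, of "\<lambda>i. (cmod (\<xi> i))\<^sup>2"] by simp
  then have "(\<lambda>m. (cmod (pull K g \<xi> m))\<^sup>2) summable_on UNIV"
    by (rule summable_on_cong_neutral[THEN iffD1, rotated 3]) (auto simp: pull_def)
  then show "pull K g \<xi> \<in> ell2 K" by (auto simp: ell2_def pull_def)
  have "(\<Sum>\<^sub>\<infinity>m. (cmod (pull K g \<xi> m))\<^sup>2) = (\<Sum>\<^sub>\<infinity>m\<in>K. (cmod (\<xi> (g m)))\<^sup>2)"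
    by (rule infsum_cong_neutral) (auto simp: pull_def)
  also have "\<dots> = (\<Sum>\<^sub>\<infinity>i\<in>J. (cmod (\<xi> i))\<^sup>2)"
    by (rule infsum_reindex_bij_betw[OF g])
  also have "\<dots> = (\<Sum>\<^sub>\<infinity>i. (cmod (\<xi> i))\<^sup>2)"
    using \<xi> by (intro infsum_cong_neutral) (auto simp: ell2_def)
  finally show "l2norm (pull K g \<xi>) = l2norm \<xi>" by (simp add: l2norm_def)
qed

lemma pull_l2inner:
  assumes g: "bij_betw g K J" and \<xi>: "\<xi> \<in> ell2 J"
  shows "l2inner (pull K g \<xi>) (pull K g \<zeta>) = l2inner \<xi> \<zeta>"
proof -
  have "l2inner (pull K g \<xi>) (pull K g \<zeta>) = (\<Sum>\<^sub>\<infinity>m\<in>K. cnj (\<xi> (g m)) * \<zeta> (g m))"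
    unfolding l2inner_def by (rule infsum_cong_neutral) (auto simp: pull_def)
  also have "\<dots> = (\<Sum>\<^sub>\<infinity>i\<in>J. cnj (\<xi> i) * \<zeta> i)"
    by (rule infsum_reindex_bij_betw[OF g])
  also have "\<dots> = l2inner \<xi> \<zeta>"
    unfolding l2inner_def using \<xi> by (intro infsum_cong_neutral) (auto simp: ell2_def)
  finally show ?thesis .
qed

lemma pull_add: "pull K g (\<lambda>i. \<xi> i + c * \<zeta> i) = (\<lambda>m. pull K g \<xi> m + c * pull K g \<zeta> m)"
  by (auto simp: pull_def fun_eq_iff)

lemma pull_sum: "pull K g (\<lambda>i. \<Sum>j\<in>F. \<xi> j i) = (\<lambda>m. \<Sum>j\<in>F. pull K g (\<xi> j) m)"
  by (auto simp: pull_def fun_eq_iff)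

lemma ell2_sum: "finite F \<Longrightarrow> (\<And>j. j \<in> F \<Longrightarrow> \<xi> j \<in> ell2 I) \<Longrightarrow> (\<lambda>s. \<Sum>j\<in>F. \<xi> j s) \<in> ell2 I"
proof (induction F rule: finite_induct)
  case (insert j F)
  then show ?case using ell2_add[of "\<xi> j" I "\<lambda>s. \<Sum>j\<in>F. \<xi> j s" 1] by simp
qed simp

lemma opmat_norm_cong:
  assumes "\<And>i j \<xi>. i < p \<Longrightarrow> j < q \<Longrightarrow> \<xi> \<in> ell2 I \<Longrightarrow> A i j \<xi> = B i j \<xi>"
  shows "opmat_norm I p q A = opmat_norm I p q B"
  unfolding opmat_norm_def using assms by (intro SUP_cong) auto

text \<open>Transport along a bijection \<open>f\<close> from \<open>J\<close> to \<open>K\<close> with inverse \<open>h\<close>.\<close>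

context
  fixes J :: "'i set" and K :: "'k set" and f :: "'i \<Rightarrow> 'k" and h :: "'k \<Rightarrow> 'i"
  assumes f: "bij_betw f J K" and h: "bij_betw h K J"
    and hf: "\<And>j. j \<in> J \<Longrightarrow> h (f j) = j" and fh: "\<And>m. m \<in> K \<Longrightarrow> f (h m) = m"
begin

definition conj_op :: "'i oper \<Rightarrow> 'k oper" where
  "conj_op A = (\<lambda>\<xi>. pull K h (A (pull J f \<xi>)))"

lemma PQ: "\<zeta> \<in> ell2 J \<Longrightarrow> pull J f (pull K h \<zeta>) = \<zeta>"
  using f hf by (auto simp: pull_def fun_eq_iff ell2D bij_betw_def)

lemma QP: "\<xi> \<in> ell2 K \<Longrightarrow> pull K h (pull J f \<xi>) = \<xi>"
  using h fh by (auto simp: pull_def fun_eq_iff ell2D bij_betw_def)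

lemma conj_op_bounded:
  assumes A: "A \<in> bounded_ops J"
  shows "conj_op A \<in> bounded_ops K"
proof -
  obtain C where C: "C \<ge> 0" "\<And>\<xi>. \<xi> \<in> ell2 J \<Longrightarrow> l2norm (A \<xi>) \<le> C * l2norm \<xi>"
    using bounded_ops_bound[OF A] by metis
  have 1: "conj_op A \<xi> \<in> ell2 K" "l2norm (conj_op A \<xi>) \<le> C * l2norm \<xi>" if "\<xi> \<in> ell2 K" for \<xi>
    using C(2)[OF pull_ell2(1)[OF f that]] pull_ell2[OF f that]
      pull_ell2[OF h bounded_opsD(1)[OF A pull_ell2(1)[OF f that]]]
    by (auto simp: conj_op_def)
  have 2: "conj_op A (\<lambda>i. \<xi> i + c * \<zeta> i) = (\<lambda>i. conj_op A \<xi> i + c * conj_op A \<zeta> i)"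
    if "\<xi> \<in> ell2 K" "\<zeta> \<in> ell2 K" for \<xi> \<zeta> c
    unfolding conj_op_def pull_add
    by (simp only: bounded_opsD(2)[OF A pull_ell2(1)[OF f that(1)] pull_ell2(1)[OF f that(2)]] pull_add)
  show ?thesis using 1 2 unfolding bounded_ops_def by blast
qed

lemma conj_op_comp:
  assumes "A \<in> bounded_ops J" "B \<in> bounded_ops J" "\<xi> \<in> ell2 K"
  shows "conj_op A (conj_op B \<xi>) = conj_op (\<lambda>\<xi>. A (B \<xi>)) \<xi>"
  unfolding conj_op_def
  by (simp only: PQ[OF bounded_opsD(1)[OF assms(2) pull_ell2(1)[OF f assms(3)]]])

lemma conj_op_adj:
  assumes A: "A \<in> bounded_ops J" and \<zeta>: "\<zeta> \<in> ell2 K"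
  shows "adj K (conj_op A) \<zeta> = conj_op (adj J A) \<zeta>"
proof
  fix m
  show "adj K (conj_op A) \<zeta> m = conj_op (adj J A) \<zeta> m"
  proof (cases "m \<in> K")
    case m: True
    have hm: "h m \<in> J" using m h by (auto simp: bij_betw_def)
    have u: "pull J f (unit m) = unit (h m)"
      using hm m hf fh by (auto simp: pull_def unit_def fun_eq_iff)
    have "adj K (conj_op A) \<zeta> m = l2inner (pull K h (A (unit (h m)))) (pull K h (pull J f \<zeta>))"
      using m by (simp add: adj_def conj_op_def u QP[OF \<zeta>])
    also have "\<dots> = l2inner (A (unit (h m))) (pull J f \<zeta>)"
      by (rule pull_l2inner[OF h bounded_opsD(1)[OF A ell2_unit[OF hm]]])
    also have "\<dots> = conj_op (adj J A) \<zeta> m"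
      using m hm by (simp add: conj_op_def pull_def adj_def)
    finally show ?thesis .
  qed (simp add: adj_def conj_op_def pull_def)
qed

lemma conj_opmat_norm:
  assumes A: "\<And>i j \<xi>. \<xi> \<in> ell2 J \<Longrightarrow> A i j \<xi> \<in> ell2 J"
  shows "opmat_norm J p q A = opmat_norm K p q (\<lambda>i j. conj_op (A i j))"
proof -
  have val: "l2norm (\<lambda>s. \<Sum>j<q. conj_op (A i j) (\<xi> j) s) = l2norm (\<lambda>s. \<Sum>j<q. A i j (pull J f (\<xi> j)) s)"
    if "\<And>j. j < q \<Longrightarrow> \<xi> j \<in> ell2 K" for \<xi> i
  proof -
    have "(\<lambda>s. \<Sum>j<q. A i j (pull J f (\<xi> j)) s) \<in> ell2 J"
      by (rule ell2_sum) (auto intro!: A pull_ell2(1)[OF f] that)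
    from pull_ell2(2)[OF h this] show ?thesis by (simp add: pull_sum conj_op_def)
  qed
  show ?thesis
  proof (rule antisym; rule opmat_norm_least)
    fix \<xi> assume \<xi>: "\<And>j. j < q \<Longrightarrow> \<xi> j \<in> ell2 J" "(\<Sum>j<q. (l2norm (\<xi> j))\<^sup>2) \<le> 1"
    have 1: "\<And>j. j < q \<Longrightarrow> pull K h (\<xi> j) \<in> ell2 K" using \<xi>(1) pull_ell2(1)[OF h] by blast
    have 2: "(\<Sum>j<q. (l2norm (pull K h (\<xi> j)))\<^sup>2) \<le> 1" using \<xi> pull_ell2(2)[OF h] by simp
    have "(\<Sum>j<q. A i j (\<xi> j) s) = (\<Sum>j<q. A i j (pull J f (pull K h (\<xi> j))) s)" for i s
      using \<xi>(1) by (intro sum.cong) (auto simp: PQ)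
    then show "ennreal (sqrt (\<Sum>i<p. (l2norm (\<lambda>s. \<Sum>j<q. A i j (\<xi> j) s))\<^sup>2))
        \<le> opmat_norm K p q (\<lambda>i j. conj_op (A i j))"
      using opmat_norm_upper[where p = p and A = "\<lambda>i j. conj_op (A i j)", OF 1 2] by (simp add: val[OF 1])
  next
    fix \<xi> assume \<xi>: "\<And>j. j < q \<Longrightarrow> \<xi> j \<in> ell2 K" "(\<Sum>j<q. (l2norm (\<xi> j))\<^sup>2) \<le> 1"
    have 1: "\<And>j. j < q \<Longrightarrow> pull J f (\<xi> j) \<in> ell2 J" using \<xi>(1) pull_ell2(1)[OF f] by blast
    have 2: "(\<Sum>j<q. (l2norm (pull J f (\<xi> j)))\<^sup>2) \<le> 1" using \<xi> pull_ell2(2)[OF f] by simp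
    show "ennreal (sqrt (\<Sum>i<p. (l2norm (\<lambda>s. \<Sum>j<q. conj_op (A i j) (\<xi> j) s))\<^sup>2)) \<le> opmat_norm J p q A"
      using opmat_norm_upper[where p = p and A = A, OF 1 2] by (simp add: val[OF \<xi>(1)])
  qed
qed

lemma conj_complete_contraction:
  assumes T: "complete_contraction X J T"
  shows "complete_contraction X K (\<lambda>x. conj_op (T x))"
proof -
  have b: "T x \<in> bounded_ops J" for x using T by (simp add: complete_contraction_def linear_into_def)
  have "conj_op (T (\<lambda>a. x a + c * y a)) \<xi> = (\<lambda>i. conj_op (T x) \<xi> i + c * conj_op (T y) \<xi> i)"
    if "\<xi> \<in> ell2 K" for x y c \<xi>
  proof -
    have "T (\<lambda>a. x a + c * y a) (pull J f \<xi>) = (\<lambda>i. T x (pull J f \<xi>) i + c * T y (pull J f \<xi>) i)"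
      by (rule linear_into_add[OF _ pull_ell2(1)[OF f that]]) (use T in \<open>simp add: complete_contraction_def\<close>)
    then show ?thesis by (simp add: conj_op_def pull_add)
  qed
  then have "linear_into K (\<lambda>x. conj_op (T x))"
    by (auto simp: linear_into_def intro: conj_op_bounded[OF b])
  moreover have "opmat_norm K l l (\<lambda>i j. conj_op (T (x i j))) = opmat_norm J l l (\<lambda>i j. T (x i j))" for l x
    by (rule conj_opmat_norm[symmetric]) (rule bounded_opsD(1)[OF b])
  ultimately show ?thesis using T by (simp add: complete_contraction_def cb_norm_def)
qed

lemma conj_commuting_pair:
  assumes TS: "commuting_pair X Y J T S"
  shows "commuting_pair X Y K (\<lambda>x. conj_op (T x)) (\<lambda>y. conj_op (S y))"
    and "opmat_norm J k k (\<lambda>i j. tensor_op T S (w i j)) =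
         opmat_norm K k k (\<lambda>i j. tensor_op (\<lambda>x. conj_op (T x)) (\<lambda>y. conj_op (S y)) (w i j))"
proof -
  have T: "complete_contraction X J T" and S: "complete_contraction Y J S"
    and comm: "\<And>x y \<xi>. \<xi> \<in> ell2 J \<Longrightarrow> T x (S y \<xi>) = S y (T x \<xi>)"
      "\<And>x y \<xi>. \<xi> \<in> ell2 J \<Longrightarrow> T x (adj J (S y) \<xi>) = adj J (S y) (T x \<xi>)"
    using TS by (auto simp: commuting_pair_def)
  have bT: "T x \<in> bounded_ops J" for x using T by (simp add: complete_contraction_def linear_into_def)
  have bS: "S y \<in> bounded_ops J" for y using S by (simp add: complete_contraction_def linear_into_def)
  have "conj_op (T x) (conj_op (S y) \<xi>) = conj_op (S y) (conj_op (T x) \<xi>)"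
    "conj_op (T x) (adj K (conj_op (S y)) \<xi>) = adj K (conj_op (S y)) (conj_op (T x) \<xi>)"
    if \<xi>: "\<xi> \<in> ell2 K" for x y \<xi>
  proof -
    note P = pull_ell2(1)[OF f \<xi>]
    show "conj_op (T x) (conj_op (S y) \<xi>) = conj_op (S y) (conj_op (T x) \<xi>)"
      by (simp only: conj_op_comp[OF bT bS \<xi>] conj_op_comp[OF bS bT \<xi>]) (simp add: conj_op_def comm(1)[OF P])
    have TK: "conj_op (T x) \<xi> \<in> ell2 K" by (rule bounded_opsD(1)[OF conj_op_bounded[OF bT] \<xi>])
    show "conj_op (T x) (adj K (conj_op (S y)) \<xi>) = adj K (conj_op (S y)) (conj_op (T x) \<xi>)"
      by (simp only: conj_op_adj[OF bS \<xi>] conj_op_adj[OF bS TK]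
            conj_op_comp[OF bT adj_bounded[OF bS] \<xi>] conj_op_comp[OF adj_bounded[OF bS] bT \<xi>])
        (simp add: conj_op_def comm(2)[OF P])
  qed
  then show "commuting_pair X Y K (\<lambda>x. conj_op (T x)) (\<lambda>y. conj_op (S y))"
    by (simp add: commuting_pair_def conj_complete_contraction[OF T] conj_complete_contraction[OF S])
  have in_J: "tensor_op T S v \<xi> \<in> ell2 J" if "\<xi> \<in> ell2 J" for v \<xi>
    unfolding tensor_op_def case_prod_beta
    by (intro ell2_sum ell2_scale bounded_opsD(1)[OF bT] bounded_opsD(1)[OF bS] that) simp
  have "opmat_norm J k k (\<lambda>i j. tensor_op T S (w i j)) =
      opmat_norm K k k (\<lambda>i j. conj_op (tensor_op T S (w i j)))"
    by (rule conj_opmat_norm) (rule in_J)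
  also have "\<dots> = opmat_norm K k k (\<lambda>i j. tensor_op (\<lambda>x. conj_op (T x)) (\<lambda>y. conj_op (S y)) (w i j))"
  proof (rule opmat_norm_cong)
    fix i j :: nat and \<xi> assume \<xi>: "\<xi> \<in> ell2 K"
    show "conj_op (tensor_op T S (w i j)) \<xi> = tensor_op (\<lambda>x. conj_op (T x)) (\<lambda>y. conj_op (S y)) (w i j) \<xi>"
      unfolding tensor_op_def case_prod_beta conj_op_comp[OF bT bS \<xi>]
      by (simp add: conj_op_def pull_def fun_eq_iff)
  qed
  finally show "opmat_norm J k k (\<lambda>i j. tensor_op T S (w i j)) =
      opmat_norm K k k (\<lambda>i j. tensor_op (\<lambda>x. conj_op (T x)) (\<lambda>y. conj_op (S y)) (w i j))" .
qed

end

lemma linear_into_coords: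
  fixes x :: "'a::finite \<Rightarrow> complex"
  assumes T: "linear_into I T" and \<xi>: "\<xi> \<in> ell2 I"
  shows "T x \<xi> i = (\<Sum>a\<in>UNIV. x a * T (unit a) \<xi> i)"
proof -
  have "T (\<lambda>a. if a \<in> F then x a else 0) \<xi> i = (\<Sum>a\<in>F. x a * T (unit a) \<xi> i)" for F
  proof (induction F rule: finite_induct[OF finite])
    case 1
    then show ?case using linear_into_zero[OF T \<xi>] by simp
  next
    case (2 b F)
    have "(\<lambda>a. if a \<in> insert b F then x a else 0) = (\<lambda>a. (if a \<in> F then x a else 0) + x b * unit b a)"
      using 2 by (auto simp: unit_def fun_eq_iff)
    then show ?case using 2 by (simp add: linear_into_add[OF T \<xi>])
  qed
  from this[of UNIV] show ?thesis by simp
qed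

theorem max_os_upper:
  fixes I :: "'i set" and X :: "('a::finite) opspace" and Y :: "('b::finite) opspace"
  assumes TS: "commuting_pair X Y I T S"
  shows "opmat_norm I k k (\<lambda>i j. tensor_op T S (w i j)) \<le> max_os X Y k w"
proof (rule opmat_norm_least)
  fix \<xi> :: "nat \<Rightarrow> 'i \<Rightarrow> complex"
  assume \<xi>: "\<And>j. j < k \<Longrightarrow> \<xi> j \<in> ell2 I" "(\<Sum>j<k. (l2norm (\<xi> j))\<^sup>2) \<le> 1"
  have T: "linear_into I T" and S: "linear_into I S"
    using TS by (auto simp: commuting_pair_def complete_contraction_def)
  have bT: "T x \<in> bounded_ops I" for x using T by (simp add: linear_into_def)
  have bS: "S y \<in> bounded_ops I" for y using S by (simp add: linear_into_def)
  define R where "R = {(j, i). j \<in> I \<and> ((\<exists>a. T (unit a) (unit j) i \<noteq> 0) \<or>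
      (\<exists>b. S (unit b) (unit j) i \<noteq> 0) \<or> (\<exists>b. adj I (S (unit b)) (unit j) i \<noteq> 0))}"
  have Rj: "countable (R `` {j})" for j
  proof (cases "j \<in> I")
    case True
    note u = ell2_unit[OF True]
    have "R `` {j} = (\<Union>a. {i. T (unit a) (unit j) i \<noteq> 0}) \<union> (\<Union>b. {i. S (unit b) (unit j) i \<noteq> 0})
        \<union> (\<Union>b. {i. adj I (S (unit b)) (unit j) i \<noteq> 0})"
      using True by (auto simp: R_def)
    moreover have "countable {i. T (unit a) (unit j) i \<noteq> 0}" for a
      by (rule countable_support[OF bounded_opsD(1)[OF bT u]])
    moreover have "countable {i. S (unit b) (unit j) i \<noteq> 0}" for b
      by (rule countable_support[OF bounded_opsD(1)[OF bS u]])
    moreover have "countable {i. adj I (S (unit b)) (unit j) i \<noteq> 0}" for b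
      by (rule countable_support[OF bounded_opsD(1)[OF adj_bounded[OF bS] u]])
    ultimately show ?thesis by (simp add: countable_finite)
  qed (simp add: R_def)
  define J0 where "J0 = (\<Union>j\<in>{..<k}. {i. \<xi> j i \<noteq> 0})"
  define J where "J = R\<^sup>* `` J0"
  have "countable J0" unfolding J0_def using \<xi>(1) by (auto intro: countable_support)
  moreover have "countable (R `` Z)" if "countable Z" for Z
  proof -
    have "R `` Z = (\<Union>j\<in>Z. R `` {j})" by auto
    then show ?thesis using that Rj by simp
  qed
  ultimately have J: "countable J" unfolding J_def by (intro countable_rtrancl)
  have RI: "i \<in> I" if "(j, i) \<in> R" for i j
  proof (rule ccontr)
    assume "i \<notin> I"
    have j: "j \<in> I" using that by (simp add: R_def)
    note z = ell2D[OF bounded_opsD(1)[OF _ ell2_unit[OF j]] \<open>i \<notin> I\<close>]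
    show False using that z[OF bT] z[OF bS] z[OF adj_bounded[OF bS]] by (simp add: R_def)
  qed
  have J0I: "J0 \<subseteq> I" using \<xi>(1) ell2D unfolding J0_def by fastforce
  have JI: "J \<subseteq> I"
  proof
    fix i assume "i \<in> J"
    then obtain j where "j \<in> J0" "(j, i) \<in> R\<^sup>*" by (auto simp: J_def)
    from this(2,1) show "i \<in> I" by (cases rule: rtranclE) (use J0I RI in auto)
  qed
  have closed: "i \<in> J" if "j \<in> J" "(j, i) \<in> R" for i j
    using that unfolding J_def by (auto intro: rtrancl_into_rtrancl)
  have cT: "T (unit a) (unit j) i = 0" and cS: "S (unit b) (unit j) i = 0"
    and cA: "adj I (S (unit b)) (unit j) i = 0" if "j \<in> J" "i \<notin> J" for a b i j
    using closed[OF that(1), of i] that JI by (auto simp: R_def)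
  have invT: "T x \<zeta> \<in> ell2 J" if "\<zeta> \<in> ell2 J" for x \<zeta>
  proof (rule bounded_ops_invariant[OF bT JI _ that])
    fix j i assume ji: "j \<in> J" "i \<notin> J"
    have j: "j \<in> I" using ji JI by auto
    show "T x (unit j) i = 0"
      by (subst linear_into_coords[OF T ell2_unit[OF j]]) (simp add: cT[OF ji])
  qed
  have invS: "S y \<zeta> \<in> ell2 J" if "\<zeta> \<in> ell2 J" for y \<zeta>
  proof (rule bounded_ops_invariant[OF bS JI _ that])
    fix j i assume ji: "j \<in> J" "i \<notin> J"
    have j: "j \<in> I" using ji JI by auto
    show "S y (unit j) i = 0"
      by (subst linear_into_coords[OF S ell2_unit[OF j]]) (simp add: cS[OF ji])
  qed
  have invA: "adj I (S y) \<zeta> \<in> ell2 J" if "\<zeta> \<in> ell2 J" for y \<zeta>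
  proof (rule bounded_ops_invariant[OF adj_bounded[OF bS] JI _ that])
    fix j i assume ji: "j \<in> J" "i \<notin> J"
    show "adj I (S y) (unit j) i = 0"
    proof (cases "i \<in> I")
      case True
      then have "S (unit b) (unit i) j = 0" for b using cA[OF ji, of b] by (simp add: adj_unit)
      then have "S y (unit i) j = 0"
        by (subst linear_into_coords[OF S ell2_unit[OF True]]) simp
      then show ?thesis using True by (simp add: adj_unit)
    qed (simp add: adj_def)
  qed
  have TSJ: "commuting_pair X Y J T S"
    by (rule commuting_pair_restrict[OF TS JI invT invS invA])
  have \<xi>J: "\<xi> j \<in> ell2 J" if "j < k" for j
    using \<xi>(1)[OF that] by (rule ell2I) (use that in \<open>auto simp: J_def J0_def\<close>)
  define K where "K = to_nat_on J ` J"
  have f: "bij_betw (to_nat_on J) J K" unfolding K_def by (intro inj_on_imp_bij_betw inj_on_to_nat_on J)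
  have h: "bij_betw (inv_into J (to_nat_on J)) K J" by (rule bij_betw_inv_into[OF f])
  have hf: "inv_into J (to_nat_on J) (to_nat_on J j) = j" if "j \<in> J" for j
    using inj_on_to_nat_on[OF J] that by (rule inv_into_f_f)
  have fh: "to_nat_on J (inv_into J (to_nat_on J) m) = m" if "m \<in> K" for m
    using that unfolding K_def by (rule f_inv_into_f)
  let ?conj = "conj_op J K (to_nat_on J) (inv_into J (to_nat_on J))"
  let ?T' = "\<lambda>x. ?conj (T x)" and ?S' = "\<lambda>y. ?conj (S y)"
  have "ennreal (sqrt (\<Sum>i<k. (l2norm (\<lambda>s. \<Sum>j<k. tensor_op T S (w i j) (\<xi> j) s))\<^sup>2))
      \<le> opmat_norm J k k (\<lambda>i j. tensor_op T S (w i j))"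
    by (rule opmat_norm_upper[OF \<xi>J \<xi>(2)])
  also have "\<dots> = opmat_norm K k k (\<lambda>i j. tensor_op ?T' ?S' (w i j))"
    by (rule conj_commuting_pair(2)[OF f h hf fh TSJ])
  also have "\<dots> \<le> max_os X Y k w"
    unfolding max_os_def
    by (rule SUP_upper2[where i = "(K, ?T', ?S')"])
      (use conj_commuting_pair(1)[OF f h hf fh TSJ] in simp_all)
  finally show "ennreal (sqrt (\<Sum>i<k. (l2norm (\<lambda>s. \<Sum>j<k. tensor_op T S (w i j) (\<xi> j) s))\<^sup>2))
      \<le> max_os X Y k w" .
qed

end

theory Submission
  imports Defs
begin

text \<open>
  Write \<open>A s t\<close> and \<open>B u v\<close> for the images under \<open>T\<close> and \<open>S\<close> of the matrix units \<open>e\<^bsub>ts\<^esub>\<close>, \<open>e\<^bsub>vu\<^esub>\<close>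
  (transposed, so that the operator matrices \<open>A\<close>, \<open>B\<close> are contractions under the trace duality) and
  \<open>\<omega> = exp(2 \<pi> i / n)\<close>. The component of \<open>\<eta>\<close> at \<open>(s, u)\<close> is \<open>\<Sum>v. \<omega>\<^bsup>f(s) u v\<^esup> A s (v + s) B u v\<close>, where
  \<open>f(s) = s\<close> for \<open>s \<noteq> 0\<close> and \<open>f(0) = 1\<close>; only \<open>n\<^sup>2\<close> of the \<open>n\<^sup>4\<close> components are used.

  If \<open>A\<close> and \<open>B\<close> commute, expand the square of the column norm at a unit vector \<open>\<xi>\<close> into terms indexed by
  \<open>(v, v')\<close>. The diagonal terms contribute at most \<open>n\<close>. Off the diagonal, commutation moves both factors \<open>A\<close>
  to one side of the inner product and both factors \<open>B\<close> to the other, leaving the kernel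
  \<open>\<omega>\<^bsup>f(s) u (v' - v)\<^esup>\<close> in \<open>(s, u)\<close>. It is a character table with one row repeated, so it has norm at most
  \<open>\<surd>(2 n)\<close>, and these terms contribute at most \<open>\<surd>(2 n) n\<close>. The total is at most \<open>2 n\<^bsup>3/2\<^esup>\<close> when \<open>n \<ge> 3\<close>;
  for \<open>n = 2\<close> the trivial bound \<open>n\<^sup>2\<close> suffices.

  For the lower bound, let \<open>U\<^bsub>su\<^esub>\<close> be the \<open>n \<times> n\<close> matrix with entry \<open>\<omega>\<^bsup>f(s) u v\<^esup>\<close> at \<open>(v + s, v)\<close>. For fixed
  \<open>u\<close> the \<open>U\<^bsub>su\<^esub>\<close> are orthogonal because of the shift by \<open>s\<close>, and for fixed \<open>s\<close> because \<open>f(s)\<close> is invertible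
  modulo \<open>n\<close>. Each of these makes the pairing with the \<open>U\<^bsub>su\<^esub>\<close> bounded by \<open>n\<close> for the Haagerup norm in one of
  the two orders, whereas \<open>\<eta>\<close> pairs to a family of \<open>\<ell>\<^sup>2\<close> norm \<open>n\<^sup>2\<close>.
\<close>

section \<open>Finite sums\<close>

lemma sum_inj_support:
  assumes "finite M" "inj g" "range g \<subseteq> M" "\<And>c. c \<in> M \<Longrightarrow> c \<notin> range g \<Longrightarrow> F c = 0"
  shows "sum F M = (\<Sum>p\<in>UNIV. F (g p))"
proof -
  have "sum F M = sum F (range g)"
    using assms by (intro sum.mono_neutral_right) auto
  also have "\<dots> = (\<Sum>p\<in>UNIV. F (g p))"
    by (rule sum.reindex_cong[OF assms(2) refl refl])
  finally show ?thesis .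
qed

lemma sum_UNIV_prod: "(\<Sum>p\<in>UNIV. f p) = (\<Sum>s\<in>UNIV. \<Sum>t\<in>UNIV. f (s, t))"
  unfolding UNIV_Times_UNIV[symmetric] sum.cartesian_product by (intro sum.cong) auto

lemma sum_swap_pairs:
  "(\<Sum>s\<in>S. \<Sum>u\<in>U. \<Sum>v\<in>V. \<Sum>w\<in>W. f s u v w) = (\<Sum>v\<in>V. \<Sum>w\<in>W. \<Sum>s\<in>S. \<Sum>u\<in>U. f s u v w)"
proof -
  have "(\<Sum>s\<in>S. \<Sum>u\<in>U. \<Sum>v\<in>V. \<Sum>w\<in>W. f s u v w) = (\<Sum>s\<in>S. \<Sum>v\<in>V. \<Sum>w\<in>W. \<Sum>u\<in>U. f s u v w)"
    by (intro sum.cong refl, subst sum.swap, intro sum.cong refl sum.swap)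
  also have "\<dots> = (\<Sum>v\<in>V. \<Sum>w\<in>W. \<Sum>s\<in>S. \<Sum>u\<in>U. f s u v w)"
    by (subst sum.swap, intro sum.cong refl sum.swap)
  finally show ?thesis .
qed

text \<open>Bessel's inequality scaled to vectors of squared norm \<open>N\<close>. For
  \<open>y\<close>, the combination of the \<open>r p\<close> with coefficients \<open>c p\<close>,
  orthogonality gives squared norm \<open>N * Q\<close> and inner product \<open>Q\<close> with
  \<open>z\<close>. The squared norm of \<open>N * z - y\<close> is therefore
  \<open>N * (N * Z - Q)\<close>, and it is nonnegative.\<close>

lemma bessel_inequality:
  fixes r :: "'p \<Rightarrow> 'x \<Rightarrow> complex"
  assumes fin: "finite P" "finite X" and N: "N > 0"
    and orth: "\<And>p p'. p \<in> P \<Longrightarrow> p' \<in> P \<Longrightarrow> (\<Sum>x\<in>X. cnj (r p x) * r p' x) = (if p = p' then complex_of_real N else 0)"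
  shows "(\<Sum>p\<in>P. (cmod (\<Sum>x\<in>X. cnj (r p x) * z x))\<^sup>2) \<le> N * (\<Sum>x\<in>X. (cmod (z x))\<^sup>2)"
proof -
  define c where "c = (\<lambda>p. \<Sum>x\<in>X. cnj (r p x) * z x)"
  define y where "y = (\<lambda>x. \<Sum>p\<in>P. c p * r p x)"
  define Q where "Q = (\<Sum>p\<in>P. (cmod (c p))\<^sup>2)"
  define Z where "Z = (\<Sum>x\<in>X. (cmod (z x))\<^sup>2)"
  let ?N = "complex_of_real N"
  have ry: "(\<Sum>x\<in>X. cnj (r p x) * y x) = N * c p" if "p \<in> P" for p
  proof -
    have "(\<Sum>x\<in>X. cnj (r p x) * y x) = (\<Sum>x\<in>X. \<Sum>p'\<in>P. c p' * (cnj (r p x) * r p' x))"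
      by (simp add: y_def sum_distrib_left mult_ac)
    also have "\<dots> = (\<Sum>p'\<in>P. c p' * (\<Sum>x\<in>X. cnj (r p x) * r p' x))"
      by (subst sum.swap) (simp only: sum_distrib_left)
    also have "\<dots> = N * c p" using fin that by (simp add: orth if_distrib[of "\<lambda>z. _ * z"] cong: sum.cong if_cong)
    finally show ?thesis .
  qed
  have cy: "(\<Sum>x\<in>X. cnj (y x) * f x) = (\<Sum>p\<in>P. cnj (c p) * (\<Sum>x\<in>X. cnj (r p x) * f x))" for f
    unfolding y_def cnj_sum sum_distrib_left sum_distrib_right complex_cnj_mult
    by (subst sum.swap) (simp only: mult.assoc)
  have Q: "complex_of_real Q = (\<Sum>p\<in>P. cnj (c p) * c p)"
    by (simp only: Q_def of_real_sum complex_norm_square mult.commute)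
  have Z: "complex_of_real Z = (\<Sum>x\<in>X. cnj (z x) * z x)"
    by (simp only: Z_def of_real_sum complex_norm_square mult.commute)
  have yz: "(\<Sum>x\<in>X. cnj (y x) * z x) = Q"
    unfolding cy Q by (simp add: c_def)
  have yy: "(\<Sum>x\<in>X. cnj (y x) * y x) = ?N * Q"
    unfolding cy Q sum_distrib_left[of "complex_of_real N"]
    by (rule sum.cong[OF refl]) (simp only: ry mult.left_commute)
  have zy: "(\<Sum>x\<in>X. cnj (z x) * y x) = Q"
  proof -
    have "(\<Sum>x\<in>X. cnj (z x) * y x) = cnj (\<Sum>x\<in>X. cnj (y x) * z x)" by (simp add: mult.commute)
    then show ?thesis by (simp only: yz complex_cnj_complex_of_real)
  qed
  have "complex_of_real (\<Sum>x\<in>X. (cmod (N * z x - y x))\<^sup>2) =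
      (\<Sum>x\<in>X. ?N * ?N * (cnj (z x) * z x) - ?N * (cnj (y x) * z x) - ?N * (cnj (z x) * y x) + cnj (y x) * y x)"
    unfolding of_real_sum complex_norm_square by (intro sum.cong refl) (simp add: algebra_simps)
  also have "\<dots> = ?N * ?N * (\<Sum>x\<in>X. cnj (z x) * z x) - ?N * (\<Sum>x\<in>X. cnj (y x) * z x) -
      ?N * (\<Sum>x\<in>X. cnj (z x) * y x) + (\<Sum>x\<in>X. cnj (y x) * y x)"
    by (simp only: sum.distrib sum_subtractf sum_distrib_left)
  also have "\<dots> = complex_of_real (N * (N * Z - Q))"
    unfolding Z[symmetric] yz zy yy by (simp add: algebra_simps)
  finally have "(\<Sum>x\<in>X. (cmod (N * z x - y x))\<^sup>2) = N * (N * Z - Q)" by (simp only: of_real_eq_iff)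
  moreover have "0 \<le> (\<Sum>x\<in>X. (cmod (N * z x - y x))\<^sup>2)" by (simp add: sum_nonneg)
  ultimately have "0 \<le> N * (N * Z - Q)" by simp
  then show ?thesis using N by (simp add: zero_le_mult_iff Q_def Z_def c_def)
qed

section \<open>Additive characters modulo n\<close>

definition chi :: "nat \<Rightarrow> int \<Rightarrow> complex" where
  "chi n j = cis (2 * pi * real_of_int j / real n)"

lemma chi_add: "chi n (i + j) = chi n i * chi n j"
  by (simp add: chi_def cis_mult add_divide_distrib distrib_left)

lemma cnj_chi: "cnj (chi n j) = chi n (- j)"
  by (simp add: chi_def cis_cnj)

lemma cmod_chi [simp]: "cmod (chi n j) = 1"
  by (simp add: chi_def)

lemma chi_0 [simp]: "chi n 0 = 1"
  by (simp add: chi_def)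

lemma chi_eq_1_imp_dvd:
  assumes "n > 0" "chi n j = 1"
  shows "int n dvd j"
proof -
  have "cos (2 * pi * real_of_int j / real n) = 1"
    using assms(2) by (simp add: chi_def complex_eq_iff)
  then obtain k :: int where "2 * pi * real_of_int j / real n = real_of_int k * 2 * pi"
    using cos_one_2pi_int by blast
  then have "real_of_int j = real_of_int (k * int n)" using assms(1) by (simp add: field_simps)
  then show ?thesis by (simp only: of_int_eq_iff) simp
qed

text \<open>A geometric series whose ratio \<open>chi n j\<close> is an n-th root of unity; the
  ratio is 1 exactly when \<open>n\<close> divides \<open>j\<close>.\<close>

lemma sum_chi:
  assumes n: "n > 0"
  shows "(\<Sum>k<n. chi n (j * int k)) = (if int n dvd j then of_nat n else 0)"
proof -
  have pow: "chi n (j * int k) = chi n j ^ k" for k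
    by (induction k) (simp_all add: distrib_left chi_add)
  have "real n * (2 * pi * real_of_int j / real n) = 2 * pi * real_of_int j" using n by simp
  then have 1: "chi n j ^ n = 1" unfolding chi_def Complex.DeMoivre by (simp only: cis_multiple_2pi Ints_of_int)
  show ?thesis
  proof (cases "chi n j = 1")
    case True
    then show ?thesis using chi_eq_1_imp_dvd[OF n True] by (simp add: pow)
  next
    case False
    have "\<not> int n dvd j"
    proof
      assume "int n dvd j"
      then obtain i where "j = int n * i" by auto
      then have "2 * pi * real_of_int j / real n = 2 * pi * real_of_int i" using n by simp
      then have "chi n j = 1" unfolding chi_def by (simp only: cis_multiple_2pi Ints_of_int)
      then show False using False by simp
    qed
    moreover have "(\<Sum>k<n. chi n j ^ k) = 0" using False 1 by (simp add: geometric_sum)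
    ultimately show ?thesis by (simp add: pow)
  qed
qed

lemma add_mod_cancel_nat:
  fixes a b c n :: nat
  assumes "(a + c) mod n = (b + c) mod n" "a < n" "b < n"
  shows "a = b"
proof -
  have "x = y" if "x \<le> y" "(y + c) mod n = (x + c) mod n" "y < n" for x y
    using that nat_dvd_not_less[of "y - x" n] by (cases "x = y") (auto simp: mod_eq_dvd_iff_nat)
  then show ?thesis using assms by (metis nat_le_linear)
qed

section \<open>Families of vectors and operators on \<open>\<ell>\<^sup>2(I)\<close>\<close>

lemma l2norm_sq_finite:
  assumes "finite F" "\<And>i. i \<notin> F \<Longrightarrow> \<xi> i = 0"
  shows "(l2norm \<xi>)\<^sup>2 = (\<Sum>i\<in>F. (cmod (\<xi> i))\<^sup>2)"
proof -
  have "(\<Sum>\<^sub>\<infinity>i. (cmod (\<xi> i))\<^sup>2) = (\<Sum>\<^sub>\<infinity>i\<in>F. (cmod (\<xi> i))\<^sup>2)"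
    using assms(2) by (intro infsum_cong_neutral) auto
  then show ?thesis using assms(1) by (simp add: l2norm_power2)
qed

lemma l2norm_scale: "(l2norm (\<lambda>i. c * \<xi> i))\<^sup>2 = (cmod c)\<^sup>2 * (l2norm \<xi>)\<^sup>2"
  by (simp add: l2norm_power2 norm_mult power_mult_distrib infsum_cmult_right')

lemma l2inner_self:
  assumes "\<xi> \<in> ell2 I"
  shows "l2inner \<xi> \<xi> = complex_of_real ((l2norm \<xi>)\<^sup>2)"
proof -
  have "l2inner \<xi> \<xi> = (\<Sum>\<^sub>\<infinity>i. complex_of_real ((cmod (\<xi> i))\<^sup>2))"
    by (simp only: l2inner_def complex_norm_square mult.commute)
  also have "\<dots> = complex_of_real (\<Sum>\<^sub>\<infinity>i. (cmod (\<xi> i))\<^sup>2)"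
    by (rule infsumI, subst has_sum_of_real_iff, rule has_sum_infsum) (use assms in \<open>simp add: ell2_def\<close>)
  finally show ?thesis by (simp only: l2norm_power2)
qed

lemma l2inner_sum_right:
  assumes "finite F" "\<xi> \<in> ell2 I" "\<And>j. j \<in> F \<Longrightarrow> \<zeta> j \<in> ell2 I"
  shows "l2inner \<xi> (\<lambda>i. \<Sum>j\<in>F. c j * \<zeta> j i) = (\<Sum>j\<in>F. c j * l2inner \<xi> (\<zeta> j))"
  using assms(1,3)
proof (induction F rule: finite_induct)
  case empty
  then show ?case by (simp add: l2inner_def)
next
  case (insert k F)
  have "(\<lambda>i. \<Sum>j\<in>F. c j * \<zeta> j i) \<in> ell2 I"
    using insert by (intro ell2_sum ell2_scale) auto
  then have "l2inner \<xi> (\<lambda>i. (\<Sum>j\<in>F. c j * \<zeta> j i) + c k * \<zeta> k i) =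
      l2inner \<xi> (\<lambda>i. \<Sum>j\<in>F. c j * \<zeta> j i) + c k * l2inner \<xi> (\<zeta> k)"
    using insert by (intro l2inner_add[OF assms(2)]) auto
  then show ?case using insert by (simp add: add.commute)
qed

lemma l2inner_sum_left:
  assumes "finite F" "\<xi> \<in> ell2 I" "\<And>j. j \<in> F \<Longrightarrow> \<zeta> j \<in> ell2 I"
  shows "l2inner (\<lambda>i. \<Sum>j\<in>F. c j * \<zeta> j i) \<xi> = (\<Sum>j\<in>F. cnj (c j) * l2inner (\<zeta> j) \<xi>)"
proof -
  have "l2inner (\<lambda>i. \<Sum>j\<in>F. c j * \<zeta> j i) \<xi> = cnj (\<Sum>j\<in>F. c j * l2inner \<xi> (\<zeta> j))"
    by (simp only: l2inner_sum_right[OF assms] flip: l2inner_cnj[of \<xi>])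
  then show ?thesis by (simp add: l2inner_cnj)
qed

lemma l2norm_sq_sum:
  assumes "finite F" "\<And>j. j \<in> F \<Longrightarrow> \<zeta> j \<in> ell2 I"
  shows "complex_of_real ((l2norm (\<lambda>i. \<Sum>j\<in>F. c j * \<zeta> j i))\<^sup>2) =
    (\<Sum>j\<in>F. \<Sum>k\<in>F. cnj (c j) * c k * l2inner (\<zeta> j) (\<zeta> k))"
proof -
  have e: "(\<lambda>i. \<Sum>j\<in>F. c j * \<zeta> j i) \<in> ell2 I"
    using assms by (intro ell2_sum ell2_scale) auto
  show ?thesis
    by (simp only: l2inner_self[OF e, symmetric] l2inner_sum_left[OF assms(1) e assms(2)]
      l2inner_sum_right[OF assms(1) assms(2) assms(2)] sum_distrib_left mult.assoc cong: sum.cong)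
qed

text \<open>Cauchy-Schwarz followed by the weighted inequality between arithmetic and geometric
  means. The free weight \<open>c\<close> later balances the two families in the off-diagonal
  terms.\<close>

lemma cmod_l2inner_le:
  assumes "\<xi> \<in> ell2 I" "\<zeta> \<in> ell2 I" "c > 0"
  shows "cmod (l2inner \<xi> \<zeta>) \<le> (c * (l2norm \<xi>)\<^sup>2 + (l2norm \<zeta>)\<^sup>2 / c) / 2"
proof -
  have "0 \<le> (c * l2norm \<xi> - l2norm \<zeta>)\<^sup>2 / c" using assms(3) by simp
  also have "\<dots> = c * (l2norm \<xi>)\<^sup>2 + (l2norm \<zeta>)\<^sup>2 / c - 2 * (l2norm \<xi> * l2norm \<zeta>)"
    using assms(3) by (simp add: field_simps power2_eq_square)
  finally show ?thesis using l2inner_cauchy_schwarz[OF assms(1,2)] by argo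
qed

lemma has_sum_sum_swap:
  fixes f :: "'j \<Rightarrow> 'i \<Rightarrow> real"
  assumes "finite F" "\<And>j. j \<in> F \<Longrightarrow> f j summable_on A"
  shows "((\<lambda>i. \<Sum>j\<in>F. f j i) has_sum (\<Sum>j\<in>F. infsum (f j) A)) A"
  using assms by (induction F rule: finite_induct) (auto intro!: has_sum_add)

text \<open>A scalar matrix keeps its bound when it acts on families of vectors: the hypothesis is
  applied at each coordinate \<open>i\<close> to the scalars \<open>\<zeta> u i\<close> and then
  summed over \<open>i\<close>.\<close>

lemma l2norm_matrix_bound:
  fixes k :: "'s \<Rightarrow> 'u \<Rightarrow> complex"
  assumes fin: "finite S" "finite U" and \<zeta>: "\<And>u. u \<in> U \<Longrightarrow> \<zeta> u \<in> ell2 I"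
    and k: "\<And>z. (\<Sum>s\<in>S. (cmod (\<Sum>u\<in>U. k s u * z u))\<^sup>2) \<le> C * (\<Sum>u\<in>U. (cmod (z u))\<^sup>2)"
  shows "(\<Sum>s\<in>S. (l2norm (\<lambda>i. \<Sum>u\<in>U. k s u * \<zeta> u i))\<^sup>2) \<le> C * (\<Sum>u\<in>U. (l2norm (\<zeta> u))\<^sup>2)"
proof -
  have e: "(\<lambda>i. \<Sum>u\<in>U. k s u * \<zeta> u i) \<in> ell2 I" for s
    using fin \<zeta> by (intro ell2_sum ell2_scale) auto
  have 1: "(\<lambda>i. (cmod (\<Sum>u\<in>U. k s u * \<zeta> u i))\<^sup>2) summable_on UNIV" for s
    using e[of s] by (simp add: ell2_def)
  have 2: "(\<lambda>i. (cmod (\<zeta> u i))\<^sup>2) summable_on UNIV" if "u \<in> U" for u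
    using \<zeta>[OF that] by (simp add: ell2_def)
  have "((\<lambda>i. \<Sum>s\<in>S. (cmod (\<Sum>u\<in>U. k s u * \<zeta> u i))\<^sup>2) has_sum
      (\<Sum>s\<in>S. (l2norm (\<lambda>i. \<Sum>u\<in>U. k s u * \<zeta> u i))\<^sup>2)) UNIV"
    unfolding l2norm_power2 by (rule has_sum_sum_swap[OF fin(1) 1])
  moreover have "((\<lambda>i. C * (\<Sum>u\<in>U. (cmod (\<zeta> u i))\<^sup>2)) has_sum C * (\<Sum>u\<in>U. (l2norm (\<zeta> u))\<^sup>2)) UNIV"
    unfolding l2norm_power2 by (intro has_sum_cmult_right has_sum_sum_swap[OF fin(2) 2])
  ultimately show ?thesis by (rule has_sum_mono) (rule k)
qed

lemma bounded_ops_scale: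
  assumes "A \<in> bounded_ops I" "\<xi> \<in> ell2 I"
  shows "A (\<lambda>i. c * \<xi> i) = (\<lambda>i. c * A \<xi> i)"
  using bounded_opsD(2)[OF assms(1) ell2_zero assms(2), of c] bounded_ops_zero[OF assms(1)] by simp

text \<open>The adjoint of a contractive row is a contractive column. If \<open>S\<close> is the
  left-hand side and \<open>?R\<close> the row applied to the vectors
  \<open>adj I (A t) \<zeta>\<close>, then \<open>S\<close> is the inner product of
  \<open>?R\<close> with \<open>\<zeta>\<close>. So \<open>S * S\<close> is at most the squared norm
  of \<open>?R\<close> times that of \<open>\<zeta>\<close>, and the former is at most
  \<open>S\<close>.\<close>

lemma adj_column_bound:
  assumes A: "\<And>t. t \<in> F \<Longrightarrow> A t \<in> bounded_ops I" and F: "finite F"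
    and row: "\<And>y. (\<And>t. t \<in> F \<Longrightarrow> y t \<in> ell2 I) \<Longrightarrow>
      (l2norm (\<lambda>i. \<Sum>t\<in>F. A t (y t) i))\<^sup>2 \<le> (\<Sum>t\<in>F. (l2norm (y t))\<^sup>2)"
    and \<zeta>: "\<zeta> \<in> ell2 I"
  shows "(\<Sum>t\<in>F. (l2norm (adj I (A t) \<zeta>))\<^sup>2) \<le> (l2norm \<zeta>)\<^sup>2"
proof -
  let ?y = "\<lambda>t. adj I (A t) \<zeta>"
  let ?R = "\<lambda>i. \<Sum>t\<in>F. A t (?y t) i"
  define S where "S = (\<Sum>t\<in>F. (l2norm (?y t))\<^sup>2)"
  have y: "?y t \<in> ell2 I" if "t \<in> F" for t
    using bounded_opsD(1)[OF adj_bounded[OF A[OF that]] \<zeta>] .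
  have Ay: "A t (?y t) \<in> ell2 I" if "t \<in> F" for t
    using bounded_opsD(1)[OF A[OF that] y[OF that]] .
  have "complex_of_real S = (\<Sum>t\<in>F. l2inner (A t (?y t)) \<zeta>)"
    unfolding S_def of_real_sum using A y \<zeta> by (intro sum.cong refl) (simp only: adj_property[OF A y \<zeta>] l2inner_self[OF y])
  also have "\<dots> = l2inner ?R \<zeta>"
    using l2inner_sum_left[OF F \<zeta> Ay, where c = "\<lambda>_. 1"] by simp
  finally have "\<bar>S\<bar> = cmod (l2inner ?R \<zeta>)" by (metis norm_of_real)
  also have "\<dots> \<le> l2norm ?R * l2norm \<zeta>"
    using F Ay \<zeta> by (intro l2inner_cauchy_schwarz ell2_sum) auto
  finally have "S\<^sup>2 \<le> (l2norm ?R)\<^sup>2 * (l2norm \<zeta>)\<^sup>2"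
    using power_mono[of "\<bar>S\<bar>" "l2norm ?R * l2norm \<zeta>" 2] by (simp add: power_mult_distrib)
  also have "\<dots> \<le> S * (l2norm \<zeta>)\<^sup>2"
    unfolding S_def by (intro mult_right_mono row y) auto
  finally have "S * S \<le> S * (l2norm \<zeta>)\<^sup>2" by (simp add: power2_eq_square)
  moreover have "S \<ge> 0" unfolding S_def by (intro sum_nonneg) auto
  ultimately have "S \<le> (l2norm \<zeta>)\<^sup>2" by (cases "S = 0") auto
  then show ?thesis by (simp add: S_def)
qed

lemma opmat_norm_bound:
  assumes bd: "opmat_norm I p q A \<le> ennreal C" and C: "C \<ge> 0"
    and \<xi>: "\<And>j. j < q \<Longrightarrow> \<xi> j \<in> ell2 I"
    and hom: "\<And>i j c \<zeta>. \<zeta> \<in> ell2 I \<Longrightarrow> A i j (\<lambda>s. c * \<zeta> s) = (\<lambda>s. c * A i j \<zeta> s)"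
  shows "(\<Sum>i<p. (l2norm (\<lambda>s. \<Sum>j<q. A i j (\<xi> j) s))\<^sup>2) \<le> C\<^sup>2 * (\<Sum>j<q. (l2norm (\<xi> j))\<^sup>2)"
proof -
  define L where "L = (\<Sum>i<p. (l2norm (\<lambda>s. \<Sum>j<q. A i j (\<xi> j) s))\<^sup>2)"
  define N where "N = (\<Sum>j<q. (l2norm (\<xi> j))\<^sup>2)"
  have L0: "L \<ge> 0" and N0: "N \<ge> 0" unfolding L_def N_def by (auto intro: sum_nonneg)
  have scaled: "c\<^sup>2 * L \<le> C\<^sup>2" if c: "c\<^sup>2 * N \<le> 1" for c :: real
  proof -
    let ?\<xi> = "\<lambda>j s. complex_of_real c * \<xi> j s"
    have 1: "?\<xi> j \<in> ell2 I" if "j < q" for j using \<xi>[OF that] by (rule ell2_scale)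
    have 2: "(\<Sum>j<q. (l2norm (?\<xi> j))\<^sup>2) \<le> 1"
      using c by (simp add: l2norm_scale N_def sum_distrib_left)
    have "(\<lambda>s. \<Sum>j<q. A i j (?\<xi> j) s) = (\<lambda>s. complex_of_real c * (\<Sum>j<q. A i j (\<xi> j) s))" for i
      using \<xi> hom by (simp add: sum_distrib_left)
    then have "(\<Sum>i<p. (l2norm (\<lambda>s. \<Sum>j<q. A i j (?\<xi> j) s))\<^sup>2) = c\<^sup>2 * L"
      by (simp only: l2norm_scale L_def norm_of_real power2_abs sum_distrib_left[of "c\<^sup>2"])
    then have "ennreal (sqrt (c\<^sup>2 * L)) \<le> ennreal C"
      using order_trans[OF opmat_norm_upper[OF 1 2, where p = p and A = A] bd] by simp
    then have "sqrt (c\<^sup>2 * L) \<le> C" using C by (simp add: ennreal_le_iff)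
    then show ?thesis by (simp add: sqrt_le_D)
  qed
  have "L \<le> C\<^sup>2 * N"
  proof (cases "N = 0")
    case True
    have "L = 0"
    proof (rule ccontr)
      assume "L \<noteq> 0"
      then have "L > 0" using L0 by simp
      \<comment> \<open>When \<open>N = 0\<close>, vectors may be scaled by any factor; this one
        would make the scaled output \<open>C\<^sup>2 + 1\<close>, above the bound
        \<open>C\<^sup>2\<close>.\<close>
      then show False
        using scaled[of "sqrt ((C\<^sup>2 + 1) / L)"] True by (simp add: real_sqrt_pow2)
    qed
    then show ?thesis using True by simp
  next
    case False
    then have "N > 0" using N0 by simp
    then show ?thesis using scaled[of "sqrt (1 / N)"] by (simp add: real_sqrt_pow2 field_simps)
  qed
  then show ?thesis by (simp only: L_def N_def)
qed

section \<open>The norms of \<open>M\<^sub>n\<close> and \<open>S\<^sub>1\<^sup>n\<close>\<close>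

lemma opmat_norm_mat_op_le_iff:
  fixes M :: "nat \<Rightarrow> nat \<Rightarrow> 'j \<Rightarrow> 'j \<Rightarrow> complex"
  assumes J: "finite J" and C: "C \<ge> 0"
  shows "opmat_norm J p q (\<lambda>\<alpha> \<beta>. mat_op J (M \<alpha> \<beta>)) \<le> ennreal C \<longleftrightarrow>
    (\<forall>\<zeta>. (\<Sum>\<alpha><p. \<Sum>s\<in>J. (cmod (\<Sum>\<beta><q. \<Sum>t\<in>J. M \<alpha> \<beta> s t * \<zeta> \<beta> t))\<^sup>2)
      \<le> C\<^sup>2 * (\<Sum>\<beta><q. \<Sum>t\<in>J. (cmod (\<zeta> \<beta> t))\<^sup>2))"
proof -
  have lhs: "(l2norm (\<lambda>s. \<Sum>\<beta><q. mat_op J (M \<alpha> \<beta>) (\<xi> \<beta>) s))\<^sup>2 =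
      (\<Sum>s\<in>J. (cmod (\<Sum>\<beta><q. \<Sum>t\<in>J. M \<alpha> \<beta> s t * \<xi> \<beta> t))\<^sup>2)" for \<alpha> \<xi>
    by (subst l2norm_sq_finite[OF J]) (simp_all add: mat_op_def)
  have rhs: "(l2norm \<xi>)\<^sup>2 = (\<Sum>t\<in>J. (cmod (\<xi> t))\<^sup>2)" if "\<xi> \<in> ell2 J" for \<xi>
    by (rule l2norm_sq_finite[OF J ell2D[OF that]])
  show ?thesis
  proof (intro iffI allI)
    fix \<zeta> :: "nat \<Rightarrow> 'j \<Rightarrow> complex"
    assume bd: "opmat_norm J p q (\<lambda>\<alpha> \<beta>. mat_op J (M \<alpha> \<beta>)) \<le> ennreal C"
    let ?\<xi> = "\<lambda>\<beta> t. if t \<in> J then \<zeta> \<beta> t else 0"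
    have \<xi>: "?\<xi> \<beta> \<in> ell2 J" for \<beta> by (rule ell2_finite_support[OF J order_refl])
    have "mat_op J (M \<alpha> \<beta>) (\<lambda>s. c * \<zeta> s) = (\<lambda>s. c * mat_op J (M \<alpha> \<beta>) \<zeta> s)" for \<alpha> \<beta> c \<zeta>
      by (auto simp: mat_op_def sum_distrib_left mult_ac)
    from opmat_norm_bound[OF bd C \<xi> this]
    show "(\<Sum>\<alpha><p. \<Sum>s\<in>J. (cmod (\<Sum>\<beta><q. \<Sum>t\<in>J. M \<alpha> \<beta> s t * \<zeta> \<beta> t))\<^sup>2)
      \<le> C\<^sup>2 * (\<Sum>\<beta><q. \<Sum>t\<in>J. (cmod (\<zeta> \<beta> t))\<^sup>2)"
      unfolding lhs rhs[OF \<xi>] by simp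
  next
    assume *: "\<forall>\<zeta>. (\<Sum>\<alpha><p. \<Sum>s\<in>J. (cmod (\<Sum>\<beta><q. \<Sum>t\<in>J. M \<alpha> \<beta> s t * \<zeta> \<beta> t))\<^sup>2)
      \<le> C\<^sup>2 * (\<Sum>\<beta><q. \<Sum>t\<in>J. (cmod (\<zeta> \<beta> t))\<^sup>2)"
    show "opmat_norm J p q (\<lambda>\<alpha> \<beta>. mat_op J (M \<alpha> \<beta>)) \<le> ennreal C"
    proof (rule opmat_norm_least)
      fix \<xi> :: "nat \<Rightarrow> 'j \<Rightarrow> complex"
      assume \<xi>: "\<And>j. j < q \<Longrightarrow> \<xi> j \<in> ell2 J" "(\<Sum>j<q. (l2norm (\<xi> j))\<^sup>2) \<le> 1"
      have "(\<Sum>\<alpha><p. (l2norm (\<lambda>s. \<Sum>\<beta><q. mat_op J (M \<alpha> \<beta>) (\<xi> \<beta>) s))\<^sup>2)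
          \<le> C\<^sup>2 * (\<Sum>\<beta><q. \<Sum>t\<in>J. (cmod (\<xi> \<beta> t))\<^sup>2)"
        unfolding lhs using * by blast
      also have "(\<Sum>\<beta><q. \<Sum>t\<in>J. (cmod (\<xi> \<beta> t))\<^sup>2) = (\<Sum>j<q. (l2norm (\<xi> j))\<^sup>2)"
        using \<xi>(1) rhs by simp
      also have "C\<^sup>2 * \<dots> \<le> C\<^sup>2 * 1" by (intro mult_left_mono \<xi>(2)) simp
      finally show "ennreal (sqrt (\<Sum>\<alpha><p. (l2norm (\<lambda>s. \<Sum>\<beta><q. mat_op J (M \<alpha> \<beta>) (\<xi> \<beta>) s))\<^sup>2)) \<le> ennreal C"
        using C by (intro ennreal_leI real_le_lsqrt) auto
    qed
  qed
qed

lemma M_os_le_1_iff: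
  fixes x :: "nat \<Rightarrow> nat \<Rightarrow> 'n::finite \<times> 'n \<Rightarrow> complex"
  shows "M_os l x \<le> 1 \<longleftrightarrow>
    (\<forall>\<zeta>. (\<Sum>\<alpha><l. \<Sum>s\<in>UNIV. (cmod (\<Sum>\<beta><l. \<Sum>t\<in>UNIV. x \<alpha> \<beta> (s, t) * \<zeta> \<beta> t))\<^sup>2)
      \<le> (\<Sum>\<beta><l. \<Sum>t\<in>UNIV. (cmod (\<zeta> \<beta> t))\<^sup>2))"
  using opmat_norm_mat_op_le_iff[of UNIV 1 l l "\<lambda>\<alpha> \<beta> s t. x \<alpha> \<beta> (s, t)"] by (simp add: M_os_def)

text \<open>The norm of the functional matrix is tested on all contractions \<open>x\<close> in
  matrices over \<open>M_n\<close>. The pairing is a matrix with rows \<open>(\<alpha>, i)\<close>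
  and columns \<open>(\<beta>, j)\<close>, and the flip \<open>(t, s)\<close> against
  \<open>(s, t)\<close> comes from the trace.\<close>

lemma S1_os_le_iff:
  fixes a :: "nat \<Rightarrow> nat \<Rightarrow> 'n::finite \<times> 'n \<Rightarrow> complex"
  assumes C: "C \<ge> 0"
  shows "S1_os k a \<le> ennreal C \<longleftrightarrow> (\<forall>l x. M_os l x \<le> 1 \<longrightarrow>
    (\<forall>\<zeta>. (\<Sum>\<alpha><l. \<Sum>i<k. (cmod (\<Sum>\<beta><l. \<Sum>j<k. (\<Sum>s\<in>UNIV. \<Sum>t\<in>UNIV. a i j (t, s) * x \<alpha> \<beta> (s, t)) * \<zeta> \<beta> j))\<^sup>2)
      \<le> C\<^sup>2 * (\<Sum>\<beta><l. \<Sum>j<k. (cmod (\<zeta> \<beta> j))\<^sup>2)))"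
proof -
  have pair: "(\<Sum>p\<in>UNIV. (case p of (s, t) \<Rightarrow> a i j (t, s)) * y p) = (\<Sum>s\<in>UNIV. \<Sum>t\<in>UNIV. a i j (t, s) * y (s, t))"
    for i j and y :: "'n \<times> 'n \<Rightarrow> complex"
    unfolding UNIV_Times_UNIV[symmetric] sum.cartesian_product by (intro sum.cong) auto
  show ?thesis
    unfolding S1_os_def dual_os_def cb_norm_def SUP_le_iff pair mem_Collect_eq Ball_def
    by (simp add: opmat_norm_mat_op_le_iff[OF _ C])
qed

lemmas S1_os_leI = S1_os_le_iff[THEN iffD2, rule_format]
  and S1_os_leD = S1_os_le_iff[THEN iffD1, rule_format]

lemma complete_contraction_bound:
  assumes T: "complete_contraction X I T" and x: "X l x \<le> 1" and \<xi>: "\<And>j. j < l \<Longrightarrow> \<xi> j \<in> ell2 I"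
  shows "(\<Sum>i<l. (l2norm (\<lambda>s. \<Sum>j<l. T (x i j) (\<xi> j) s))\<^sup>2) \<le> (\<Sum>j<l. (l2norm (\<xi> j))\<^sup>2)"
proof -
  have "opmat_norm I l l (\<lambda>i j. T (x i j)) \<le> cb_norm X I T"
    unfolding cb_norm_def using x by (intro SUP_upper2[where i = l] SUP_upper2[where i = x]) auto
  also have "\<dots> \<le> ennreal 1" using T by (simp add: complete_contraction_def)
  finally have "opmat_norm I l l (\<lambda>i j. T (x i j)) \<le> ennreal 1" .
  moreover have "T y (\<lambda>s. c * \<zeta> s) = (\<lambda>s. c * T y \<zeta> s)" if "\<zeta> \<in> ell2 I" for y c \<zeta>
    using T that by (intro bounded_ops_scale) (simp_all add: complete_contraction_def linear_into_def)
  ultimately show ?thesis 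
    using opmat_norm_bound[where p = l and q = l and A = "\<lambda>i j. T (x i j)" and \<xi> = \<xi> and C = 1] \<xi> by simp
qed

section \<open>Rows and columns of matrix units in the trace class\<close>

context
  fixes e :: "'n::finite \<Rightarrow> nat"
  assumes e: "bij_betw e UNIV {..<CARD('n)}"
begin

lemma inv_enum: "inv e (e t) = t"
  using e by (simp add: bij_betw_def)

lemma sum_enum: "(\<Sum>j<CARD('n). f j) = (\<Sum>t\<in>UNIV. f (e t))"
  by (rule sum.reindex_bij_betw[OF e, symmetric])

lemma enum_less: "e t < CARD('n)"
  using e by (auto simp: bij_betw_def)

lemma enum_eq_iff: "e t = e t' \<longleftrightarrow> t = t'"
  using e by (auto simp: bij_betw_def inj_eq)

text \<open>Pairing this row of matrix units with \<open>x\<close> leaves the block row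
  \<open>s\<close> of \<open>x\<close>, and passing to a block row does not increase the norm. The
  enumeration \<open>e\<close> translates the coordinates \<open>'n\<close> of \<open>S1_os\<close>
  into the natural numbers that index matrices.\<close>

lemma S1_os_row:
  "S1_os CARD('n) (\<lambda>\<alpha> \<beta> (t, s'). if \<alpha> = 0 \<and> s' = s \<and> e t = \<beta> then 1 else 0) \<le> 1"
proof -
  have "S1_os CARD('n) (\<lambda>\<alpha> \<beta> (t, s'). if \<alpha> = 0 \<and> s' = s \<and> e t = \<beta> then 1 else 0) \<le> ennreal 1"
  proof (rule S1_os_leI)
    fix l and x :: "nat \<Rightarrow> nat \<Rightarrow> 'n \<times> 'n \<Rightarrow> complex" and \<zeta> :: "nat \<Rightarrow> nat \<Rightarrow> complex"
    assume x: "M_os l x \<le> 1"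
    let ?L = "\<lambda>\<alpha> i. \<Sum>\<beta><l. \<Sum>j<CARD('n). (\<Sum>s'\<in>UNIV. \<Sum>t\<in>UNIV. (case (t, s') of (t, s') \<Rightarrow>
        if i = 0 \<and> s' = s \<and> e t = j then 1 else 0) * x \<alpha> \<beta> (s', t)) * \<zeta> \<beta> j"
    have L: "?L \<alpha> i = (if i = 0 then \<Sum>\<beta><l. \<Sum>t\<in>UNIV. x \<alpha> \<beta> (s, t) * \<zeta> \<beta> (e t) else 0)" for \<alpha> and i :: nat
    proof (cases "i = 0")
      case True
      have "(\<Sum>s'\<in>UNIV. \<Sum>t\<in>UNIV. (if s' = s \<and> e t = e t' then 1 else 0) * x \<alpha> \<beta> (s', t)) = x \<alpha> \<beta> (s, t')" for \<beta> t'
      proof -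
        have "(if s' = s \<and> e t = e t' then 1 else 0) * x \<alpha> \<beta> (s', t) =
            (if t = t' then if s' = s then x \<alpha> \<beta> (s, t') else 0 else 0)" for s' t
          by (simp add: enum_eq_iff)
        then show ?thesis by simp
      qed
      then show ?thesis using True by (simp add: sum_enum)
    qed simp
    have "(\<Sum>\<alpha><l. \<Sum>i<CARD('n). (cmod (?L \<alpha> i))\<^sup>2) =
        (\<Sum>\<alpha><l. (cmod (\<Sum>\<beta><l. \<Sum>t\<in>UNIV. x \<alpha> \<beta> (s, t) * \<zeta> \<beta> (e t)))\<^sup>2)"
      unfolding L by (simp add: if_distrib[of "\<lambda>z. (cmod z)\<^sup>2"] cong: if_cong)
    also have "\<dots> \<le> (\<Sum>\<alpha><l. \<Sum>s'\<in>UNIV. (cmod (\<Sum>\<beta><l. \<Sum>t\<in>UNIV. x \<alpha> \<beta> (s', t) * \<zeta> \<beta> (e t)))\<^sup>2)"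
      by (intro sum_mono member_le_sum) auto
    also have "\<dots> \<le> (\<Sum>\<beta><l. \<Sum>t\<in>UNIV. (cmod (\<zeta> \<beta> (e t)))\<^sup>2)"
      using x unfolding M_os_le_1_iff by (rule allE[where x = "\<lambda>\<beta> t. \<zeta> \<beta> (e t)"])
    finally show "(\<Sum>\<alpha><l. \<Sum>i<CARD('n). (cmod (?L \<alpha> i))\<^sup>2) \<le> 1\<^sup>2 * (\<Sum>\<beta><l. \<Sum>j<CARD('n). (cmod (\<zeta> \<beta> j))\<^sup>2)"
      by (simp add: sum_enum)
  qed simp
  then show ?thesis by simp
qed

text \<open>Here the pairing leaves the block column \<open>t\<close>, that is, \<open>x\<close>
  restricted to vectors supported at coordinate \<open>t\<close>.\<close>

lemma S1_os_column:
  "S1_os CARD('n) (\<lambda>\<alpha> \<beta> (t', s). if \<beta> = 0 \<and> t' = t \<and> e s = \<alpha> then 1 else 0) \<le> 1"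
proof -
  have "S1_os CARD('n) (\<lambda>\<alpha> \<beta> (t', s). if \<beta> = 0 \<and> t' = t \<and> e s = \<alpha> then 1 else 0) \<le> ennreal 1"
  proof (rule S1_os_leI)
    fix l and x :: "nat \<Rightarrow> nat \<Rightarrow> 'n \<times> 'n \<Rightarrow> complex" and \<zeta> :: "nat \<Rightarrow> nat \<Rightarrow> complex"
    assume x: "M_os l x \<le> 1"
    let ?L = "\<lambda>\<alpha> i. \<Sum>\<beta><l. \<Sum>j<CARD('n). (\<Sum>s\<in>UNIV. \<Sum>t'\<in>UNIV. (case (t', s) of (t', s) \<Rightarrow>
        if j = 0 \<and> t' = t \<and> e s = i then 1 else 0) * x \<alpha> \<beta> (s, t')) * \<zeta> \<beta> j"
    let ?\<zeta> = "\<lambda>\<beta> t'. if t' = t then \<zeta> \<beta> 0 else 0"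
    have L: "?L \<alpha> (e s) = (\<Sum>\<beta><l. \<Sum>t'\<in>UNIV. x \<alpha> \<beta> (s, t') * ?\<zeta> \<beta> t')" for \<alpha> s
    proof (rule sum.cong[OF refl])
      fix \<beta>
      have "(\<Sum>s'\<in>UNIV. \<Sum>t'\<in>UNIV. (if j = 0 \<and> t' = t \<and> e s' = e s then 1 else 0) * x \<alpha> \<beta> (s', t')) =
          (if j = 0 then x \<alpha> \<beta> (s, t) else 0)" for j :: nat
      proof -
        have "(if j = 0 \<and> t' = t \<and> e s' = e s then 1 else 0) * x \<alpha> \<beta> (s', t') =
            (if t' = t then if s' = s then if j = 0 then x \<alpha> \<beta> (s, t) else 0 else 0 else 0)" for s' t'
          by (simp add: enum_eq_iff)
        then show ?thesis by simp
      qed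
      then show "(\<Sum>j<CARD('n). (\<Sum>s'\<in>UNIV. \<Sum>t'\<in>UNIV. (case (t', s') of (t', s') \<Rightarrow>
          if j = 0 \<and> t' = t \<and> e s' = e s then 1 else 0) * x \<alpha> \<beta> (s', t')) * \<zeta> \<beta> j) =
          (\<Sum>t'\<in>UNIV. x \<alpha> \<beta> (s, t') * ?\<zeta> \<beta> t')"
        by (simp add: if_distrib[of "\<lambda>x. x * _"] if_distrib[of "\<lambda>x. _ * x"] cong: if_cong)
    qed
    have "(\<Sum>\<alpha><l. \<Sum>i<CARD('n). (cmod (?L \<alpha> i))\<^sup>2) =
        (\<Sum>\<alpha><l. \<Sum>s\<in>UNIV. (cmod (\<Sum>\<beta><l. \<Sum>t'\<in>UNIV. x \<alpha> \<beta> (s, t') * ?\<zeta> \<beta> t'))\<^sup>2)"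
      unfolding sum_enum[of "\<lambda>i. (cmod (?L _ i))\<^sup>2"] L ..
    also have "\<dots> \<le> (\<Sum>\<beta><l. \<Sum>t'\<in>UNIV. (cmod (?\<zeta> \<beta> t'))\<^sup>2)"
      using x unfolding M_os_le_1_iff by (rule allE[where x = ?\<zeta>])
    also have "\<dots> = (\<Sum>\<beta><l. (cmod (\<zeta> \<beta> 0))\<^sup>2)"
      by (simp add: if_distrib[of "\<lambda>z. (cmod z)\<^sup>2"] cong: if_cong)
    also have "\<dots> \<le> (\<Sum>\<beta><l. \<Sum>j<CARD('n). (cmod (\<zeta> \<beta> j))\<^sup>2)"
      by (intro sum_mono member_le_sum) auto
    finally show "(\<Sum>\<alpha><l. \<Sum>i<CARD('n). (cmod (?L \<alpha> i))\<^sup>2) \<le> 1\<^sup>2 * (\<Sum>\<beta><l. \<Sum>j<CARD('n). (cmod (\<zeta> \<beta> j))\<^sup>2)"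
      by simp
  qed simp
  then show ?thesis by simp
qed

text \<open>Together with \<open>S1_contraction_column\<close> this is how complete contractivity
  enters the upper bound: every row and every column of the operator matrix
  \<open>A s t = T (unit (t, s))\<close> is a contraction.\<close>

lemma S1_contraction_row:
  fixes y :: "'n \<Rightarrow> 'i \<Rightarrow> complex"
  assumes T: "complete_contraction S1_os I T" and y: "\<And>t. y t \<in> ell2 I"
  shows "(l2norm (\<lambda>i. \<Sum>t\<in>UNIV. T (unit (t, s)) (y t) i))\<^sup>2 \<le> (\<Sum>t\<in>UNIV. (l2norm (y t))\<^sup>2)"
proof -
  let ?x = "\<lambda>(\<alpha> :: nat) \<beta> (t, s'). if \<alpha> = 0 \<and> s' = s \<and> e t = \<beta> then 1 else 0 :: complex"
  let ?\<xi> = "\<lambda>j. y (inv e j)"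
  have x: "?x 0 (e t) = unit (t, s)" for t
    by (auto simp: unit_def fun_eq_iff enum_eq_iff)
  have "(l2norm (\<lambda>i. \<Sum>t\<in>UNIV. T (unit (t, s)) (y t) i))\<^sup>2 =
      (l2norm (\<lambda>i. \<Sum>j<CARD('n). T (?x 0 j) (?\<xi> j) i))\<^sup>2"
    unfolding sum_enum x inv_enum ..
  also have "\<dots> \<le> (\<Sum>i<CARD('n). (l2norm (\<lambda>s. \<Sum>j<CARD('n). T (?x i j) (?\<xi> j) s))\<^sup>2)"
    by (rule member_le_sum) auto
  also have "\<dots> \<le> (\<Sum>j<CARD('n). (l2norm (?\<xi> j))\<^sup>2)"
    by (rule complete_contraction_bound[where x = ?x and \<xi> = ?\<xi>, OF T S1_os_row y])
  also have "\<dots> = (\<Sum>t\<in>UNIV. (l2norm (y t))\<^sup>2)"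
    unfolding sum_enum inv_enum ..
  finally show ?thesis .
qed

lemma S1_contraction_column:
  fixes t :: 'n
  assumes T: "complete_contraction S1_os I T" and \<xi>: "\<xi> \<in> ell2 I"
  shows "(\<Sum>s\<in>UNIV. (l2norm (T (unit (t, s)) \<xi>))\<^sup>2) \<le> (l2norm \<xi>)\<^sup>2"
proof -
  let ?x = "\<lambda>\<alpha> (\<beta> :: nat) (t', s). if \<beta> = 0 \<and> t' = t \<and> e s = \<alpha> then 1 else 0 :: complex"
  let ?\<xi> = "\<lambda>j :: nat. if j = 0 then \<xi> else (\<lambda>_. 0)"
  have lin: "T x \<in> bounded_ops I" for x using T by (simp add: complete_contraction_def linear_into_def)
  have x: "?x (e s) 0 = unit (t, s)" for s
    by (auto simp: unit_def fun_eq_iff enum_eq_iff)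
  have x\<xi>: "(\<lambda>i. \<Sum>j<CARD('n). T (?x k j) (?\<xi> j) i) = T (?x k 0) \<xi>" for k
  proof
    fix i
    have "(\<Sum>j<CARD('n). T (?x k j) (?\<xi> j) i) = (\<Sum>j<CARD('n). if j = 0 then T (?x k 0) \<xi> i else 0)"
      by (intro sum.cong refl) (simp add: bounded_ops_zero[OF lin])
    then show "(\<Sum>j<CARD('n). T (?x k j) (?\<xi> j) i) = T (?x k 0) \<xi> i" by simp
  qed
  have "(\<Sum>s\<in>UNIV. (l2norm (T (unit (t, s)) \<xi>))\<^sup>2) =
      (\<Sum>k<CARD('n). (l2norm (\<lambda>i. \<Sum>j<CARD('n). T (?x k j) (?\<xi> j) i))\<^sup>2)"
    unfolding x\<xi> sum_enum[of "\<lambda>k. (l2norm (T (?x k 0) \<xi>))\<^sup>2"] x ..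
  also have "\<dots> \<le> (\<Sum>j<CARD('n). (l2norm (?\<xi> j))\<^sup>2)"
    by (rule complete_contraction_bound[where x = ?x and \<xi> = ?\<xi>, OF T S1_os_column]) (simp add: \<xi>)
  also have "\<dots> = (\<Sum>j<CARD('n). if j = 0 then (l2norm \<xi>)\<^sup>2 else 0)"
    by (intro sum.cong) auto
  also have "\<dots> = (l2norm \<xi>)\<^sup>2" by simp
  finally show ?thesis .
qed

section \<open>Test matrices and a lower bound for the Haagerup norm\<close>

text \<open>The test matrix for the left factor. Its only nonzero rows are those at
  \<open>(e p, p)\<close>: the conjugate of \<open>r p\<close>, which lives on the graph of
  \<open>\<tau> p\<close>, divided by the root of n. By \<open>orth\<close> the \<open>r p\<close>
  are orthogonal of squared norm n, so these rows are orthonormal and Bessel's inequality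
  applies.\<close>

lemma M_os_partial_isometry:
  fixes \<phi> :: "'n \<Rightarrow> 'n \<Rightarrow> complex" and \<tau> :: "'n \<Rightarrow> 'n \<Rightarrow> 'n"
  assumes orth: "\<And>p p'. (\<Sum>v\<in>UNIV. if \<tau> p v = \<tau> p' v then cnj (\<phi> p v) * \<phi> p' v else 0) =
      (if p = p' then of_nat CARD('n) else 0)"
  shows "M_os CARD('n) (\<lambda>\<alpha> \<beta> (s, t). if s = inv e \<alpha> \<and> t = \<tau> (inv e \<alpha>) (inv e \<beta>)
      then cnj (\<phi> (inv e \<alpha>) (inv e \<beta>)) / sqrt CARD('n) else 0) \<le> 1"
  unfolding M_os_le_1_iff
proof
  fix \<zeta> :: "nat \<Rightarrow> 'n \<Rightarrow> complex"
  let ?n = "real CARD('n)"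
  let ?x = "\<lambda>\<alpha> \<beta> (s, t). if s = inv e \<alpha> \<and> t = \<tau> (inv e \<alpha>) (inv e \<beta>)
      then cnj (\<phi> (inv e \<alpha>) (inv e \<beta>)) / sqrt CARD('n) else 0"
  define r where "r = (\<lambda>p (v, t). if t = \<tau> p v then \<phi> p v else 0)"
  define z where "z = (\<lambda>(v, t). \<zeta> (e v) t)"
  have "(\<Sum>x\<in>UNIV. cnj (r p x) * r p' x) = (if p = p' then complex_of_real ?n else 0)" for p p'
  proof -
    have "(\<Sum>x\<in>UNIV. cnj (r p x) * r p' x) =
        (\<Sum>v\<in>UNIV. \<Sum>t\<in>UNIV. if t = \<tau> p v then (if \<tau> p v = \<tau> p' v then cnj (\<phi> p v) * \<phi> p' v else 0) else 0)"
      unfolding sum_UNIV_prod by (intro sum.cong refl) (auto simp: r_def)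
    then show ?thesis using orth[of p p'] by simp
  qed
  then have bessel: "(\<Sum>p\<in>UNIV. (cmod (\<Sum>x\<in>UNIV. cnj (r p x) * z x))\<^sup>2) \<le> ?n * (\<Sum>x\<in>UNIV. (cmod (z x))\<^sup>2)"
    by (intro bessel_inequality) auto
  have row: "(\<Sum>\<beta><CARD('n). \<Sum>t\<in>UNIV. ?x (e p) \<beta> (s, t) * \<zeta> \<beta> t) =
      (if s = p then (\<Sum>x\<in>UNIV. cnj (r p x) * z x) / sqrt ?n else 0)" for p s
  proof -
    have "(\<Sum>x\<in>UNIV. cnj (r p x) * z x) = (\<Sum>v\<in>UNIV. \<Sum>t\<in>UNIV. if t = \<tau> p v then cnj (\<phi> p v) * \<zeta> (e v) t else 0)"
      unfolding sum_UNIV_prod by (intro sum.cong refl) (auto simp: r_def z_def)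
    moreover have "(\<Sum>\<beta><CARD('n). \<Sum>t\<in>UNIV. ?x (e p) \<beta> (s, t) * \<zeta> \<beta> t) = (\<Sum>v\<in>UNIV. \<Sum>t\<in>UNIV.
        if t = \<tau> p v then (if s = p then cnj (\<phi> p v) * \<zeta> (e v) t / sqrt ?n else 0) else 0)"
      unfolding sum_enum by (intro sum.cong refl) (auto simp: inv_enum)
    ultimately show ?thesis by (simp add: sum_divide_distrib)
  qed
  have "(\<Sum>\<alpha><CARD('n). \<Sum>s\<in>UNIV. (cmod (\<Sum>\<beta><CARD('n). \<Sum>t\<in>UNIV. ?x \<alpha> \<beta> (s, t) * \<zeta> \<beta> t))\<^sup>2) =
      (\<Sum>p\<in>UNIV. (cmod (\<Sum>x\<in>UNIV. cnj (r p x) * z x))\<^sup>2 / ?n)"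
    unfolding sum_enum[of "\<lambda>\<alpha>. \<Sum>s\<in>UNIV. (cmod (\<Sum>\<beta><CARD('n). \<Sum>t\<in>UNIV. ?x \<alpha> \<beta> (s, t) * \<zeta> \<beta> t))\<^sup>2"] row
    by (simp add: if_distrib[of "\<lambda>z. (cmod z)\<^sup>2"] norm_divide power_divide cong: if_cong)
  also have "\<dots> \<le> (\<Sum>x\<in>UNIV. (cmod (z x))\<^sup>2)"
    using bessel by (simp add: divide_le_eq mult.commute flip: sum_divide_distrib)
  also have "\<dots> = (\<Sum>\<beta><CARD('n). \<Sum>t\<in>UNIV. (cmod (\<zeta> \<beta> t))\<^sup>2)"
    unfolding sum_UNIV_prod sum_enum by (simp add: z_def)
  finally show "(\<Sum>\<alpha><CARD('n). \<Sum>s\<in>UNIV. (cmod (\<Sum>\<beta><CARD('n). \<Sum>t\<in>UNIV. ?x \<alpha> \<beta> (s, t) * \<zeta> \<beta> t))\<^sup>2)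
      \<le> (\<Sum>\<beta><CARD('n). \<Sum>t\<in>UNIV. (cmod (\<zeta> \<beta> t))\<^sup>2)" .
qed

text \<open>\<open>u\<close> is paired with the partial isometry above and applied to
  \<open>y\<close>, padded by zeros. For each \<open>p\<close> only the output coordinate
  \<open>(e p, \<iota> p)\<close> is kept. The factor n undoes the normalization of the test
  matrix.\<close>

lemma rect_S1_rows_bound:
  fixes \<phi> :: "'n \<Rightarrow> 'n \<Rightarrow> complex" and \<tau> :: "'n \<Rightarrow> 'n \<Rightarrow> 'n"
  assumes orth: "\<And>p p'. (\<Sum>v\<in>UNIV. if \<tau> p v = \<tau> p' v then cnj (\<phi> p v) * \<phi> p' v else 0) =
      (if p = p' then of_nat CARD('n) else 0)"
    and u: "rect_norm S1_os k r u \<le> ennreal C" and C: "C \<ge> 0" and \<iota>: "\<And>p. \<iota> p < k"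
  shows "(\<Sum>p\<in>UNIV. (cmod (\<Sum>l<r. \<Sum>v\<in>UNIV. cnj (\<phi> p v) * u (\<iota> p) l (\<tau> p v, p) * y l v))\<^sup>2)
    \<le> real CARD('n) * C\<^sup>2 * (\<Sum>l<r. \<Sum>v\<in>UNIV. (cmod (y l v))\<^sup>2)"
proof -
  let ?n = "real CARD('n)" and ?K = "max k r"
  let ?x = "\<lambda>\<alpha> \<beta> (s, t). if s = inv e \<alpha> \<and> t = \<tau> (inv e \<alpha>) (inv e \<beta>)
      then cnj (\<phi> (inv e \<alpha>) (inv e \<beta>)) / sqrt CARD('n) else 0"
  let ?a = "\<lambda>i j. if i < k \<and> j < r then u i j else (\<lambda>_. 0)"
  let ?\<zeta> = "\<lambda>\<beta> j. if j < r then y j (inv e \<beta>) else 0"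
  let ?L = "\<lambda>\<alpha> i. \<Sum>\<beta><CARD('n). \<Sum>j<?K. (\<Sum>s\<in>UNIV. \<Sum>t\<in>UNIV. ?a i j (t, s) * ?x \<alpha> \<beta> (s, t)) * ?\<zeta> \<beta> j"
  let ?R = "\<lambda>p. \<Sum>l<r. \<Sum>v\<in>UNIV. cnj (\<phi> p v) * u (\<iota> p) l (\<tau> p v, p) * y l v"
  have "S1_os ?K ?a \<le> ennreal C" using u by (simp add: rect_norm_def)
  from S1_os_leD[OF C this M_os_partial_isometry[OF orth], of ?\<zeta>]
  have bd: "(\<Sum>\<alpha><CARD('n). \<Sum>i<?K. (cmod (?L \<alpha> i))\<^sup>2) \<le> C\<^sup>2 * (\<Sum>\<beta><CARD('n). \<Sum>j<?K. (cmod (?\<zeta> \<beta> j))\<^sup>2)" .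
  have L: "?L (e p) (\<iota> p) = ?R p / sqrt ?n" for p
  proof -
    have pair: "(\<Sum>s\<in>UNIV. \<Sum>t\<in>UNIV. ?a (\<iota> p) j (t, s) * ?x (e p) (e v) (s, t)) =
        u (\<iota> p) j (\<tau> p v, p) * cnj (\<phi> p v) / sqrt ?n" if "j < r" for j v
    proof -
      have "?a (\<iota> p) j (t, s) * ?x (e p) (e v) (s, t) =
          (if t = \<tau> p v then if s = p then u (\<iota> p) j (\<tau> p v, p) * cnj (\<phi> p v) / sqrt ?n else 0 else 0)" for s t
        using that \<iota>[of p] by (auto simp: inv_enum)
      then show ?thesis by simp
    qed
    have "?L (e p) (\<iota> p) = (\<Sum>v\<in>UNIV. \<Sum>j<?K.
        (\<Sum>s\<in>UNIV. \<Sum>t\<in>UNIV. ?a (\<iota> p) j (t, s) * ?x (e p) (e v) (s, t)) * ?\<zeta> (e v) j)"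
      by (rule sum_enum)
    also have "\<dots> = (\<Sum>v\<in>UNIV. \<Sum>j<r. cnj (\<phi> p v) * u (\<iota> p) j (\<tau> p v, p) * y j v / sqrt ?n)"
    proof (intro sum.cong[OF refl] sum.mono_neutral_cong_right)
      fix v j assume "j \<in> {..<r}"
      then have j: "j < r" by simp
      show "(\<Sum>s\<in>UNIV. \<Sum>t\<in>UNIV. ?a (\<iota> p) j (t, s) * ?x (e p) (e v) (s, t)) * ?\<zeta> (e v) j =
          cnj (\<phi> p v) * u (\<iota> p) j (\<tau> p v, p) * y j v / sqrt ?n"
        unfolding pair[OF j] using j by (simp add: inv_enum)
    qed auto
    also have "\<dots> = ?R p / sqrt ?n"
      by (subst sum.swap) (simp add: sum_divide_distrib)
    finally show ?thesis .
  qed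
  have "(\<Sum>p\<in>UNIV. (cmod (?R p))\<^sup>2) / ?n = (\<Sum>p\<in>UNIV. (cmod (?L (e p) (\<iota> p)))\<^sup>2)"
    unfolding L by (simp add: norm_divide power_divide flip: sum_divide_distrib)
  also have "\<dots> \<le> (\<Sum>p\<in>UNIV. \<Sum>i<?K. (cmod (?L (e p) i))\<^sup>2)"
    by (intro sum_mono member_le_sum) (use \<iota> in \<open>auto simp: less_max_iff_disj\<close>)
  also have "\<dots> \<le> C\<^sup>2 * (\<Sum>\<beta><CARD('n). \<Sum>j<?K. (cmod (?\<zeta> \<beta> j))\<^sup>2)"
    using bd unfolding sum_enum[of "\<lambda>\<alpha>. \<Sum>i<?K. (cmod (?L \<alpha> i))\<^sup>2"] .
  also have "(\<Sum>\<beta><CARD('n). \<Sum>j<?K. (cmod (?\<zeta> \<beta> j))\<^sup>2) = (\<Sum>v\<in>UNIV. \<Sum>j<r. (cmod (y j v))\<^sup>2)"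
    unfolding sum_enum inv_enum by (intro sum.cong[OF refl] sum.mono_neutral_cong_right) auto
  also have "\<dots> = (\<Sum>l<r. \<Sum>v\<in>UNIV. (cmod (y l v))\<^sup>2)" by (rule sum.swap)
  finally show ?thesis by (simp add: field_simps)
qed

text \<open>The test matrix sends coordinate \<open>(0, \<rho> v)\<close> to \<open>(e v, q)\<close>
  and kills all others, so it is a contraction because \<open>\<rho>\<close> is injective. Its
  pairing with \<open>w\<close>, applied to the basis vector at \<open>(0, 0)\<close>, lists the
  entries in the sum.\<close>

lemma rect_S1_column_bound:
  fixes \<rho> :: "'n \<Rightarrow> 'n"
  assumes v: "rect_norm S1_os r k w \<le> ennreal C" and C: "C \<ge> 0" and k: "k > 0" and \<rho>: "inj \<rho>"
  shows "(\<Sum>l<r. \<Sum>v\<in>UNIV. (cmod (w l 0 (\<rho> v, q)))\<^sup>2) \<le> C\<^sup>2"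
proof -
  let ?K = "max r k"
  let ?x = "\<lambda>\<alpha> (\<beta> :: nat) (s, t). if \<beta> = 0 \<and> s = q \<and> t = \<rho> (inv e \<alpha>) then 1 else 0 :: complex"
  let ?a = "\<lambda>i j. if i < r \<and> j < k then w i j else (\<lambda>_. 0)"
  let ?\<zeta> = "\<lambda>(\<beta> :: nat) (j :: nat). if j = 0 then if \<beta> = 0 then 1 else 0 else 0 :: complex"
  let ?L = "\<lambda>\<alpha> i. \<Sum>\<beta><CARD('n). \<Sum>j<?K. (\<Sum>s\<in>UNIV. \<Sum>t\<in>UNIV. ?a i j (t, s) * ?x \<alpha> \<beta> (s, t)) * ?\<zeta> \<beta> j"
  have x: "M_os CARD('n) ?x \<le> 1"
    unfolding M_os_le_1_iff
  proof
    fix \<zeta> :: "nat \<Rightarrow> 'n \<Rightarrow> complex"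
    have row: "(\<Sum>\<beta><CARD('n). \<Sum>t\<in>UNIV. ?x (e v) \<beta> (s, t) * \<zeta> \<beta> t) = (if s = q then \<zeta> 0 (\<rho> v) else 0)" for v s
    proof -
      have "?x (e v) \<beta> (s, t) * \<zeta> \<beta> t = (if t = \<rho> v then if \<beta> = 0 then if s = q then \<zeta> 0 (\<rho> v) else 0 else 0 else 0)" for \<beta> t
        by (auto simp: inv_enum)
      then show ?thesis by simp
    qed
    have "(\<Sum>\<alpha><CARD('n). \<Sum>s\<in>UNIV. (cmod (\<Sum>\<beta><CARD('n). \<Sum>t\<in>UNIV. ?x \<alpha> \<beta> (s, t) * \<zeta> \<beta> t))\<^sup>2) =
        (\<Sum>v\<in>UNIV. (cmod (\<zeta> 0 (\<rho> v)))\<^sup>2)"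
      unfolding sum_enum[of "\<lambda>\<alpha>. \<Sum>s\<in>UNIV. (cmod (\<Sum>\<beta><CARD('n). \<Sum>t\<in>UNIV. ?x \<alpha> \<beta> (s, t) * \<zeta> \<beta> t))\<^sup>2"] row
      by (simp add: if_distrib[of "\<lambda>z. (cmod z)\<^sup>2"] cong: if_cong)
    also have "\<dots> = (\<Sum>t\<in>UNIV. (cmod (\<zeta> 0 t))\<^sup>2)"
      by (rule sum.reindex_bij_betw) (use \<rho> in \<open>simp add: bij_betw_def finite_UNIV_inj_surj\<close>)
    also have "\<dots> \<le> (\<Sum>\<beta><CARD('n). \<Sum>t\<in>UNIV. (cmod (\<zeta> \<beta> t))\<^sup>2)"
      by (rule member_le_sum[of 0]) (auto intro: sum_nonneg)
    finally show "(\<Sum>\<alpha><CARD('n). \<Sum>s\<in>UNIV. (cmod (\<Sum>\<beta><CARD('n). \<Sum>t\<in>UNIV. ?x \<alpha> \<beta> (s, t) * \<zeta> \<beta> t))\<^sup>2)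
        \<le> (\<Sum>\<beta><CARD('n). \<Sum>t\<in>UNIV. (cmod (\<zeta> \<beta> t))\<^sup>2)" .
  qed
  have "S1_os ?K ?a \<le> ennreal C" using v by (simp add: rect_norm_def)
  from S1_os_leD[OF C this x, of ?\<zeta>]
  have bd: "(\<Sum>\<alpha><CARD('n). \<Sum>i<?K. (cmod (?L \<alpha> i))\<^sup>2) \<le> C\<^sup>2 * (\<Sum>\<beta><CARD('n). \<Sum>j<?K. (cmod (?\<zeta> \<beta> j))\<^sup>2)" .
  have L: "?L (e v) i = w i 0 (\<rho> v, q)" if "i < r" for v i
  proof -
    have pair: "(\<Sum>s\<in>UNIV. \<Sum>t\<in>UNIV. ?a i 0 (t, s) * ?x (e v) 0 (s, t)) = w i 0 (\<rho> v, q)"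
    proof -
      have "?a i 0 (t, s) * ?x (e v) 0 (s, t) = (if t = \<rho> v then if s = q then w i 0 (\<rho> v, q) else 0 else 0)" for s t
        using that k by (auto simp: inv_enum)
      then show ?thesis by simp
    qed
    have "?L (e v) i = (\<Sum>\<beta><CARD('n). \<Sum>j<?K. if j = 0 then if \<beta> = 0 then
        (\<Sum>s\<in>UNIV. \<Sum>t\<in>UNIV. ?a i 0 (t, s) * ?x (e v) 0 (s, t)) else 0 else 0)"
    proof (intro sum.cong refl)
      fix \<beta> j
      show "(\<Sum>s\<in>UNIV. \<Sum>t\<in>UNIV. ?a i j (t, s) * ?x (e v) \<beta> (s, t)) * ?\<zeta> \<beta> j =
          (if j = 0 then if \<beta> = 0 then (\<Sum>s\<in>UNIV. \<Sum>t\<in>UNIV. ?a i 0 (t, s) * ?x (e v) 0 (s, t)) else 0 else 0)"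
        by (cases "j = 0"; cases "\<beta> = 0") simp_all
    qed
    also have "\<dots> = w i 0 (\<rho> v, q)" unfolding pair using k by (simp add: less_max_iff_disj)
    finally show ?thesis .
  qed
  have "(\<Sum>l<r. \<Sum>v\<in>UNIV. (cmod (w l 0 (\<rho> v, q)))\<^sup>2) = (\<Sum>v\<in>UNIV. \<Sum>i<r. (cmod (?L (e v) i))\<^sup>2)"
    by (subst sum.swap, intro sum.cong refl, subst L) simp_all
  also have "\<dots> \<le> (\<Sum>v\<in>UNIV. \<Sum>i<?K. (cmod (?L (e v) i))\<^sup>2)"
    by (intro sum_mono sum_mono2) auto
  also have "\<dots> \<le> C\<^sup>2 * (\<Sum>\<beta><CARD('n). \<Sum>j<?K. (cmod (?\<zeta> \<beta> j))\<^sup>2)"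
    using bd unfolding sum_enum[of "\<lambda>\<alpha>. \<Sum>i<?K. (cmod (?L \<alpha> i))\<^sup>2"] .
  also have "\<dots> = C\<^sup>2"
    using k by (simp add: less_max_iff_disj if_distrib[of "\<lambda>z. (cmod z)\<^sup>2"] cong: if_cong)
  finally show ?thesis .
qed

text \<open>For a factorization with factor norms \<open>C\<close> and \<open>D\<close>, fix
  \<open>q\<close> and absorb the sum over \<open>p\<close> by \<open>rect_S1_rows_bound\<close>,
  with the entries of \<open>v\<close> as the vector \<open>y\<close>. The column bound gives
  \<open>Y q \<le> D\<^sup>2\<close>, and summing over \<open>q\<close> costs a second factor n, so
  the double sum is at most the square of \<open>n * C * D\<close>. Orthogonality is required only
  in \<open>p\<close>, the index of the left factor; the choice of order exploits this.\<close>

lemma haagerup_S1_lower_bound: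
  fixes \<phi> :: "'n \<Rightarrow> 'n \<Rightarrow> 'n \<Rightarrow> complex" and \<tau> :: "'n \<Rightarrow> 'n \<Rightarrow> 'n \<Rightarrow> 'n" and \<rho> :: "'n \<Rightarrow> 'n \<Rightarrow> 'n"
  assumes orth: "\<And>q p p'. (\<Sum>v\<in>UNIV. if \<tau> p q v = \<tau> p' q v then cnj (\<phi> p q v) * \<phi> p' q v else 0) =
      (if p = p' then of_nat CARD('n) else 0)"
    and \<rho>: "\<And>q. inj (\<rho> q)" and \<iota>: "\<And>p q. \<iota> p q < k"
  shows "ennreal (sqrt (\<Sum>p\<in>UNIV. \<Sum>q\<in>UNIV.
      (cmod (\<Sum>v\<in>UNIV. cnj (\<phi> p q v) * w (\<iota> p q) 0 ((\<tau> p q v, p), (\<rho> q v, q))))\<^sup>2) / CARD('n))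
    \<le> haagerup S1_os S1_os k w"
  unfolding haagerup_def
proof (rule INF_greatest, clarify)
  fix r :: nat and u v :: "nat \<Rightarrow> nat \<Rightarrow> 'n \<times> 'n \<Rightarrow> complex"
  assume w: "\<forall>i<k. \<forall>j<k. \<forall>a b. w i j (a, b) = (\<Sum>l<r. u i l a * v l j b)"
  let ?n = "real CARD('n)"
  let ?U = "rect_norm S1_os k r u" and ?V = "rect_norm S1_os r k v"
  let ?S = "\<Sum>p\<in>UNIV. \<Sum>q\<in>UNIV. (cmod (\<Sum>t\<in>UNIV. cnj (\<phi> p q t) * w (\<iota> p q) 0 ((\<tau> p q t, p), (\<rho> q t, q))))\<^sup>2"
  define Y where "Y = (\<lambda>q. \<Sum>l<r. \<Sum>t\<in>UNIV. (cmod (v l 0 (\<rho> q t, q)))\<^sup>2)"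
  have k: "k > 0" using \<iota> by (metis not_less_zero gr0I)
  have inner: "(\<Sum>t\<in>UNIV. cnj (\<phi> p q t) * w (\<iota> p q) 0 ((\<tau> p q t, p), (\<rho> q t, q))) =
      (\<Sum>l<r. \<Sum>t\<in>UNIV. cnj (\<phi> p q t) * u (\<iota> p q) l (\<tau> p q t, p) * v l 0 (\<rho> q t, q))" for p q
    by (subst sum.swap) (simp add: w \<iota> k sum_distrib_left mult.assoc)
  have S: "?S = (\<Sum>q\<in>UNIV. \<Sum>p\<in>UNIV.
      (cmod (\<Sum>l<r. \<Sum>t\<in>UNIV. cnj (\<phi> p q t) * u (\<iota> p q) l (\<tau> p q t, p) * v l 0 (\<rho> q t, q)))\<^sup>2)"
    unfolding inner by (rule sum.swap)
  have US: "?S \<le> ?n * C\<^sup>2 * (\<Sum>q\<in>UNIV. Y q)" if "?U \<le> ennreal C" "C \<ge> 0" for C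
    unfolding S Y_def sum_distrib_left[of _ Y UNIV, unfolded Y_def]
    by (rule sum_mono) (rule rect_S1_rows_bound[OF orth that \<iota>])
  have VS: "(\<Sum>q\<in>UNIV. Y q) \<le> ?n * D\<^sup>2" if "?V \<le> ennreal D" "D \<ge> 0" for D
  proof -
    have "(\<Sum>q\<in>UNIV. Y q) \<le> (\<Sum>q\<in>(UNIV :: 'n set). D\<^sup>2)"
      unfolding Y_def by (rule sum_mono) (rule rect_S1_column_bound[OF that k \<rho>])
    then show ?thesis by simp
  qed
  have Y0: "Y q \<ge> 0" for q unfolding Y_def by (intro sum_nonneg) auto
  have S0: "?S \<ge> 0" by (intro sum_nonneg) auto
  \<comment> \<open>In \<open>ennreal\<close> the product of 0 and \<open>top\<close> is 0, so a
    vanishing factor norm must force the sum itself to vanish even when the other factor norm is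
    infinite.\<close>
  consider "?U = 0" | "?V = 0" | "?U \<noteq> 0" "?V \<noteq> 0" "?U = top \<or> ?V = top" | "?U \<noteq> top" "?V \<noteq> top"
    by blast
  then show "ennreal (sqrt ?S / ?n) \<le> ?U * ?V"
  proof cases
    case 1
    then have "?S = 0" using US[of 0] S0 by simp
    then show ?thesis by simp
  next
    case 2
    then have "(\<Sum>q\<in>UNIV. Y q) = 0" using VS[of 0] Y0 by (simp add: sum_nonneg order_antisym)
    then have "Y q = 0" for q using Y0 by (simp add: sum_nonneg_eq_0_iff)
    then have "v l 0 (\<rho> q t, q) = 0" if "l < r" for l q t
      using that by (simp add: Y_def sum_nonneg_eq_0_iff sum_nonneg)
    then have "?S = 0" unfolding S by simp
    then show ?thesis by simp
  next
    case 3
    then show ?thesis by (auto simp: ennreal_mult_top ennreal_top_mult)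
  next
    case 4
    define C D where "C = enn2real ?U" and "D = enn2real ?V"
    have C: "?U = ennreal C" "C \<ge> 0" and D: "?V = ennreal D" "D \<ge> 0"
      using 4 by (auto simp: C_def D_def less_top)
    have "?S \<le> ?n * C\<^sup>2 * (?n * D\<^sup>2)"
      by (rule order_trans[OF US mult_left_mono[OF VS]]) (use C D in auto)
    then have "?S \<le> (?n * (C * D))\<^sup>2" by (simp add: power2_eq_square mult_ac)
    then have "sqrt ?S \<le> ?n * (C * D)" using C D by (intro real_le_lsqrt) auto
    then have "sqrt ?S / ?n \<le> C * D" by (simp add: divide_le_eq mult.commute)
    then show ?thesis unfolding C(1) D(1) ennreal_mult[OF C(2) D(2), symmetric] by (rule ennreal_leI)
  qed
qed

end

section \<open>Commuting families of operators\<close>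

context
  fixes I :: "'i set" and A B :: "'n::finite \<Rightarrow> 'n \<Rightarrow> 'i oper"
    and \<psi> :: "'n \<Rightarrow> 'n \<Rightarrow> 'n \<Rightarrow> complex" and \<sigma> :: "'n \<Rightarrow> 'n \<Rightarrow> 'n"
  assumes A: "\<And>s t. A s t \<in> bounded_ops I" and B: "\<And>u v. B u v \<in> bounded_ops I"
    and comm: "\<And>s t u v \<xi>. \<xi> \<in> ell2 I \<Longrightarrow> A s t (B u v \<xi>) = B u v (A s t \<xi>)"
      "\<And>s t u v \<xi>. \<xi> \<in> ell2 I \<Longrightarrow> A s t (adj I (B u v) \<xi>) = adj I (B u v) (A s t \<xi>)"
    and row: "\<And>s y. (\<And>t. y t \<in> ell2 I) \<Longrightarrow>
        (l2norm (\<lambda>i. \<Sum>t\<in>UNIV. A s t (y t) i))\<^sup>2 \<le> (\<Sum>t\<in>UNIV. (l2norm (y t))\<^sup>2)"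
      "\<And>u y. (\<And>v. y v \<in> ell2 I) \<Longrightarrow>
        (l2norm (\<lambda>i. \<Sum>v\<in>UNIV. B u v (y v) i))\<^sup>2 \<le> (\<Sum>v\<in>UNIV. (l2norm (y v))\<^sup>2)"
    and column: "\<And>t \<xi>. \<xi> \<in> ell2 I \<Longrightarrow> (\<Sum>s\<in>UNIV. (l2norm (A s t \<xi>))\<^sup>2) \<le> (l2norm \<xi>)\<^sup>2"
      "\<And>v \<xi>. \<xi> \<in> ell2 I \<Longrightarrow> (\<Sum>u\<in>UNIV. (l2norm (B u v \<xi>))\<^sup>2) \<le> (l2norm \<xi>)\<^sup>2"
    and \<psi>: "\<And>s u v. cmod (\<psi> s u v) = 1" and \<sigma>: "\<And>s. bij (\<sigma> s)"
begin

lemma sum_shift: "(\<Sum>v\<in>UNIV. f (\<sigma> s v)) = (\<Sum>t\<in>UNIV. f t)"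
  by (rule sum.reindex_bij_betw[OF \<sigma>])

lemma entries_bound:
  assumes \<xi>: "\<xi> \<in> ell2 I"
  shows "(\<Sum>s\<in>UNIV. \<Sum>t\<in>UNIV. (l2norm (A s t \<xi>))\<^sup>2) \<le> real CARD('n) * (l2norm \<xi>)\<^sup>2"
    and "(\<Sum>u\<in>UNIV. \<Sum>v\<in>UNIV. (l2norm (B u v \<xi>))\<^sup>2) \<le> real CARD('n) * (l2norm \<xi>)\<^sup>2"
  by (subst sum.swap, rule order_trans[OF sum_mono[OF column(1)[OF \<xi>]]], simp)
    (subst sum.swap, rule order_trans[OF sum_mono[OF column(2)[OF \<xi>]]], simp)

text \<open>For fixed \<open>s\<close> and \<open>u\<close> the vector is the row \<open>A s\<close>
  applied to the \<open>B u v \<xi>\<close> with phases, relisted by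
  \<open>t = \<sigma> s v\<close>. The row bound leaves the entries of \<open>B\<close>; these
  contribute one factor n, and the sum over \<open>s\<close> the other.\<close>

lemma commuting_sum_trivial_bound:
  assumes \<xi>: "\<xi> \<in> ell2 I"
  shows "(\<Sum>s\<in>UNIV. \<Sum>u\<in>UNIV. (l2norm (\<lambda>i. \<Sum>v\<in>UNIV. \<psi> s u v * A s (\<sigma> s v) (B u v \<xi>) i))\<^sup>2)
    \<le> (real CARD('n))\<^sup>2 * (l2norm \<xi>)\<^sup>2"
proof -
  note b = bounded_opsD(1)[OF B \<xi>]
  have "(l2norm (\<lambda>i. \<Sum>v\<in>UNIV. \<psi> s u v * A s (\<sigma> s v) (B u v \<xi>) i))\<^sup>2 \<le> (\<Sum>v\<in>UNIV. (l2norm (B u v \<xi>))\<^sup>2)" for s u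
  proof -
    let ?w = "inv (\<sigma> s)"
    let ?y = "\<lambda>t i. \<psi> s u (?w t) * B u (?w t) \<xi> i"
    have w: "?w (\<sigma> s v) = v" for v using \<sigma>[of s] by (simp add: bij_is_inj)
    have "(\<Sum>t\<in>UNIV. A s t (?y t) i) = (\<Sum>v\<in>UNIV. \<psi> s u v * A s (\<sigma> s v) (B u v \<xi>) i)" for i
      by (subst sum_shift[of _ s, symmetric]) (simp add: bounded_ops_scale[OF A b] w)
    then have "(l2norm (\<lambda>i. \<Sum>v\<in>UNIV. \<psi> s u v * A s (\<sigma> s v) (B u v \<xi>) i))\<^sup>2 =
        (l2norm (\<lambda>i. \<Sum>t\<in>UNIV. A s t (?y t) i))\<^sup>2"
      by simp
    also have "\<dots> \<le> (\<Sum>t\<in>UNIV. (l2norm (?y t))\<^sup>2)"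
      by (intro row(1) ell2_scale b)
    also have "\<dots> = (\<Sum>v\<in>UNIV. (l2norm (B u v \<xi>))\<^sup>2)"
      by (subst sum_shift[of _ s, symmetric]) (simp add: l2norm_scale \<psi> w)
    finally show ?thesis .
  qed
  then have "(\<Sum>s\<in>UNIV. \<Sum>u\<in>UNIV. (l2norm (\<lambda>i. \<Sum>v\<in>UNIV. \<psi> s u v * A s (\<sigma> s v) (B u v \<xi>) i))\<^sup>2)
      \<le> (\<Sum>s\<in>(UNIV :: 'n set). \<Sum>u\<in>UNIV. \<Sum>v\<in>UNIV. (l2norm (B u v \<xi>))\<^sup>2)"
    by (intro sum_mono)
  also have "\<dots> \<le> (\<Sum>s\<in>(UNIV :: 'n set). real CARD('n) * (l2norm \<xi>)\<^sup>2)"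
    by (intro sum_mono entries_bound \<xi>)
  finally show ?thesis by (simp add: power2_eq_square mult.assoc)
qed

text \<open>This separates the variables: with \<open>t\<close> and \<open>t'\<close> functions of
  \<open>s\<close>, \<open>v\<close> and \<open>v'\<close>, the left vector depends on
  \<open>s\<close> but not on \<open>u\<close>, the right one on \<open>u\<close> but not on
  \<open>s\<close>. The first relation in \<open>comm\<close> frees \<open>B u v\<close> to pass to
  the right as an adjoint; the second carries that adjoint past \<open>A s t'\<close>.\<close>

lemma commuting_inner:
  assumes \<xi>: "\<xi> \<in> ell2 I"
  shows "l2inner (A s t (B u v \<xi>)) (A s t' (B u v' \<xi>)) =
    l2inner (adj I (A s t') (A s t \<xi>)) (adj I (B u v) (B u v' \<xi>))"
proof -
  note a = bounded_opsD(1)[OF A] and b = bounded_opsD(1)[OF B]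
    and a' = bounded_opsD(1)[OF adj_bounded[OF A]] and b' = bounded_opsD(1)[OF adj_bounded[OF B]]
  let ?z = "adj I (B u v) (B u v' \<xi>)"
  have "l2inner (A s t (B u v \<xi>)) (A s t' (B u v' \<xi>)) = l2inner (A s t \<xi>) (adj I (B u v) (A s t' (B u v' \<xi>)))"
    by (subst comm(1)[OF \<xi>]) (rule adj_property[OF B a[OF \<xi>] a[OF b[OF \<xi>]]])
  also have "\<dots> = cnj (l2inner (A s t' ?z) (A s t \<xi>))"
    by (simp only: comm(2)[OF b[OF \<xi>]] l2inner_cnj)
  also have "\<dots> = l2inner (adj I (A s t') (A s t \<xi>)) ?z"
    by (simp only: adj_property[OF A b'[OF b[OF \<xi>]] a[OF \<xi>]] l2inner_cnj)
  finally show ?thesis .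
qed

lemma commuting_sum_bound:
  assumes \<xi>: "\<xi> \<in> ell2 I" and C: "C > 0"
    and uniform: "\<And>v v' z. v \<noteq> v' \<Longrightarrow>
      (\<Sum>s\<in>UNIV. (cmod (\<Sum>u\<in>UNIV. cnj (\<psi> s u v) * \<psi> s u v' * z u))\<^sup>2) \<le> C\<^sup>2 * (\<Sum>u\<in>UNIV. (cmod (z u))\<^sup>2)"
  shows "(\<Sum>s\<in>UNIV. \<Sum>u\<in>UNIV. (l2norm (\<lambda>i. \<Sum>v\<in>UNIV. \<psi> s u v * A s (\<sigma> s v) (B u v \<xi>) i))\<^sup>2)
    \<le> (1 + C) * real CARD('n) * (l2norm \<xi>)\<^sup>2"
proof -
  note a = bounded_opsD(1)[OF A] and b = bounded_opsD(1)[OF B]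
    and a' = bounded_opsD(1)[OF adj_bounded[OF A]] and b' = bounded_opsD(1)[OF adj_bounded[OF B]]
  define x where "x = (\<lambda>v v' s. adj I (A s (\<sigma> s v')) (A s (\<sigma> s v) \<xi>))"
  define z where "z = (\<lambda>v v' u. adj I (B u v) (B u v' \<xi>))"
  define k where "k = (\<lambda>v v' s u. cnj (\<psi> s u v) * \<psi> s u v')"
  define G where "G = (\<lambda>v v'. \<Sum>s\<in>UNIV. \<Sum>u\<in>UNIV. k v v' s u * l2inner (x v v' s) (z v v' u))"
  define X where "X = (\<lambda>v v'. \<Sum>s\<in>UNIV. (l2norm (x v v' s))\<^sup>2)"
  define Z where "Z = (\<lambda>v v'. \<Sum>u\<in>UNIV. (l2norm (z v v' u))\<^sup>2)"
  define D where "D = (\<lambda>v. \<Sum>s\<in>UNIV. (l2norm (A s (\<sigma> s v) \<xi>))\<^sup>2)"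
  let ?S = "\<Sum>s\<in>UNIV. \<Sum>u\<in>UNIV. (l2norm (\<lambda>i. \<Sum>v\<in>UNIV. \<psi> s u v * A s (\<sigma> s v) (B u v \<xi>) i))\<^sup>2"
  let ?n = "real CARD('n)"
  have x: "x v v' s \<in> ell2 I" and z: "z v v' u \<in> ell2 I" for v v' s u
    unfolding x_def z_def by (intro a' a b' b \<xi>)+
  have "complex_of_real ?S = (\<Sum>s\<in>UNIV. \<Sum>u\<in>UNIV. \<Sum>v\<in>UNIV. \<Sum>v'\<in>UNIV. k v v' s u * l2inner (x v v' s) (z v v' u))"
    unfolding of_real_sum k_def x_def z_def commuting_inner[OF \<xi>, symmetric]
    by (intro sum.cong refl l2norm_sq_sum) (auto intro: a b \<xi>)
  also have "\<dots> = (\<Sum>v\<in>UNIV. \<Sum>v'\<in>UNIV. G v v')"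
    unfolding G_def by (rule sum_swap_pairs)
  finally have S: "complex_of_real ?S = (\<Sum>v\<in>UNIV. \<Sum>v'\<in>UNIV. G v v')" .
  \<comment> \<open>On the diagonal the phases cancel and each term is a squared norm; the column
    bound for \<open>B\<close> removes the sum over \<open>u\<close>.\<close>
  have diag: "cmod (G v v) \<le> D v" for v
  proof -
    have "k v v s u * l2inner (x v v s) (z v v u) = complex_of_real ((l2norm (B u v (A s (\<sigma> s v) \<xi>)))\<^sup>2)" for s u
    proof -
      have "k v v s u = 1" using complex_norm_square[of "\<psi> s u v"] by (simp add: k_def \<psi> mult.commute)
      then show ?thesis
        unfolding x_def z_def commuting_inner[OF \<xi>, symmetric]
        by (simp only: comm(1)[OF \<xi>] l2inner_self[OF b[OF a[OF \<xi>]]] mult_1)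
    qed
    then have "G v v = complex_of_real (\<Sum>s\<in>UNIV. \<Sum>u\<in>UNIV. (l2norm (B u v (A s (\<sigma> s v) \<xi>)))\<^sup>2)"
      unfolding G_def of_real_sum by simp
    then have "cmod (G v v) = \<bar>\<Sum>s\<in>UNIV. \<Sum>u\<in>UNIV. (l2norm (B u v (A s (\<sigma> s v) \<xi>)))\<^sup>2\<bar>"
      by (simp only: norm_of_real)
    also have "\<dots> = (\<Sum>s\<in>UNIV. \<Sum>u\<in>UNIV. (l2norm (B u v (A s (\<sigma> s v) \<xi>)))\<^sup>2)"
      by (intro abs_of_nonneg sum_nonneg) auto
    also have "\<dots> \<le> D v"
      unfolding D_def by (intro sum_mono column a \<xi>)
    finally show ?thesis .
  qed
  \<comment> \<open>The sum over \<open>u\<close> goes into the right vector. With weight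
    \<open>C\<close> the left family contributes \<open>C * X\<close> and the right one at most
    \<open>C\<^sup>2 * Z / C\<close>, so both carry the same factor.\<close>
  have off: "cmod (G v v') \<le> C / 2 * (X v v' + Z v v')" if "v \<noteq> v'" for v v'
  proof -
    let ?y = "\<lambda>s i. \<Sum>u\<in>UNIV. k v v' s u * z v v' u i"
    have y: "?y s \<in> ell2 I" for s by (intro ell2_sum ell2_scale z) simp
    have "G v v' = (\<Sum>s\<in>UNIV. l2inner (x v v' s) (?y s))"
      unfolding G_def by (simp add: l2inner_sum_right[OF _ x z])
    then have "cmod (G v v') \<le> (\<Sum>s\<in>UNIV. cmod (l2inner (x v v' s) (?y s)))"
      by (simp add: norm_sum)
    also have "\<dots> \<le> (\<Sum>s\<in>UNIV. (C * (l2norm (x v v' s))\<^sup>2 + (l2norm (?y s))\<^sup>2 / C) / 2)"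
      by (rule sum_mono) (rule cmod_l2inner_le[OF x y C])
    also have "\<dots> = (C * X v v' + (\<Sum>s\<in>UNIV. (l2norm (?y s))\<^sup>2) / C) / 2"
      by (simp add: X_def sum.distrib sum_distrib_left flip: sum_divide_distrib)
    also have "\<dots> \<le> (C * X v v' + C\<^sup>2 * Z v v' / C) / 2"
      unfolding Z_def using C
      by (intro divide_right_mono add_left_mono l2norm_matrix_bound[where I = I])
        (auto simp: k_def z intro: uniform[OF that])
    also have "\<dots> = C / 2 * (X v v' + Z v v')"
      using C by (simp add: power2_eq_square field_simps)
    finally show ?thesis .
  qed
  have X0: "X v v' \<ge> 0" and Z0: "Z v v' \<ge> 0" and D0: "D v \<ge> 0" for v v'
    unfolding X_def Z_def D_def by (intro sum_nonneg; simp)+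
  \<comment> \<open>Adding the nonnegative off-diagonal bound on the diagonal too allows
    \<open>X\<close> and \<open>Z\<close> to be summed over all pairs.\<close>
  have G: "cmod (G v v') \<le> (if v = v' then D v else 0) + C / 2 * (X v v' + Z v v')" for v v'
    using diag[of v] off[of v v'] X0[of v v'] Z0[of v v'] C by (cases "v = v'") (auto intro: add_increasing2)
  have sumD: "(\<Sum>v\<in>UNIV. D v) \<le> ?n * (l2norm \<xi>)\<^sup>2"
    unfolding D_def
    by (subst sum.swap) (simp only: sum_shift[of "\<lambda>t. (l2norm (A _ t \<xi>))\<^sup>2"] entries_bound(1)[OF \<xi>])
  \<comment> \<open>For fixed \<open>s\<close> and \<open>v\<close>, the index
    \<open>\<sigma> s v'\<close> runs over all \<open>t\<close>, so the sum over \<open>v'\<close>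
    is the adjoint column of the row \<open>A s\<close> at
    \<open>A s (\<sigma> s v) \<xi>\<close>.\<close>
  have "(\<Sum>v\<in>UNIV. \<Sum>v'\<in>UNIV. X v v') = (\<Sum>v\<in>UNIV. \<Sum>s\<in>UNIV. \<Sum>t\<in>UNIV. (l2norm (adj I (A s t) (A s (\<sigma> s v) \<xi>)))\<^sup>2)"
    unfolding X_def x_def
    by (rule sum.cong[OF refl], subst sum.swap) (simp only: sum_shift[of "\<lambda>t. (l2norm (adj I (A _ t) _))\<^sup>2"])
  also have "\<dots> \<le> (\<Sum>v\<in>UNIV. D v)"
    unfolding D_def by (intro sum_mono adj_column_bound A row a \<xi>) auto
  finally have sumX: "(\<Sum>v\<in>UNIV. \<Sum>v'\<in>UNIV. X v v') \<le> ?n * (l2norm \<xi>)\<^sup>2" using sumD by linarith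
  \<comment> \<open>Now the sum over \<open>v\<close>, taken innermost, is the adjoint column of the
    row \<open>B u\<close> at \<open>B u v' \<xi>\<close>.\<close>
  have "(\<Sum>v\<in>UNIV. \<Sum>v'\<in>UNIV. Z v v') = (\<Sum>u\<in>UNIV. \<Sum>v'\<in>UNIV. \<Sum>v\<in>UNIV. (l2norm (z v v' u))\<^sup>2)"
    unfolding Z_def by (subst sum.swap, subst (2) sum.swap, rule sum.swap)
  also have "\<dots> \<le> (\<Sum>u\<in>UNIV. \<Sum>v'\<in>UNIV. (l2norm (B u v' \<xi>))\<^sup>2)"
    unfolding z_def by (intro sum_mono adj_column_bound B row b \<xi>) auto
  also have "\<dots> \<le> ?n * (l2norm \<xi>)\<^sup>2" by (rule entries_bound(2)[OF \<xi>])
  finally have sumZ: "(\<Sum>v\<in>UNIV. \<Sum>v'\<in>UNIV. Z v v') \<le> ?n * (l2norm \<xi>)\<^sup>2" .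
  have "?S \<le> cmod (complex_of_real ?S)" by (simp only: norm_of_real abs_ge_self)
  also have "\<dots> \<le> (\<Sum>v\<in>UNIV. \<Sum>v'\<in>UNIV. cmod (G v v'))"
    unfolding S by (intro order_trans[OF norm_sum] sum_mono order_refl)
  also have "\<dots> \<le> (\<Sum>v\<in>UNIV. \<Sum>v'\<in>UNIV. (if v = v' then D v else 0) + C / 2 * (X v v' + Z v v'))"
    by (intro sum_mono G)
  also have "\<dots> = (\<Sum>v\<in>UNIV. D v) + C / 2 * ((\<Sum>v\<in>UNIV. \<Sum>v'\<in>UNIV. X v v') + (\<Sum>v\<in>UNIV. \<Sum>v'\<in>UNIV. Z v v'))"
    unfolding sum.distrib sum_distrib_left[of "C / 2", symmetric] by simp
  also have "\<dots> \<le> ?n * (l2norm \<xi>)\<^sup>2 + C / 2 * (?n * (l2norm \<xi>)\<^sup>2 + ?n * (l2norm \<xi>)\<^sup>2)"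
    using C by (intro add_mono mult_left_mono sumD sumX sumZ) auto
  also have "\<dots> = (1 + C) * ?n * (l2norm \<xi>)\<^sup>2" by (simp add: algebra_simps)
  finally show ?thesis .
qed

end

section \<open>Columns of tensors\<close>

text \<open>The map \<open>\<iota>\<close> places the pairs \<open>(s, u)\<close> among the
  components of the column space. The coordinates \<open>(t, s)\<close> and \<open>(v, u)\<close>
  are transposed to match \<open>A s t = T (unit (t, s))\<close> and
  \<open>B u v = S (unit (v, u))\<close>.\<close>

definition tensor_column ::
  "('n \<times> 'n \<Rightarrow> nat) \<Rightarrow> ('n \<Rightarrow> 'n \<Rightarrow> 'n) \<Rightarrow> ('n \<Rightarrow> 'n \<Rightarrow> 'n \<Rightarrow> complex) \<Rightarrow>
    nat \<Rightarrow> ('n \<times> 'n) \<times> ('n \<times> 'n) \<Rightarrow> complex" where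
  "tensor_column \<iota> \<sigma> \<psi> i = (\<lambda>((t, s), (v, u)). if i = \<iota> (s, u) \<and> t = \<sigma> s v then \<psi> s u v else 0)"

lemma tensor_op_column:
  fixes \<sigma> :: "'n::finite \<Rightarrow> 'n \<Rightarrow> 'n"
  assumes \<iota>: "inj \<iota>"
  shows "tensor_op T S (tensor_column \<iota> \<sigma> \<psi> (\<iota> (s, u))) \<xi> =
    (\<lambda>i. \<Sum>v\<in>UNIV. \<psi> s u v * T (unit (\<sigma> s v, s)) (S (unit (v, u)) \<xi>) i)"
proof
  fix i
  let ?g = "\<lambda>v. ((\<sigma> s v, s), (v, u))"
  show "tensor_op T S (tensor_column \<iota> \<sigma> \<psi> (\<iota> (s, u))) \<xi> i =
      (\<Sum>v\<in>UNIV. \<psi> s u v * T (unit (\<sigma> s v, s)) (S (unit (v, u)) \<xi>) i)"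
    unfolding tensor_op_def
    by (subst sum_inj_support[of UNIV ?g])
      (auto simp: tensor_column_def inj_eq[OF \<iota>] intro!: injI)
qed

text \<open>The padded square matrix has a single nonzero column, so only \<open>\<xi> 0\<close>
  matters, and components off the range of \<open>\<iota>\<close> vanish; what remains is a vector
  estimate for commuting pairs.\<close>

lemma col_min_norm_max_os_le:
  fixes \<sigma> :: "'n::finite \<Rightarrow> 'n \<Rightarrow> 'n"
  assumes \<iota>: "inj \<iota>" "\<And>p. \<iota> p < m" and K: "K \<ge> 0"
    and bd: "\<And>(I :: nat set) T S \<xi>. commuting_pair S1_os S1_os I T S \<Longrightarrow> \<xi> \<in> ell2 I \<Longrightarrow>
      (\<Sum>s\<in>UNIV. \<Sum>u\<in>UNIV. (l2norm (\<lambda>i. \<Sum>v\<in>UNIV. \<psi> s u v * T (unit (\<sigma> s v, s)) (S (unit (v, u)) \<xi>) i))\<^sup>2)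
        \<le> K\<^sup>2 * (l2norm \<xi>)\<^sup>2"
  shows "col_min_norm m (max_os S1_os S1_os) (tensor_column \<iota> \<sigma> \<psi>) \<le> ennreal K"
proof -
  let ?\<eta> = "tensor_column \<iota> \<sigma> \<psi>"
  let ?w = "\<lambda>i j. if i < m \<and> j < (1::nat) then ?\<eta> i else (\<lambda>_. 0)"
  have m: "m > 0" using \<iota>(2) by (metis not_less_zero gr0I)
  have "max_os S1_os S1_os m ?w \<le> ennreal K"
    unfolding max_os_def
  proof (rule SUP_least, clarify, rule opmat_norm_least)
    fix I :: "nat set" and T S :: "('n \<times> 'n \<Rightarrow> complex) \<Rightarrow> nat oper" and \<xi> :: "nat \<Rightarrow> nat \<Rightarrow> complex"
    assume TS: "commuting_pair S1_os S1_os I T S"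
      and \<xi>: "\<And>j. j < m \<Longrightarrow> \<xi> j \<in> ell2 I" "(\<Sum>j<m. (l2norm (\<xi> j))\<^sup>2) \<le> 1"
    have \<xi>0: "\<xi> 0 \<in> ell2 I" by (rule \<xi>(1)[OF m])
    have "(l2norm (\<xi> 0))\<^sup>2 \<le> (\<Sum>j<m. (l2norm (\<xi> j))\<^sup>2)"
      using m by (intro member_le_sum) auto
    then have \<xi>1: "(l2norm (\<xi> 0))\<^sup>2 \<le> 1" using \<xi>(2) by linarith
    have zero: "tensor_op T S (?\<eta> i) \<zeta> = (\<lambda>_. 0)" if "i \<notin> range \<iota>" for i \<zeta>
      using that by (auto simp: tensor_op_def tensor_column_def fun_eq_iff intro!: sum.neutral)
    have "(\<Sum>j<m. tensor_op T S (?w i j) (\<xi> j) x) = tensor_op T S (?\<eta> i) (\<xi> 0) x" if "i < m" for i x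
    proof -
      have "(\<Sum>j<m. tensor_op T S (?w i j) (\<xi> j) x) = (\<Sum>j\<in>{0}. tensor_op T S (?w i j) (\<xi> j) x)"
        using m by (intro sum.mono_neutral_right) (auto simp: tensor_op_def)
      then show ?thesis using that by simp
    qed
    then have "(\<Sum>i<m. (l2norm (\<lambda>x. \<Sum>j<m. tensor_op T S (?w i j) (\<xi> j) x))\<^sup>2) =
        (\<Sum>i<m. (l2norm (tensor_op T S (?\<eta> i) (\<xi> 0)))\<^sup>2)"
      by simp
    also have "\<dots> = (\<Sum>p\<in>UNIV. (l2norm (tensor_op T S (?\<eta> (\<iota> p)) (\<xi> 0)))\<^sup>2)"
      using \<iota> by (intro sum_inj_support) (auto simp: zero)
    also have "\<dots> = (\<Sum>s\<in>UNIV. \<Sum>u\<in>UNIV. (l2norm (tensor_op T S (?\<eta> (\<iota> (s, u))) (\<xi> 0)))\<^sup>2)"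
      unfolding UNIV_Times_UNIV[symmetric] sum.cartesian_product by (intro sum.cong) auto
    also have "\<dots> \<le> K\<^sup>2 * (l2norm (\<xi> 0))\<^sup>2"
      unfolding tensor_op_column[OF \<iota>(1)] by (rule bd[OF TS \<xi>0])
    also have "\<dots> \<le> K\<^sup>2 * 1" by (intro mult_left_mono \<xi>1) simp
    finally show "ennreal (sqrt (\<Sum>i<m. (l2norm (\<lambda>x. \<Sum>j<m. tensor_op T S (?w i j) (\<xi> j) x))\<^sup>2)) \<le> ennreal K"
      using K by (intro ennreal_leI real_le_lsqrt) auto
  qed
  then show ?thesis using m by (simp add: col_min_norm_def rect_norm_def max_absorb1 Suc_le_eq)
qed

lemma col_min_norm_sym_haagerup_ge:
  fixes e :: "'n::finite \<Rightarrow> nat" and \<psi> :: "'n \<Rightarrow> 'n \<Rightarrow> 'n \<Rightarrow> complex"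
  assumes e: "bij_betw e UNIV {..<CARD('n)}"
    and \<iota>: "inj \<iota>" "\<And>p. \<iota> p < m"
    and \<psi>: "\<And>s u v. cmod (\<psi> s u v) = 1"
    and \<sigma>: "\<And>s. inj (\<sigma> s)" "\<And>v. inj (\<lambda>s. \<sigma> s v)"
    and orth: "\<And>s u u'. u \<noteq> u' \<Longrightarrow> (\<Sum>v\<in>UNIV. cnj (\<psi> s u v) * \<psi> s u' v) = 0"
  shows "ennreal CARD('n) \<le> col_min_norm m (sym_haagerup S1_os S1_os) (tensor_column \<iota> \<sigma> \<psi>)"
proof -
  let ?\<eta> = "tensor_column \<iota> \<sigma> \<psi>" and ?n = "real CARD('n)"
  let ?w = "\<lambda>i j. if i < m \<and> j < (1::nat) then ?\<eta> i else (\<lambda>_. 0)"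
  have m: "m > 0" using \<iota>(2) by (metis not_less_zero gr0I)
  have n0: "?n > 0" by simp
  have \<psi>\<psi>: "cnj (\<psi> s u v) * \<psi> s u v = 1" for s u v
    using complex_norm_square[of "\<psi> s u v"] by (simp add: \<psi> mult.commute)
  have "ennreal ?n \<le> sym_haagerup S1_os S1_os m ?w"
    unfolding sym_haagerup_def
  proof (rule INF_greatest, clarify)
    fix w1 w2 :: "nat \<Rightarrow> nat \<Rightarrow> ('n \<times> 'n) \<times> ('n \<times> 'n) \<Rightarrow> complex"
    assume w: "\<forall>i<m. \<forall>j<m. \<forall>c. ?w i j c = w1 i j c + w2 i j c"
    let ?w2 = "\<lambda>i j (b, a). w2 i j (a, b)"
    define a where "a = (\<lambda>w (s, u). \<Sum>v\<in>UNIV. cnj (\<psi> s u v) * w (\<iota> (s, u)) (0::nat) ((\<sigma> s v, s), (v, u)))"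
    \<comment> \<open>In this order the left index is \<open>s\<close>, with \<open>u\<close> fixed:
      for distinct \<open>s\<close> and \<open>s'\<close> the supports \<open>\<sigma> s v\<close>
      and \<open>\<sigma> s' v\<close> never meet, whatever the phases.\<close>
    have h1: "ennreal (L2_set (\<lambda>p. cmod (a w1 p)) UNIV / ?n) \<le> haagerup S1_os S1_os m w1"
    proof -
      have "(\<Sum>v\<in>UNIV. if \<sigma> s v = \<sigma> s' v then cnj (\<psi> s u v) * \<psi> s' u v else 0) =
          (if s = s' then of_nat CARD('n) else 0)" for u s s'
        by (cases "s = s'") (auto simp: \<psi>\<psi> inj_eq[OF \<sigma>(2)] intro!: sum.neutral)
      from haagerup_S1_lower_bound[where \<tau> = "\<lambda>s u v. \<sigma> s v" and \<rho> = "\<lambda>u v. v" and \<iota> = "\<lambda>s u. \<iota> (s, u)"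
          and w = w1, OF e this _ \<iota>(2)]
      show ?thesis by (simp add: L2_set_def sum_UNIV_prod a_def)
    qed
    \<comment> \<open>After the flip the left index is \<open>u\<close>, with \<open>s\<close>
      fixed. The supports coincide, and the phases supply the orthogonality through
      \<open>orth\<close>.\<close>
    have h2: "ennreal (L2_set (\<lambda>p. cmod (a w2 p)) UNIV / ?n) \<le> haagerup S1_os S1_os m ?w2"
    proof -
      have "(\<Sum>v\<in>UNIV. if v = v then cnj (\<psi> s u v) * \<psi> s u' v else 0) =
          (if u = u' then of_nat CARD('n) else 0)" for s u u'
        by (cases "u = u'") (auto simp: \<psi>\<psi> orth)
      from haagerup_S1_lower_bound[where \<tau> = "\<lambda>u s v. v" and \<rho> = "\<lambda>s v. \<sigma> s v" and \<iota> = "\<lambda>u s. \<iota> (s, u)"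
          and w = ?w2, OF e this \<sigma>(1) \<iota>(2)]
      show ?thesis
        unfolding L2_set_def sum_UNIV_prod by (subst sum.swap) (simp add: a_def)
    qed
    have a: "a w1 p + a w2 p = ?n" for p
    proof (cases p)
      case (Pair s u)
      have "w1 (\<iota> (s, u)) 0 ((\<sigma> s v, s), (v, u)) + w2 (\<iota> (s, u)) 0 ((\<sigma> s v, s), (v, u)) = \<psi> s u v" for v
        using w[rule_format, OF \<iota>(2)[of "(s, u)"] m, of "((\<sigma> s v, s), (v, u))"] \<iota>(2)[of "(s, u)"]
        by (simp add: tensor_column_def)
      then show ?thesis
        by (simp add: Pair a_def \<psi>\<psi> flip: sum.distrib distrib_left)
    qed
    \<comment> \<open>The pairing equals n at each of the n^2 indices. By the triangle inequality in
      l2 the two summands share this norm n^2, and each of \<open>h1\<close>, \<open>h2\<close>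
      loses a factor n.\<close>
    have "?n * ?n = L2_set (\<lambda>p. ?n) (UNIV :: ('n \<times> 'n) set)"
      by (simp add: L2_set_def real_sqrt_mult)
    also have "\<dots> \<le> L2_set (\<lambda>p. cmod (a w1 p) + cmod (a w2 p)) UNIV"
    proof (rule L2_set_mono)
      fix p
      show "?n \<le> cmod (a w1 p) + cmod (a w2 p)"
        using norm_triangle_ineq[of "a w1 p" "a w2 p"] unfolding a by simp
    qed simp
    also have "\<dots> \<le> L2_set (\<lambda>p. cmod (a w1 p)) UNIV + L2_set (\<lambda>p. cmod (a w2 p)) UNIV"
      by (rule L2_set_triangle_ineq)
    finally have "?n \<le> L2_set (\<lambda>p. cmod (a w1 p)) UNIV / ?n + L2_set (\<lambda>p. cmod (a w2 p)) UNIV / ?n"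
      using n0 by (simp add: field_simps)
    then have "ennreal ?n \<le> ennreal (L2_set (\<lambda>p. cmod (a w1 p)) UNIV / ?n + L2_set (\<lambda>p. cmod (a w2 p)) UNIV / ?n)"
      by (rule ennreal_leI)
    also have "\<dots> = ennreal (L2_set (\<lambda>p. cmod (a w1 p)) UNIV / ?n) + ennreal (L2_set (\<lambda>p. cmod (a w2 p)) UNIV / ?n)"
      by (rule ennreal_plus) (simp_all add: L2_set_nonneg)
    also have "\<dots> \<le> haagerup S1_os S1_os m w1 + haagerup S1_os S1_os m ?w2"
      by (rule add_mono[OF h1 h2])
    finally show "ennreal ?n \<le> haagerup S1_os S1_os m w1 + haagerup S1_os S1_os m ?w2" .
  qed
  then show ?thesis using m by (simp add: col_min_norm_def rect_norm_def max_absorb1 Suc_le_eq)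
qed

lemma col_min_norm_max_os_tensor_column_le:
  fixes e :: "'n::finite \<Rightarrow> nat" and \<psi> :: "'n \<Rightarrow> 'n \<Rightarrow> 'n \<Rightarrow> complex"
  assumes e: "bij_betw e UNIV {..<CARD('n)}"
    and \<iota>: "inj \<iota>" "\<And>p. \<iota> p < m"
    and \<psi>: "\<And>s u v. cmod (\<psi> s u v) = 1"
    and \<sigma>: "\<And>s. bij (\<sigma> s)"
  shows "col_min_norm m (max_os S1_os S1_os) (tensor_column \<iota> \<sigma> \<psi>) \<le> ennreal CARD('n)"
    and "C > 0 \<Longrightarrow> (\<And>v v' z. v \<noteq> v' \<Longrightarrow> (\<Sum>s\<in>UNIV. (cmod (\<Sum>u\<in>UNIV. cnj (\<psi> s u v) * \<psi> s u v' * z u))\<^sup>2)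
        \<le> C\<^sup>2 * (\<Sum>u\<in>UNIV. (cmod (z u))\<^sup>2)) \<Longrightarrow>
      col_min_norm m (max_os S1_os S1_os) (tensor_column \<iota> \<sigma> \<psi>) \<le> ennreal (sqrt ((1 + C) * CARD('n)))"
proof -
  have sum_le: "(\<Sum>s\<in>UNIV. \<Sum>u\<in>UNIV. (l2norm (\<lambda>i. \<Sum>v\<in>UNIV. \<psi> s u v * T (unit (\<sigma> s v, s)) (S (unit (v, u)) \<xi>) i))\<^sup>2)
      \<le> (real CARD('n))\<^sup>2 * (l2norm \<xi>)\<^sup>2"
    "C > 0 \<Longrightarrow> (\<And>v v' z. v \<noteq> v' \<Longrightarrow> (\<Sum>s\<in>UNIV. (cmod (\<Sum>u\<in>UNIV. cnj (\<psi> s u v) * \<psi> s u v' * z u))\<^sup>2)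
        \<le> C\<^sup>2 * (\<Sum>u\<in>UNIV. (cmod (z u))\<^sup>2)) \<Longrightarrow>
      (\<Sum>s\<in>UNIV. \<Sum>u\<in>UNIV. (l2norm (\<lambda>i. \<Sum>v\<in>UNIV. \<psi> s u v * T (unit (\<sigma> s v, s)) (S (unit (v, u)) \<xi>) i))\<^sup>2)
      \<le> (1 + C) * CARD('n) * (l2norm \<xi>)\<^sup>2"
    if TS: "commuting_pair S1_os S1_os I T S" and \<xi>: "\<xi> \<in> ell2 I" for I :: "nat set" and T S \<xi>
  proof -
    let ?A = "\<lambda>s t. T (unit (t, s))" and ?B = "\<lambda>u v. S (unit (v, u))"
    have T: "complete_contraction S1_os I T" and S: "complete_contraction S1_os I S"
      and comm: "\<And>x y \<zeta>. \<zeta> \<in> ell2 I \<Longrightarrow> T x (S y \<zeta>) = S y (T x \<zeta>)"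
        "\<And>x y \<zeta>. \<zeta> \<in> ell2 I \<Longrightarrow> T x (adj I (S y) \<zeta>) = adj I (S y) (T x \<zeta>)"
      using TS by (auto simp: commuting_pair_def)
    have bT: "T x \<in> bounded_ops I" for x using T by (simp add: complete_contraction_def linear_into_def)
    have bS: "S y \<in> bounded_ops I" for y using S by (simp add: complete_contraction_def linear_into_def)
    note facts = bT bS comm S1_contraction_row[OF e T] S1_contraction_row[OF e S]
      S1_contraction_column[OF e T] S1_contraction_column[OF e S] \<psi> \<sigma> \<xi>
    show "(\<Sum>s\<in>UNIV. \<Sum>u\<in>UNIV. (l2norm (\<lambda>i. \<Sum>v\<in>UNIV. \<psi> s u v * T (unit (\<sigma> s v, s)) (S (unit (v, u)) \<xi>) i))\<^sup>2)
        \<le> (real CARD('n))\<^sup>2 * (l2norm \<xi>)\<^sup>2"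
      by (rule commuting_sum_trivial_bound[where A = ?A and B = ?B, OF facts])
    assume C: "C > 0" and uniform: "\<And>v v' z. v \<noteq> v' \<Longrightarrow>
        (\<Sum>s\<in>UNIV. (cmod (\<Sum>u\<in>UNIV. cnj (\<psi> s u v) * \<psi> s u v' * z u))\<^sup>2) \<le> C\<^sup>2 * (\<Sum>u\<in>UNIV. (cmod (z u))\<^sup>2)"
    show "(\<Sum>s\<in>UNIV. \<Sum>u\<in>UNIV. (l2norm (\<lambda>i. \<Sum>v\<in>UNIV. \<psi> s u v * T (unit (\<sigma> s v, s)) (S (unit (v, u)) \<xi>) i))\<^sup>2)
        \<le> (1 + C) * CARD('n) * (l2norm \<xi>)\<^sup>2"
      by (rule commuting_sum_bound[where A = ?A and B = ?B, OF facts C uniform])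
  qed
  show "col_min_norm m (max_os S1_os S1_os) (tensor_column \<iota> \<sigma> \<psi>) \<le> ennreal CARD('n)"
    by (rule col_min_norm_max_os_le[OF \<iota>], simp) (rule sum_le(1))
  assume C: "C > 0" and uniform: "\<And>v v' z. v \<noteq> v' \<Longrightarrow>
        (\<Sum>s\<in>UNIV. (cmod (\<Sum>u\<in>UNIV. cnj (\<psi> s u v) * \<psi> s u v' * z u))\<^sup>2) \<le> C\<^sup>2 * (\<Sum>u\<in>UNIV. (cmod (z u))\<^sup>2)"
  have "(sqrt ((1 + C) * CARD('n)))\<^sup>2 = (1 + C) * CARD('n)" using C by simp
  with sum_le(2)[OF _ _ C uniform]
  show "col_min_norm m (max_os S1_os S1_os) (tensor_column \<iota> \<sigma> \<psi>) \<le> ennreal (sqrt ((1 + C) * CARD('n)))"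
    by (intro col_min_norm_max_os_le[OF \<iota>]) (use C in simp_all)
qed

section \<open>Choice of shifts and phases for prime n\<close>

theorem theorem3p1:
  fixes n :: nat
  assumes "prime n" and "CARD('n::finite) = n"
  shows "\<exists>\<eta> :: nat \<Rightarrow> ('n \<times> 'n) \<times> ('n \<times> 'n) \<Rightarrow> complex.
           col_min_norm (n ^ 4) (max_os S1_os S1_os) \<eta> \<le> ennreal (sqrt 2 * real n powr (3 / 4)) \<and>
           col_min_norm (n ^ 4) (sym_haagerup S1_os S1_os) \<eta> \<ge> ennreal (real n)"
proof -
  have n2: "n \<ge> 2" using assms(1) by (rule prime_ge_2_nat)
  obtain e :: "'n \<Rightarrow> nat" where "bij_betw e UNIV {0..<CARD('n)}"
    using ex_bij_betw_finite_nat[of "UNIV :: 'n set"] by auto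
  then have e: "bij_betw e UNIV {..<CARD('n)}" by (simp add: lessThan_atLeast0)
  note sum_enum = sum_enum[OF e, unfolded assms(2)]
  have enum_less: "e t < n" for t using enum_less[OF e] assms(2) by simp
  have "card (UNIV :: ('n \<times> 'n) set) \<le> card {..<n ^ 4}"
    using n2 power_increasing[of 2 4 n] by (simp add: assms(2) power2_eq_square)
  then obtain \<iota> :: "'n \<times> 'n \<Rightarrow> nat" where "\<iota> ` UNIV \<subseteq> {..<n ^ 4}" "inj \<iota>"
    using card_le_inj[of "UNIV :: ('n \<times> 'n) set" "{..<n ^ 4}"] by auto
  then have \<iota>: "inj \<iota>" "\<And>p. \<iota> p < n ^ 4" by auto
  \<comment> \<open>With multiplier 0 all phases would be 1 and \<open>orth\<close> would fail at
    that \<open>s\<close>. Replacing 0 by 1 repairs this at the price of a repeated row in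
    \<open>uniform\<close>.\<close>
  define f where "f = (\<lambda>k :: nat. if k = 0 then 1 else k)"
  define \<psi> where "\<psi> = (\<lambda>s u v. chi n (int (f (e s)) * int (e u) * int (e v)))"
  define \<sigma> where "\<sigma> = (\<lambda>s v. inv e ((e v + e s) mod n))"
  have e_\<sigma>: "e (\<sigma> s v) = (e v + e s) mod n" for s v
    unfolding \<sigma>_def using n2 by (intro bij_betw_inv_into_right[OF e]) (simp add: assms(2))
  have \<sigma>: "inj (\<sigma> s)" "inj (\<lambda>s. \<sigma> s v)" for s v
  proof -
    show "inj (\<sigma> s)"
    proof (rule injI)
      fix v v' assume "\<sigma> s v = \<sigma> s v'"
      then have "(e v + e s) mod n = (e v' + e s) mod n" by (metis e_\<sigma>)
      then have "e v = e v'" by (rule add_mod_cancel_nat) (rule enum_less)+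
      then show "v = v'" by (simp add: enum_eq_iff[OF e])
    qed
    show "inj (\<lambda>s. \<sigma> s v)"
    proof (rule injI)
      fix s s' assume "\<sigma> s v = \<sigma> s' v"
      then have "(e s + e v) mod n = (e s' + e v) mod n" by (metis e_\<sigma> add.commute)
      then have "e s = e s'" by (rule add_mod_cancel_nat) (rule enum_less)+
      then show "s = s'" by (simp add: enum_eq_iff[OF e])
    qed
  qed
  have bij\<sigma>: "bij (\<sigma> s)" for s using \<sigma>(1) by (simp add: bij_betw_def finite_UNIV_inj_surj)
  have \<psi>: "cmod (\<psi> s u v) = 1" for s u v by (simp add: \<psi>_def)
  \<comment> \<open>Primality is used here: a product of two residues that are nonzero modulo n
    stays nonzero, both in \<open>orth\<close> and for the rows \<open>r k\<close>.\<close>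
  have dvd_mult: "int n dvd a * b \<longleftrightarrow> int n dvd a \<or> int n dvd b" for a b
    using assms(1) by (simp add: prime_dvd_mult_iff)
  have dvd_diff: "int n dvd int i - int j \<longleftrightarrow> i = j" if "i < n" "j < n" for i j
    using that zdvd_not_zless[of "int i - int j" "int n"] zdvd_not_zless[of "int j - int i" "int n"]
    by (cases i j rule: linorder_cases) (auto simp: dvd_diff_commute)
  have f: "\<not> int n dvd int (f (e s))" for s
    using n2 enum_less[of s] by (auto simp: f_def dest!: zdvd_imp_le)
  have orth: "(\<Sum>v\<in>UNIV. cnj (\<psi> s u v) * \<psi> s u' v) = 0" if "u \<noteq> u'" for s u u'
  proof -
    have "(\<Sum>v\<in>UNIV. cnj (\<psi> s u v) * \<psi> s u' v) = (\<Sum>v\<in>UNIV. chi n (int (f (e s)) * (int (e u') - int (e u)) * int (e v)))"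
      unfolding \<psi>_def cnj_chi chi_add[symmetric] by (simp add: algebra_simps)
    also have "\<dots> = (\<Sum>k<n. chi n (int (f (e s)) * (int (e u') - int (e u)) * int k))"
      by (rule sum_enum[symmetric])
    also have "\<dots> = 0"
      using that n2 f[of s] by (subst sum_chi) (auto simp: dvd_mult dvd_diff enum_less enum_eq_iff[OF e])
    finally show ?thesis .
  qed
  have uniform: "(\<Sum>s\<in>UNIV. (cmod (\<Sum>u\<in>UNIV. cnj (\<psi> s u v) * \<psi> s u v' * z u))\<^sup>2)
      \<le> (sqrt (2 * n))\<^sup>2 * (\<Sum>u\<in>UNIV. (cmod (z u))\<^sup>2)" if "v \<noteq> v'" for v v' z
  proof -
    define d where "d = int (e v) - int (e v')"
    define r where "r = (\<lambda>k u. chi n (int k * int (e u) * d))"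
    define F where "F = (\<lambda>k. (cmod (\<Sum>u\<in>UNIV. cnj (r k u) * z u))\<^sup>2)"
    have d: "\<not> int n dvd d" using that by (simp add: d_def dvd_diff enum_less enum_eq_iff[OF e])
    have "(\<Sum>u\<in>UNIV. cnj (r k u) * r k' u) = (if k = k' then complex_of_real n else 0)" if "k < n" "k' < n" for k k'
    proof -
      have "(\<Sum>u\<in>UNIV. cnj (r k u) * r k' u) = (\<Sum>u\<in>UNIV. chi n ((int k' - int k) * d * int (e u)))"
        unfolding r_def cnj_chi chi_add[symmetric] by (simp add: algebra_simps)
      also have "\<dots> = (\<Sum>j<n. chi n ((int k' - int k) * d * int j))"
        by (rule sum_enum[symmetric])
      finally show ?thesis using that n2 d by (subst (asm) sum_chi) (auto simp: dvd_mult dvd_diff)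
    qed
    then have F: "(\<Sum>k<n. F k) \<le> n * (\<Sum>u\<in>UNIV. (cmod (z u))\<^sup>2)"
      unfolding F_def using n2 by (intro bessel_inequality) auto
    have "cnj (\<psi> s u v) * \<psi> s u v' = cnj (r (f (e s)) u)" for s u
      unfolding \<psi>_def r_def d_def cnj_chi chi_add[symmetric] by (simp add: algebra_simps)
    then have "(\<Sum>s\<in>UNIV. (cmod (\<Sum>u\<in>UNIV. cnj (\<psi> s u v) * \<psi> s u v' * z u))\<^sup>2) = (\<Sum>s\<in>UNIV. F (f (e s)))"
      by (simp add: F_def)
    also have "\<dots> = (\<Sum>k<n. F (f k))" by (rule sum_enum[symmetric])
    \<comment> \<open>Under \<open>f\<close> the term \<open>F 0\<close> is replaced by a second
      copy of \<open>F 1\<close>. That copy is at most the whole sum, hence the constant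
      \<open>2 * n\<close> instead of n.\<close>
    also have "\<dots> \<le> (\<Sum>k<n. F k + (if k = 0 then F 1 else 0))"
      by (intro sum_mono) (auto simp: f_def F_def)
    also have "\<dots> = (\<Sum>k<n. F k) + F 1" using n2 by (simp add: sum.distrib)
    also have "F 1 \<le> (\<Sum>k<n. F k)" using n2 by (intro member_le_sum) (auto simp: F_def)
    finally show ?thesis using F by simp
  qed
  have target: "sqrt 2 * real n powr (3 / 4) = sqrt (2 * (n * sqrt n))"
  proof -
    have "real n powr (3 / 4) = sqrt (real n powr (3 / 2))"
      by (simp add: powr_half_sqrt[symmetric] powr_powr)
    also have "real n powr (3 / 2) = n * sqrt n"
      using n2 powr_add[of n 1 "1/2"] by (simp add: powr_half_sqrt)
    finally show ?thesis by (simp add: real_sqrt_mult)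
  qed
  have upper: "col_min_norm (n ^ 4) (max_os S1_os S1_os) (tensor_column \<iota> \<sigma> \<psi>) \<le> ennreal (sqrt 2 * real n powr (3 / 4))"
  proof (cases "n = 2")
    \<comment> \<open>For n = 2 the bound \<open>(1 + C) * n\<close> with
      \<open>C = sqrt (2 * n)\<close> is 6, above the target 4 sqrt 2; the trivial bound gives
      4.\<close>
    case True
    have "real n = sqrt (2 * (n * sqrt 1))" using True by simp
    also have "\<dots> \<le> sqrt 2 * real n powr (3 / 4)" unfolding target using n2 by (intro real_sqrt_le_mono mult_left_mono) auto
    finally show ?thesis
      using order_trans[OF col_min_norm_max_os_tensor_column_le(1)[OF e \<iota> \<psi> bij\<sigma>] ennreal_leI] by (simp add: assms(2))
  next
    case False
    then have n3: "real n \<ge> 3" using n2 by simp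
    \<comment> \<open>This is the required
      \<open>(1 + sqrt (2 * n)) * n \<le> 2 * (n * sqrt n)\<close> divided by n. The rational bounds
      17/12 for sqrt 2 and 12/7 for sqrt 3 fit exactly, as 2 - 17/12 = 7/12.\<close>
    have "1 \<le> (2 - sqrt 2) * sqrt n"
    proof -
      have "sqrt 2 \<le> 17 / 12" by (rule real_le_lsqrt) (simp_all add: power2_eq_square)
      moreover have "12 / 7 \<le> sqrt n" using n3 by (intro real_le_rsqrt) (simp add: power2_eq_square)
      ultimately show ?thesis using mult_mono[of "7 / 12" "2 - sqrt 2" "12 / 7" "sqrt n"] by simp
    qed
    then have "(1 + sqrt (2 * n)) * n \<le> 2 * (n * sqrt n)"
      using n2 mult_right_mono[of "1 + sqrt (2 * n)" "2 * sqrt n" n] by (simp add: real_sqrt_mult algebra_simps)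
    then have "sqrt ((1 + sqrt (2 * n)) * n) \<le> sqrt 2 * real n powr (3 / 4)"
      unfolding target by (rule real_sqrt_le_mono)
    then show ?thesis
      using order_trans[OF col_min_norm_max_os_tensor_column_le(2)[OF e \<iota> \<psi> bij\<sigma> _ uniform] ennreal_leI] n2
      by (simp add: assms(2))
  qed
  moreover have "ennreal (real n) \<le> col_min_norm (n ^ 4) (sym_haagerup S1_os S1_os) (tensor_column \<iota> \<sigma> \<psi>)"
    using col_min_norm_sym_haagerup_ge[OF e \<iota> \<psi> \<sigma> orth] by (simp add: assms(2))
  ultimately show ?thesis by blast
qed

end
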